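(* Let $K$ be a local field with finite residue field of characteristic $p$, let $e>0$ be an integer with $e\not\equiv 0\pmod p$, and let $f>0$ be an integer. Let $K_f$ be the unramified extension of $K$ of degree $f$ and $G_f=\mathrm{Gal}(K_f|K)$. Let $D,D'\subset K_f^\times/K_f^{\times e}$ be two ramified lines, and let $L=K_f(\sqrt[e]{D})$, $L'=K_f(\sqrt[e]{D'})$ be the corresponding totally ramified extensions of $K_f$ of degree $e$. Then $L$ and $L'$ are $K$-isomorphic if and only if $D'=\sigma(D)$ for some $\sigma\in G_f$.
   Context: A local field is a field complete for a discrete valuation with finite residue field. Let $w_f:K_f^\times\to\mathbf Z$ be the normalised valuation of $K_f$, and $\bar w_f:K_f^\times/K_f^{\times e}\to\mathbf Z/e\mathbf Z$ the induced map. A ramified line in $K_f^\times/K_f^{\times e}$ is a subgroup $D$ such that the restriction of $\bar w_f$ to $D$ is an isomorphism $D\to\mathbf Z/e\mathbf Z$. Every ramified line $D$ is generated by the image of a uniformiser $\varpi$ of $K_f$, and the image of $\varpi$ (the element of $D$ mapping to $1\in\mathbf Z/e\mathbf Z$) is unique; $K_f(\sqrt[e]{D})$ denotes the extension $K_f[T]/(T^e-\varpi)$, which is totally ramified of degree $e$ over $K_f$ and independent of the choice of $\varpi$ up to $K_f$-isomorphism. $G_f$ acts on the set of ramified lines through its natural action on $K_f^\times/K_f^{\times e}$. *)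

theory Defs
  imports "HOL-Algebra.Algebra"
begin

section \<open>Local fields\<close>

text \<open>
  Valuations are normalised, i.e.\ onto the integers. The value of \<open>v\<close> at \<open>\<zero>\<close> carries no
  information; \<open>val_ge x n\<close> expresses \<open>v x \<ge> n\<close> under the convention \<open>v \<zero> = \<infinity>\<close>.
\<close>

locale discretely_valued_field = field R for R (structure) +
  fixes v :: "'a \<Rightarrow> int"
  assumes val_mult:
      "\<lbrakk> x \<in> carrier R - {\<zero>}; y \<in> carrier R - {\<zero>} \<rbrakk> \<Longrightarrow> v (x \<otimes> y) = v x + v y"
    and val_add:
      "\<lbrakk> x \<in> carrier R - {\<zero>}; y \<in> carrier R - {\<zero>}; x \<oplus> y \<noteq> \<zero> \<rbrakk>
        \<Longrightarrow> min (v x) (v y) \<le> v (x \<oplus> y)"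
    and val_surj: "v ` (carrier R - {\<zero>}) = UNIV"

definition val_ge :: "('a, 'b) ring_scheme \<Rightarrow> ('a \<Rightarrow> int) \<Rightarrow> 'a \<Rightarrow> int \<Rightarrow> bool" where
  "val_ge R v x n \<longleftrightarrow> x = \<zero>\<^bsub>R\<^esub> \<or> n \<le> v x"

definition valuation_ring :: "('a, 'b) ring_scheme \<Rightarrow> ('a \<Rightarrow> int) \<Rightarrow> ('a, 'b) ring_scheme" where
  "valuation_ring R v = R \<lparr> carrier := {x \<in> carrier R. val_ge R v x 0} \<rparr>"

definition valuation_ideal :: "('a, 'b) ring_scheme \<Rightarrow> ('a \<Rightarrow> int) \<Rightarrow> 'a set" where
  "valuation_ideal R v = {x \<in> carrier R. val_ge R v x 1}"

definition residue_field :: "('a, 'b) ring_scheme \<Rightarrow> ('a \<Rightarrow> int) \<Rightarrow> 'a set ring" where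
  "residue_field R v = valuation_ring R v Quot valuation_ideal R v"

definition val_Cauchy :: "('a, 'b) ring_scheme \<Rightarrow> ('a \<Rightarrow> int) \<Rightarrow> (nat \<Rightarrow> 'a) \<Rightarrow> bool" where
  "val_Cauchy R v s \<longleftrightarrow> (\<forall>n. \<exists>N. \<forall>i\<ge>N. \<forall>j\<ge>N. val_ge R v (s i \<ominus>\<^bsub>R\<^esub> s j) n)"

definition val_tendsto :: "('a, 'b) ring_scheme \<Rightarrow> ('a \<Rightarrow> int) \<Rightarrow> (nat \<Rightarrow> 'a) \<Rightarrow> 'a \<Rightarrow> bool" where
  "val_tendsto R v s l \<longleftrightarrow> (\<forall>n. \<exists>N. \<forall>i\<ge>N. val_ge R v (s i \<ominus>\<^bsub>R\<^esub> l) n)"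

locale local_field = discretely_valued_field R v for R (structure) and v +
  assumes complete:
      "\<lbrakk> range s \<subseteq> carrier R; val_Cauchy R v s \<rbrakk> \<Longrightarrow> \<exists>l \<in> carrier R. val_tendsto R v s l"
    and finite_residue_field: "finite (carrier (residue_field R v))"

definition residue_char :: "('a, 'b) ring_scheme \<Rightarrow> ('a \<Rightarrow> int) \<Rightarrow> nat \<Rightarrow> bool" where
  "residue_char R v p \<longleftrightarrow>
     Factorial_Ring.prime p \<and> add_pow (residue_field R v) p \<one>\<^bsub>residue_field R v\<^esub> = \<zero>\<^bsub>residue_field R v\<^esub>"

section \<open>Unramified extensions and their Galois groups\<close>

text \<open>
  \<open>F\<close> is an unramified extension of degree \<open>f\<close> of its local subfield \<open>K\<close>, and \<open>w\<close> is the
  normalised valuation of \<open>F\<close>. Unramified means ramification index 1: the normalised valuation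
  of \<open>F\<close> restricts to the normalised valuation \<open>v\<close> of \<open>K\<close>. Separability of the residue
  extension is automatic, residue fields being finite, and \<open>F\<close> is itself a local field because
  it is finite over \<open>K\<close>.
\<close>

locale unramified_extension =
  base: local_field "F \<lparr> carrier := K \<rparr>" v + discretely_valued_field F w
  for F :: "('a, 'b) ring_scheme" (structure) and w :: "'a \<Rightarrow> int"
    and K :: "'a set" and v :: "'a \<Rightarrow> int" +
  fixes f :: nat
  assumes base_subfield: "subfield K F"
    and degree: "dimension f K (carrier F)"
    and unramified: "x \<in> K - {\<zero>} \<Longrightarrow> w x = v x"

definition Gal :: "('a, 'b) ring_scheme \<Rightarrow> 'a set \<Rightarrow> ('a \<Rightarrow> 'a) set" where
  "Gal F K = {\<sigma> \<in> ring_iso F F. \<sigma> \<in> extensional (carrier F) \<and> (\<forall>x\<in>K. \<sigma> x = x)}"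

section \<open>Ramified lines\<close>

definition mod_powers :: "('a, 'b) ring_scheme \<Rightarrow> nat \<Rightarrow> 'a set monoid" where
  "mod_powers F e =
     units_of F Mod ((\<lambda>x. x [^]\<^bsub>units_of F\<^esub> e) ` carrier (units_of F))"

definition induced_val :: "('a \<Rightarrow> int) \<Rightarrow> nat \<Rightarrow> 'a set \<Rightarrow> int" where
  "induced_val w e c = the_elem ((\<lambda>x. w x mod int e) ` c)"

definition ramified_line ::
    "('a, 'b) ring_scheme \<Rightarrow> ('a \<Rightarrow> int) \<Rightarrow> nat \<Rightarrow> 'a set set \<Rightarrow> bool" where
  "ramified_line F w e D \<longleftrightarrow>
     subgroup D (mod_powers F e) \<and>
     induced_val w e \<in> iso (mod_powers F e \<lparr> carrier := D \<rparr>) (integer_mod_group e)"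

text \<open>Cosets being sets, \<open>\<sigma>\<close> acts on classes by \<open>image \<sigma>\<close>, and on sets of classes accordingly.\<close>

definition act_on_line :: "('a \<Rightarrow> 'a) \<Rightarrow> 'a set set \<Rightarrow> 'a set set" where
  "act_on_line \<sigma> D = (\<lambda>c. \<sigma> ` c) ` D"

definition line_uniformiser ::
    "('a, 'b) ring_scheme \<Rightarrow> ('a \<Rightarrow> int) \<Rightarrow> 'a set set \<Rightarrow> 'a \<Rightarrow> bool" where
  "line_uniformiser F w D \<pi> \<longleftrightarrow> \<pi> \<in> carrier F - {\<zero>\<^bsub>F\<^esub>} \<and> w \<pi> = 1 \<and> (\<exists>c\<in>D. \<pi> \<in> c)"

definition radical_poly :: "('a, 'b) ring_scheme \<Rightarrow> nat \<Rightarrow> 'a \<Rightarrow> 'a list" where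
  "radical_poly F e \<pi> =
     X\<^bsub>F\<^esub> [^]\<^bsub>poly_ring F\<^esub> e \<ominus>\<^bsub>poly_ring F\<^esub> ring.poly_of_const F \<pi>"

definition radical_ext :: "('a, 'b) ring_scheme \<Rightarrow> nat \<Rightarrow> 'a \<Rightarrow> 'a list set ring" where
  "radical_ext F e \<pi> = Rupt\<^bsub>F\<^esub> (carrier F) (radical_poly F e \<pi>)"

definition radical_emb :: "('a, 'b) ring_scheme \<Rightarrow> nat \<Rightarrow> 'a \<Rightarrow> 'a \<Rightarrow> 'a list set" where
  "radical_emb F e \<pi> a =
     ring.rupture_surj F (carrier F) (radical_poly F e \<pi>) (ring.poly_of_const F a)"

definition isomorphic_over ::
    "'k set \<Rightarrow> ('a, 'c) ring_scheme \<Rightarrow> ('k \<Rightarrow> 'a) \<Rightarrow> ('b, 'd) ring_scheme \<Rightarrow> ('k \<Rightarrow> 'b) \<Rightarrow> bool" where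
  "isomorphic_over K L i L' i' \<longleftrightarrow> (\<exists>h \<in> ring_iso L L'. \<forall>a\<in>K. h (i a) = i' a)"

end

theory Submission
  imports Defs
begin

text \<open>
  Let \<open>\<mu>\<close> be the group of roots of unity in \<open>F = Kf\<close> whose order divides \<open>q - 1\<close>, where \<open>q\<close> is the
  size of the residue field. By Hensel's lemma \<open>\<mu>\<close> represents all non-zero residue classes, so the valuation ring
  of \<open>F\<close> is spanned by \<open>\<mu>\<close> over that of \<open>K\<close>. Hence automorphisms over \<open>K\<close> preserve the valuation
  of \<open>F\<close>; and since a totally ramified extension \<open>L'\<close> of \<open>F\<close> has no further roots of unity of that
  order, a \<open>K\<close>-isomorphism \<open>h\<close> from \<open>L\<close> to \<open>L'\<close> maps \<open>F\<close> onto \<open>F\<close> and restricts to some \<open>\<sigma>\<close> in the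
  Galois group. Now \<open>\<sigma> \<pi>\<close> is an \<open>e\<close>-th power in \<open>L'\<close>; comparing leading terms with respect to
  \<open>Y\<close>, where \<open>Y\<^sup>e = \<pi>'\<close>, shows that \<open>\<sigma> \<pi>\<close> agrees with \<open>c\<^sup>e \<pi>'\<close> up to a one-unit, which is an
  \<open>e\<close>-th power in \<open>F\<close>. So the classes of \<open>\<sigma> \<pi>\<close> and \<open>\<pi>'\<close> coincide, and these generate the lines.
\<close>

section \<open>Filtered rings\<close>

text \<open>Two obstacles shape the proof. First, \<open>F\<close> is given only as finite over
  \<open>K\<close>, with a valuation restricting to \<open>v\<close>; its completeness and the
  finiteness of its residue field have to be drawn from \<open>K\<close>, coordinate by coordinate,
  before Hensel's lemma can be applied in \<open>F\<close>. Second, an abstract automorphism carries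
  no compatibility with \<open>w\<close>. Roots of unity supply it: their valuation is forced to be
  zero by an algebraic equation, which every homomorphism respects. On the radical extension no
  valuation function is constructed. A decreasing filtration suffices to speak of leading terms, so
  both rings are instances of one theory of filtered rings. That \<open>p\<close> does not divide
  \<open>e\<close> enters as invertibility of \<open>e\<close> in the valuation ring: in the
  expansion of (y + d)^e the linear term e d then governs the change, which makes one-units
  \<open>e\<close>-th powers. The same expansion with exponent q - 1 produces the roots of unity and
  shows that no one-unit other than one is among them.\<close>

locale filtered_cring = cring R for R (structure) +
  fixes M :: "int \<Rightarrow> 'a set"
  assumes fil_carrier: "M n \<subseteq> carrier R"
    and fil_zero: "\<zero> \<in> M n"
    and fil_add: "\<lbrakk> x \<in> M n; y \<in> M n \<rbrakk> \<Longrightarrow> x \<oplus> y \<in> M n"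
    and fil_a_inv: "x \<in> M n \<Longrightarrow> \<ominus> x \<in> M n"
    and fil_antimono: "m \<le> n \<Longrightarrow> M n \<subseteq> M m"
    and fil_mult: "\<lbrakk> x \<in> M m; y \<in> M n \<rbrakk> \<Longrightarrow> x \<otimes> y \<in> M (m + n)"
    and fil_one: "\<one> \<in> M 0"
begin

lemma fil_closed: "x \<in> M n \<Longrightarrow> x \<in> carrier R"
  using fil_carrier by blast

lemma fil_weaken: "\<lbrakk> x \<in> M n; m \<le> n \<rbrakk> \<Longrightarrow> x \<in> M m"
  using fil_antimono by blast

lemma fil_mult_eq: "\<lbrakk> x \<in> M m; y \<in> M n; k = m + n \<rbrakk> \<Longrightarrow> x \<otimes> y \<in> M k"
  using fil_mult by simp

lemma fil_minus: "\<lbrakk> x \<in> M n; y \<in> M n \<rbrakk> \<Longrightarrow> x \<ominus> y \<in> M n"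
  by (simp add: a_minus_def fil_add fil_a_inv)

lemma fil_diff_trans:
  assumes "x \<ominus> y \<in> M n" "y \<ominus> z \<in> M n" "x \<in> carrier R" "y \<in> carrier R" "z \<in> carrier R"
  shows "x \<ominus> z \<in> M n"
proof -
  have "x \<ominus> z = (x \<ominus> y) \<oplus> (y \<ominus> z)" using assms(3-5) by algebra
  then show ?thesis using assms(1,2) fil_add by simp
qed

lemma fil_diff_sym:
  assumes "x \<ominus> y \<in> M n" "x \<in> carrier R" "y \<in> carrier R"
  shows "y \<ominus> x \<in> M n"
proof -
  have "y \<ominus> x = \<ominus> (x \<ominus> y)" using assms(2,3) by algebra
  then show ?thesis using assms(1) fil_a_inv by simp
qed

lemma fil_of_diff:
  assumes "x \<ominus> y \<in> M n" "y \<in> M n" "x \<in> carrier R"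
  shows "x \<in> M n"
proof -
  have "x = (x \<ominus> y) \<oplus> y" using assms(3) fil_closed[OF assms(2)] by algebra
  then show ?thesis using assms(1,2) fil_add by metis
qed

lemma fil_diff_mult:
  assumes "x \<ominus> x' \<in> M k" "y \<ominus> y' \<in> M l" "x' \<in> M m" "y \<in> M n" "x \<in> carrier R" "y' \<in> carrier R"
    and "j \<le> k + n" "j \<le> m + l"
  shows "x \<otimes> y \<ominus> x' \<otimes> y' \<in> M j"
proof -
  have c: "x' \<in> carrier R" "y \<in> carrier R" using assms fil_closed by auto
  have "x \<otimes> y \<ominus> x' \<otimes> y' = (x \<ominus> x') \<otimes> y \<oplus> x' \<otimes> (y \<ominus> y')" using assms(5,6) c by algebra
  moreover have "(x \<ominus> x') \<otimes> y \<in> M j" "x' \<otimes> (y \<ominus> y') \<in> M j"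
    using assms fil_mult fil_weaken by blast+
  ultimately show ?thesis using fil_add by simp
qed

lemma fil_pow: "x \<in> M m \<Longrightarrow> x [^] (n :: nat) \<in> M (int n * m)"
proof (induct n)
  case 0 then show ?case using fil_one by simp
next
  case (Suc n) then show ?case by (auto intro!: fil_mult_eq simp: algebra_simps)
qed

lemma fil_add_pow: "x \<in> M m \<Longrightarrow> add_pow R (n :: nat) x \<in> M m"
  by (induct n) (auto simp: fil_zero intro: fil_add)

text \<open>Powers preserve agreement of leading terms: the difference of the powers contains the
  difference of the bases once, and with it the extra order. This is how leading terms of
  \<open>N\<close>-th and \<open>e\<close>-th powers in the radical extension are computed.\<close>

lemma fil_pow_diff:
  assumes "x \<in> M m" "y \<in> M m" "x \<ominus> y \<in> M (m + 1)"
  shows "x [^] (n :: nat) \<ominus> y [^] n \<in> M (int n * m + 1)"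
proof (induct n)
  case 0 then show ?case using fil_zero by (simp add: a_minus_def r_neg)
next
  case (Suc n)
  show ?case
    using fil_diff_mult[OF Suc assms(3) fil_pow[OF assms(2), of n] assms(1)] fil_closed assms
    by (simp add: algebra_simps)
qed

lemma fil_pow_one_unit:
  assumes "y \<ominus> \<one> \<in> M 1" "y \<in> carrier R"
  shows "y [^] (n :: nat) \<ominus> \<one> \<in> M 1"
  using fil_pow_diff[of y 0 \<one> n] assms fil_one fil_of_diff[of y \<one> 0] fil_weaken[OF assms(1), of 0]
  by simp

text \<open>First-order expansion at a one-unit. The derivative is \<open>n\<close> times a power of
  \<open>y\<close>, and that power is congruent to one, so the linear term may be taken to be
  \<open>n\<close> times \<open>d\<close>. The error has higher order than \<open>d\<close>, which
  makes iteration possible once \<open>n\<close> is invertible.\<close>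

lemma fil_pow_taylor:
  assumes y: "y \<ominus> \<one> \<in> M 1" "y \<in> carrier R" and d: "d \<in> M k" and k: "1 \<le> k"
  shows "(y \<oplus> d) [^] (n :: nat) \<ominus> y [^] n \<ominus> add_pow R n d \<in> M (k + 1)"
proof (induct n)
  case 0 then show ?case using fil_zero by (simp add: a_minus_def r_neg)
next
  case (Suc n)
  define A B N where "A = (y \<oplus> d) [^] n" and "B = y [^] n" and "N = add_pow R n d"
  have dc: "d \<in> carrier R" using d fil_closed by blast
  have c: "A \<in> carrier R" "B \<in> carrier R" "N \<in> carrier R"
    unfolding A_def B_def N_def using y dc by auto
  have d1: "d \<in> M 1" using d k fil_weaken by blast
  have yd1: "y \<oplus> d \<ominus> \<one> \<in> M 1"
  proof -
    have "y \<oplus> d \<ominus> \<one> = (y \<ominus> \<one>) \<oplus> d" using y dc by algebra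
    then show ?thesis using y d1 fil_add by simp
  qed
  have yd0: "y \<oplus> d \<in> M 0"
    using fil_of_diff[of "y \<oplus> d" \<one> 0] yd1 fil_weaken[OF yd1, of 0] fil_one y dc by simp
  \<comment> \<open>The new error is the old one times an integral element, plus two products in
    each of which a one-unit minus one meets a factor of order \<open>k\<close>.\<close>
  have "A \<otimes> (y \<oplus> d) \<ominus> B \<otimes> y \<ominus> (N \<oplus> d)
      = (A \<ominus> B \<ominus> N) \<otimes> (y \<oplus> d) \<oplus> (B \<ominus> \<one>) \<otimes> d \<oplus> N \<otimes> (y \<oplus> d \<ominus> \<one>)"
    using c y(2) dc by (algebra, simp)
  moreover have "(A \<ominus> B \<ominus> N) \<otimes> (y \<oplus> d) \<in> M (k + 1)"
    using Suc yd0 fil_mult_eq[of _ "k + 1" _ 0] unfolding A_def B_def N_def by simp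
  moreover have "(B \<ominus> \<one>) \<otimes> d \<in> M (k + 1)"
    using fil_mult_eq[OF fil_pow_one_unit[OF y, of n] d, of "k + 1"] unfolding B_def by simp
  moreover have "N \<otimes> (y \<oplus> d \<ominus> \<one>) \<in> M (k + 1)"
    using fil_mult_eq[OF fil_add_pow[OF d, of n] yd1, of "k + 1"] unfolding N_def by simp
  ultimately have "A \<otimes> (y \<oplus> d) \<ominus> B \<otimes> y \<ominus> (N \<oplus> d) \<in> M (k + 1)"
    using fil_add by simp
  then show ?case unfolding A_def B_def N_def by simp
qed

text \<open>Writing the root as one plus \<open>d\<close>, the expansion shows that \<open>n\<close>
  times \<open>d\<close> has higher order than was known for \<open>d\<close>; dividing by
  \<open>n\<close> raises the order of \<open>d\<close> without end, and separatedness finishes.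
  Invertibility of \<open>n\<close> is given by an explicit integral inverse \<open>s\<close>
  because the lemma will be applied to a mere filtered ring.\<close>

lemma one_unit_root_of_unity:
  assumes sep: "\<And>x. (\<And>k. x \<in> M k) \<Longrightarrow> x = \<zero>"
    and y: "y \<ominus> \<one> \<in> M 1" "y \<in> carrier R" "y [^] (n :: nat) = \<one>"
    and inv: "s \<in> M 0" "s \<otimes> add_pow R n \<one> = \<one>"
  shows "y = \<one>"
proof -
  define d where "d = y \<ominus> \<one>"
  have dc: "d \<in> carrier R" and sc: "s \<in> carrier R" using y inv fil_closed unfolding d_def by auto
  have yd: "y = \<one> \<oplus> d" unfolding d_def using y(2) by algebra
  have step: "d \<in> M (int k + 1)" for k
  proof (induct k)
    case 0 then show ?case using y unfolding d_def by simp
  next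
    case (Suc k)
    have "(\<one> \<oplus> d) [^] n \<ominus> \<one> [^] n \<ominus> add_pow R n d \<in> M (int k + 1 + 1)"
      by (rule fil_pow_taylor) (use Suc fil_zero in \<open>auto simp: a_minus_def r_neg\<close>)
    then have "\<one> \<ominus> \<one> \<ominus> add_pow R n d \<in> M (int k + 1 + 1)" using y(3) yd by simp
    moreover have "\<one> \<ominus> \<one> \<ominus> add_pow R n d = \<ominus> add_pow R n d" using dc by (simp add: a_minus_def r_neg)
    ultimately have "add_pow R n d \<in> M (int k + 1 + 1)" using fil_a_inv dc by fastforce
    then have "s \<otimes> add_pow R n d \<in> M (int k + 1 + 1)" using inv fil_mult_eq[of s 0] by simp
    moreover have "s \<otimes> add_pow R n d = (s \<otimes> add_pow R n \<one>) \<otimes> d"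
      using add_pow_ldistr[of \<one> d n] dc sc by (simp add: m_assoc)
    ultimately show ?case using inv(2) dc by simp
  qed
  have "d \<in> M k" for k
    using fil_weaken[OF step[of "nat k"], of k] by simp
  then have "d = \<zero>" by (rule sep)
  then show ?thesis using yd by simp
qed

lemma fil_pow_cong:
  assumes "x \<in> M 0" "y \<in> M 0" "x \<ominus> y \<in> M k"
  shows "x [^] (n :: nat) \<ominus> y [^] n \<in> M k"
proof (induct n)
  case 0 then show ?case using fil_zero by (simp add: a_minus_def r_neg)
next
  case (Suc n)
  show ?case
    using fil_diff_mult[OF Suc assms(3) _ assms(1), of 0] fil_pow[OF assms(2), of n] fil_closed assms
    by simp
qed

lemma fil_telescope:
  assumes "\<And>n. s n \<in> carrier R" "\<And>n. s (Suc n) \<ominus> s n \<in> M (int n)"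
  shows "s (j + d) \<ominus> s j \<in> M (int j)"
proof (induct d)
  case 0 then show ?case using assms(1) fil_zero by (simp add: a_minus_def r_neg)
next
  case (Suc d)
  have "s (Suc (j + d)) \<ominus> s (j + d) \<in> M (int j)"
    using fil_weaken[OF assms(2)[of "j + d"], of "int j"] by simp
  from fil_diff_trans[OF this Suc] show ?case using assms(1) by simp
qed

end

section \<open>Discretely valued fields\<close>

context discretely_valued_field
begin

definition val_ideal :: "int \<Rightarrow> 'a set" where
  "val_ideal n = {x \<in> carrier R. val_ge R v x n}"

lemma val_one: "v \<one> = 0"
  using val_mult[of \<one> \<one>] by simp

lemma val_inv: "x \<in> carrier R - {\<zero>} \<Longrightarrow> v (inv x) = - v x"
proof -
  assume x: "x \<in> carrier R - {\<zero>}"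
  then have "x \<in> Units R" using field_Units by simp
  then have "x \<otimes> inv x = \<one>" "inv x \<in> carrier R - {\<zero>}"
    using Units_inv_Units field_Units by auto
  then show ?thesis using val_mult[OF x, of "inv x"] val_one by simp
qed

lemma inv_nonzero: "x \<in> carrier R - {\<zero>} \<Longrightarrow> inv x \<in> carrier R - {\<zero>} \<and> x \<otimes> inv x = \<one> \<and> inv x \<otimes> x = \<one>"
  using field_Units Units_inv_Units Units_r_inv Units_l_inv by metis

lemma mult_nonzero: "\<lbrakk> x \<in> carrier R - {\<zero>}; y \<in> carrier R - {\<zero>} \<rbrakk> \<Longrightarrow> x \<otimes> y \<in> carrier R - {\<zero>}"
  using integral by blast

lemma pow_nonzero: "x \<in> carrier R - {\<zero>} \<Longrightarrow> x [^] (n :: nat) \<in> carrier R - {\<zero>}"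
  by (induct n) (use mult_nonzero in auto)

lemma val_pow: "x \<in> carrier R - {\<zero>} \<Longrightarrow> v (x [^] (n :: nat)) = int n * v x"
proof (induct n)
  case 0 then show ?case using val_one by simp
next
  case (Suc n) then show ?case
    using val_mult[OF pow_nonzero[of x n]] by (simp add: algebra_simps)
qed

lemma val_a_inv: "x \<in> carrier R - {\<zero>} \<Longrightarrow> v (\<ominus> x) = v x"
proof -
  assume x: "x \<in> carrier R - {\<zero>}"
  have m: "\<ominus> \<one> \<in> carrier R - {\<zero>}"
    using one_not_zero by (metis DiffI a_inv_closed add.inv_eq_1_iff one_closed singletonD)
  have "(\<ominus> \<one>) \<otimes> (\<ominus> \<one>) = \<one>" by algebra
  then have "v (\<ominus> \<one>) = 0" using val_mult[OF m m] val_one by simp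
  moreover have "\<ominus> x = (\<ominus> \<one>) \<otimes> x" using x by (simp add: l_minus)
  ultimately show ?thesis using val_mult[OF m x] by simp
qed

lemma mem_val_ideal: "x \<in> val_ideal n \<longleftrightarrow> x \<in> carrier R \<and> (x = \<zero> \<or> n \<le> v x)"
  by (auto simp: val_ideal_def val_ge_def)

lemma val_idealD: "\<lbrakk> x \<in> val_ideal n; x \<noteq> \<zero> \<rbrakk> \<Longrightarrow> n \<le> v x"
  by (simp add: mem_val_ideal)

sublocale filtered_cring R val_ideal
proof (unfold_locales, goal_cases)
  case (3 x n y)
  then show ?case using val_add[of x y] by (fastforce simp: mem_val_ideal)
next
  case (4 x n)
  then show ?case using val_a_inv[of x] by (fastforce simp: mem_val_ideal)
next
  case (6 x m y n)
  then show ?case using val_mult[of x y] by (fastforce simp: mem_val_ideal)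
qed (auto simp: mem_val_ideal val_one)

lemma val_ideal_separated: "(\<And>k. x \<in> val_ideal k) \<Longrightarrow> x = \<zero>"
  using mem_val_ideal[of x "v x + 1"] by auto

lemma val_ideal_nat_separated:
  assumes "\<And>k :: nat. x \<in> val_ideal (int k)"
  shows "x = \<zero>"
proof (rule val_ideal_separated)
  fix k show "x \<in> val_ideal k" using fil_weaken[OF assms[of "nat k"], of k] by simp
qed

lemma one_notin_val_ideal: "\<one> \<notin> val_ideal 1"
  by (simp add: mem_val_ideal val_one)

lemma unit_iff: "x \<in> val_ideal 0 \<Longrightarrow> x \<notin> val_ideal 1 \<longleftrightarrow> x \<noteq> \<zero> \<and> v x = 0"
  by (auto simp: mem_val_ideal)

text \<open>Ultrametric principle: a perturbation of strictly larger valuation does not affect the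
  valuation. Non-vanishing of \<open>x\<close> is part of the conclusion because
  \<open>v \<zero>\<close> carries no information.\<close>

lemma val_eqI:
  assumes "x \<ominus> y \<in> val_ideal (v y + 1)" "x \<in> carrier R" "y \<in> carrier R - {\<zero>}"
  shows "x \<noteq> \<zero> \<and> v x = v y"
proof -
  have x: "x \<in> val_ideal (v y)"
    using fil_of_diff[of x y "v y"] fil_weaken[OF assms(1), of "v y"] assms(2,3)
    by (simp add: mem_val_ideal)
  have "x \<notin> val_ideal (v y + 1)"
  proof
    assume "x \<in> val_ideal (v y + 1)"
    then have "y \<in> val_ideal (v y + 1)"
      using fil_of_diff[of y x] fil_diff_sym[OF assms(1)] assms(2,3) by simp
    then show False using assms(3) by (simp add: mem_val_ideal)
  qed
  then show ?thesis using x assms(2) by (auto simp: mem_val_ideal)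
qed

section \<open>Linear combinations modulo a fractional ideal\<close>

lemma combine_val_ideal:
  assumes "set Ks \<subseteq> val_ideal n" "set us \<subseteq> val_ideal 0"
  shows "combine Ks us \<in> val_ideal n"
  using assms
proof (induct Ks us rule: combine.induct)
  case (1 k Ks u us)
  then show ?case using fil_mult[of k n u 0] fil_add by simp
qed (auto simp: fil_zero)

lemma combine_diff_left:
  assumes "list_all2 (\<lambda>a b. a \<ominus> b \<in> val_ideal n) As Bs"
    and "set As \<subseteq> carrier R" "set Bs \<subseteq> carrier R" "set us \<subseteq> val_ideal 0"
  shows "combine As us \<ominus> combine Bs us \<in> val_ideal n"
  using assms
proof (induct arbitrary: us rule: list_all2_induct)
  case Nil then show ?case using fil_zero by (simp add: a_minus_def)
next
  case (Cons a As b Bs)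
  show ?case
  proof (cases us)
    case Nil then show ?thesis using fil_zero by (simp add: a_minus_def)
  next
    case (Cons u us')
    have us: "set us' \<subseteq> val_ideal 0" "u \<in> val_ideal 0" using Cons Cons.prems by auto
    define x y where "x = combine As us'" and "y = combine Bs us'"
    have xy: "x \<in> carrier R" "y \<in> carrier R" "u \<in> carrier R" "a \<in> carrier R" "b \<in> carrier R"
      unfolding x_def y_def using Cons.prems us fil_carrier by (auto intro!: combine_in_carrier)
    have "a \<otimes> u \<oplus> x \<ominus> (b \<otimes> u \<oplus> y) = (a \<ominus> b) \<otimes> u \<oplus> (x \<ominus> y)" using xy by algebra
    moreover have "x \<ominus> y \<in> val_ideal n" unfolding x_def y_def using Cons.hyps(3)[of us'] Cons.prems us by simp
    moreover have "(a \<ominus> b) \<otimes> u \<in> val_ideal n" using Cons.hyps(1) us fil_mult by force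
    ultimately show ?thesis using fil_add by (simp add: Cons x_def y_def)
  qed
qed

lemma combine_diff_right:
  assumes "list_all2 (\<lambda>u u'. u \<ominus> u' \<in> val_ideal n) us us'"
    and "set us \<subseteq> carrier R" "set us' \<subseteq> carrier R" "set As \<subseteq> val_ideal 0"
  shows "combine As us \<ominus> combine As us' \<in> val_ideal n"
  using assms
proof (induct arbitrary: As rule: list_all2_induct)
  case Nil then show ?case using fil_zero by (simp add: a_minus_def)
next
  case (Cons u us u' us')
  show ?case
  proof (cases As)
    case Nil then show ?thesis using fil_zero by (simp add: a_minus_def)
  next
    case (Cons a As')
    have as: "set As' \<subseteq> val_ideal 0" "a \<in> val_ideal 0" using Cons Cons.prems by auto
    define x y where "x = combine As' us" and "y = combine As' us'"
    have xy: "x \<in> carrier R" "y \<in> carrier R" "u \<in> carrier R" "u' \<in> carrier R" "a \<in> carrier R"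
      unfolding x_def y_def using Cons.prems as fil_carrier by (auto intro!: combine_in_carrier)
    have "a \<otimes> u \<oplus> x \<ominus> (a \<otimes> u' \<oplus> y) = a \<otimes> (u \<ominus> u') \<oplus> (x \<ominus> y)" using xy by algebra
    moreover have "x \<ominus> y \<in> val_ideal n" unfolding x_def y_def using Cons.hyps(3)[of As'] Cons.prems as by simp
    moreover have "a \<otimes> (u \<ominus> u') \<in> val_ideal n" using Cons.hyps(1) as fil_mult by force
    ultimately show ?thesis using fil_add by (simp add: Cons x_def y_def)
  qed
qed

subsection \<open>The residue field\<close>

lemma valuation_ring_eq: "valuation_ring R v = R \<lparr> carrier := val_ideal 0 \<rparr>"
  by (simp add: valuation_ring_def val_ideal_def)

lemma valuation_ideal_eq: "valuation_ideal R v = val_ideal 1"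
  by (simp add: valuation_ideal_def val_ideal_def)

lemma valuation_subring: "subring (val_ideal 0) R"
proof (rule subringI)
  show "val_ideal 0 \<subseteq> carrier R" by (rule fil_carrier)
qed (auto intro: fil_one fil_a_inv fil_add fil_mult_eq[of _ 0 _ 0])

lemma valuation_cring: "cring (valuation_ring R v)"
  unfolding valuation_ring_eq
  using subcring_iff[OF fil_carrier, of 0] subcringI'[OF valuation_subring] by simp

lemma valuation_ring_a_inv:
  assumes "y \<in> val_ideal 0"
  shows "\<ominus>\<^bsub>valuation_ring R v\<^esub> y = \<ominus> y"
proof -
  have "subgroup (val_ideal 0) (add_monoid R)"
    using subring.axioms(1)[OF valuation_subring] .
  from add.m_inv_consistent[OF this] show ?thesis
    using assms unfolding valuation_ring_eq a_inv_def by simp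
qed

lemma valuation_ring_minus:
  assumes "y \<in> val_ideal 0"
  shows "x \<ominus>\<^bsub>valuation_ring R v\<^esub> y = x \<ominus> y"
  using valuation_ring_a_inv[OF assms] by (simp add: a_minus_def) (simp add: valuation_ring_eq)

lemma valuation_ideal_ideal: "ideal (val_ideal 1) (valuation_ring R v)"
proof (rule idealI)
  show "ring (valuation_ring R v)" using valuation_cring cring_def by blast
  interpret O: cring "valuation_ring R v" by (rule valuation_cring)
  show "subgroup (val_ideal 1) (add_monoid (valuation_ring R v))"
  proof (rule group.subgroupI[OF O.add.is_group])
    show "val_ideal 1 \<subseteq> carrier (add_monoid (valuation_ring R v))"
      using fil_antimono[of 0 1] by (simp add: valuation_ring_eq)
  next
    show "val_ideal 1 \<noteq> {}" using fil_zero by auto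
  next
    fix a assume a: "a \<in> val_ideal 1"
    then have "a \<in> val_ideal 0" using fil_weaken by force
    then have "\<ominus>\<^bsub>valuation_ring R v\<^esub> a = \<ominus> a" by (rule valuation_ring_a_inv)
    then show "inv\<^bsub>add_monoid (valuation_ring R v)\<^esub> a \<in> val_ideal 1"
      using fil_a_inv[OF a] by (simp add: a_inv_def)
  next
    fix a b assume "a \<in> val_ideal 1" "b \<in> val_ideal 1"
    then show "a \<otimes>\<^bsub>add_monoid (valuation_ring R v)\<^esub> b \<in> val_ideal 1"
      using fil_add by (simp add: valuation_ring_eq)
  qed
qed (auto simp: valuation_ring_eq intro: fil_mult_eq)

lemma residue_field_eq: "residue_field R v = valuation_ring R v Quot val_ideal 1"
  by (simp add: residue_field_def valuation_ideal_eq)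

lemma field_residue_field: "field (residue_field R v)"
proof -
  interpret O: cring "valuation_ring R v" by (rule valuation_cring)
  have "maximalideal (val_ideal 1) (valuation_ring R v)"
  proof (rule maximalidealI[OF valuation_ideal_ideal])
    show "carrier (valuation_ring R v) \<noteq> val_ideal 1"
      using fil_one one_notin_val_ideal by (auto simp: valuation_ring_eq)
  next
    fix J assume J: "ideal J (valuation_ring R v)" "val_ideal 1 \<subseteq> J" "J \<subseteq> carrier (valuation_ring R v)"
    show "J = val_ideal 1 \<or> J = carrier (valuation_ring R v)"
    proof (cases "J = val_ideal 1")
      case False
      \<comment> \<open>An element outside the ideal has valuation zero and hence an integral
        inverse, so a larger ideal contains one.\<close>
      then obtain x where x: "x \<in> J" "x \<notin> val_ideal 1" using J(2) by blast
      then have x0: "x \<in> val_ideal 0" using J(3) by (auto simp: valuation_ring_eq)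
      have xn: "x \<in> carrier R - {\<zero>}" "v x = 0" using unit_iff[OF x0] x(2) fil_closed[OF x0] by auto
      have "inv x \<in> val_ideal 0" using val_inv[OF xn(1)] xn(2) inv_nonzero[OF xn(1)]
        by (simp add: mem_val_ideal)
      then have "inv x \<otimes> x \<in> J"
        using ideal.I_l_closed[OF J(1) x(1), of "inv x"] by (simp add: valuation_ring_eq)
      then have "\<one> \<in> J" using inv_nonzero[OF xn(1)] by simp
      then show ?thesis using ideal.one_imp_carrier[OF J(1)] by (simp add: valuation_ring_eq)
    qed simp
  qed
  then show ?thesis unfolding residue_field_eq
    by (rule maximalideal.quotient_is_field) (rule valuation_cring)
qed

text \<open>The coset is formed in \<open>R\<close>; it is the same set as the coset in the
  valuation ring, whose addition is inherited.\<close>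

definition residue :: "'a \<Rightarrow> 'a set" where
  "residue x = val_ideal 1 +> x"

lemma residue_hom: "residue \<in> ring_hom (valuation_ring R v) (residue_field R v)"
proof -
  have "residue = (\<lambda>x. val_ideal 1 +>\<^bsub>valuation_ring R v\<^esub> x)"
    by (simp add: residue_def[abs_def] a_r_coset_def r_coset_def valuation_ring_eq)
  then show ?thesis
    using ideal.rcos_ring_hom[OF valuation_ideal_ideal] unfolding residue_field_eq by simp
qed

lemma residue_eq_iff:
  assumes "x \<in> val_ideal 0" "y \<in> val_ideal 0"
  shows "residue x = residue y \<longleftrightarrow> x \<ominus> y \<in> val_ideal 1"
proof -
  interpret O: cring "valuation_ring R v" by (rule valuation_cring)
  have "val_ideal 1 +> z = val_ideal 1 +>\<^bsub>valuation_ring R v\<^esub> z" for z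
    by (simp add: a_r_coset_def r_coset_def valuation_ring_eq)
  then show ?thesis
    using O.quotient_eq_iff_same_a_r_cos[OF valuation_ideal_ideal, of x y] assms
      valuation_ring_minus[OF assms(2)]
    by (simp add: residue_def) (simp add: valuation_ring_eq)
qed

lemma carrier_residue_field: "carrier (residue_field R v) = residue ` val_ideal 0"
  by (auto simp: residue_field_eq FactRing_def A_RCOSETS_def' residue_def valuation_ring_eq
      a_r_coset_def r_coset_def)

lemma residue_simps:
  shows "\<lbrakk> x \<in> val_ideal 0; y \<in> val_ideal 0 \<rbrakk> \<Longrightarrow>
          residue (x \<oplus> y) = residue x \<oplus>\<^bsub>residue_field R v\<^esub> residue y"
    and "\<lbrakk> x \<in> val_ideal 0; y \<in> val_ideal 0 \<rbrakk> \<Longrightarrow>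
          residue (x \<otimes> y) = residue x \<otimes>\<^bsub>residue_field R v\<^esub> residue y"
    and "residue \<one> = \<one>\<^bsub>residue_field R v\<^esub>"
    and "residue \<zero> = \<zero>\<^bsub>residue_field R v\<^esub>"
proof -
  interpret O: cring "valuation_ring R v" by (rule valuation_cring)
  interpret k: field "residue_field R v" by (rule field_residue_field)
  show "\<lbrakk> x \<in> val_ideal 0; y \<in> val_ideal 0 \<rbrakk> \<Longrightarrow>
          residue (x \<oplus> y) = residue x \<oplus>\<^bsub>residue_field R v\<^esub> residue y"
    using ring_hom_add[OF residue_hom, of x y] by (simp add: valuation_ring_eq)
  show "\<lbrakk> x \<in> val_ideal 0; y \<in> val_ideal 0 \<rbrakk> \<Longrightarrow>
          residue (x \<otimes> y) = residue x \<otimes>\<^bsub>residue_field R v\<^esub> residue y"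
    using ring_hom_mult[OF residue_hom, of x y] by (simp add: valuation_ring_eq)
  show "residue \<one> = \<one>\<^bsub>residue_field R v\<^esub>"
    using ring_hom_one[OF residue_hom] by (simp add: valuation_ring_eq)
  show "residue \<zero> = \<zero>\<^bsub>residue_field R v\<^esub>"
    using ring_hom_zero[OF residue_hom O.ring_axioms k.ring_axioms] by (simp add: valuation_ring_eq)
qed

lemma residue_closed: "x \<in> val_ideal 0 \<Longrightarrow> residue x \<in> carrier (residue_field R v)"
  by (simp add: carrier_residue_field)

lemma residue_pow: "x \<in> val_ideal 0 \<Longrightarrow> residue (x [^] (n :: nat)) = residue x [^]\<^bsub>residue_field R v\<^esub> n"
proof (induct n)
  case 0 then show ?case by (simp add: residue_simps)
next
  case (Suc n) then show ?case using residue_simps(2)[of "x [^] n" x] fil_pow[of x 0 n] by simp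
qed

lemma residue_add_pow: "x \<in> val_ideal 0 \<Longrightarrow> residue (add_pow R (n :: nat) x) = add_pow (residue_field R v) n (residue x)"
proof (induct n)
  case 0 then show ?case by (simp add: residue_simps add_pow_def)
next
  case (Suc n) then show ?case using residue_simps(1)[of "add_pow R n x" x] fil_add_pow[of x 0 n]
    by (simp add: add_pow_def)
qed

lemma residue_char_iff:
  "residue_char R v p \<longleftrightarrow> Factorial_Ring.prime p \<and> add_pow R p \<one> \<in> val_ideal 1"
proof -
  have "add_pow (residue_field R v) p \<one>\<^bsub>residue_field R v\<^esub> = residue (add_pow R p \<one>)"
    using residue_add_pow[OF fil_one] residue_simps(3) by simp
  moreover have "add_pow R p \<one> \<ominus> \<zero> = add_pow R p \<one>" by (simp add: a_minus_def)
  ultimately show ?thesis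
    using residue_eq_iff[OF fil_add_pow[OF fil_one] fil_zero, of p] residue_simps(4)
    by (simp add: residue_char_def)
qed

text \<open>If the image of \<open>n\<close> lay in the maximal ideal along with that of
  \<open>p\<close>, a Bezout relation between \<open>p\<close> and \<open>n\<close> would put one
  there too.\<close>

lemma coprime_unit:
  assumes "residue_char R v p" "coprime p n"
  shows "v (add_pow R n \<one>) = 0 \<and> add_pow R n \<one> \<noteq> \<zero>"
proof -
  have p: "add_pow R p \<one> \<in> val_ideal 1" "Factorial_Ring.prime p"
    using assms(1) residue_char_iff by auto
  have "add_pow R n \<one> \<notin> val_ideal 1"
  proof
    assume n: "add_pow R n \<one> \<in> val_ideal 1"
    have "p \<noteq> 0" using p by auto
    then obtain a b where ab: "p * a = n * b + 1"
      using bezout_nat[of p n] assms(2) by auto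
    have "add_pow R (p * a) \<one> \<in> val_ideal 1" "add_pow R (n * b) \<one> \<in> val_ideal 1"
      using fil_add_pow[OF p(1), of a] fil_add_pow[OF n, of b] add.nat_pow_pow[of \<one>]
      by (simp_all add: mult.commute)
    moreover have "add_pow R (p * a) \<one> = add_pow R (n * b) \<one> \<oplus> \<one>" unfolding ab by simp
    moreover have "\<one> = (add_pow R (n * b) \<one> \<oplus> \<one>) \<ominus> add_pow R (n * b) \<one>"
    proof -
      define z where "z = add_pow R (n * b) \<one>"
      have "z \<in> carrier R" unfolding z_def by simp
      then show ?thesis unfolding z_def[symmetric] by algebra
    qed
    ultimately have "\<one> \<in> val_ideal 1" using fil_minus by metis
    then show False using one_notin_val_ideal by blast
  qed
  then show ?thesis using unit_iff[OF fil_add_pow[OF fil_one]] by blast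
qed

text \<open>In a finite residue field with \<open>q\<close> elements, \<open>p\<close> divides \<open>q\<close> and hence not \<open>q - 1\<close>.\<close>

lemma residue_exponent:
  assumes fin: "finite (carrier (residue_field R v))" and p: "residue_char R v p"
  obtains N :: nat where "N > 0" "coprime p N"
    "\<And>x. \<lbrakk> x \<in> val_ideal 0; x \<notin> val_ideal 1 \<rbrakk> \<Longrightarrow> x [^] N \<ominus> \<one> \<in> val_ideal 1"
proof -
  interpret k: field "residue_field R v" by (rule field_residue_field)
  have pp: "Factorial_Ring.prime p" using p by (simp add: residue_char_def)
  define q where "q = order (residue_field R v)"
  \<comment> \<open>One is non-zero and annihilated by \<open>p\<close>, so its additive order is
    exactly \<open>p\<close>; Lagrange's theorem in the additive group gives the
    divisibility.\<close>
  have "p dvd q"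
  proof -
    have "add_pow (residue_field R v) p \<one>\<^bsub>residue_field R v\<^esub> = \<zero>\<^bsub>residue_field R v\<^esub>"
      using p by (simp add: residue_char_def)
    then have "k.add.ord \<one>\<^bsub>residue_field R v\<^esub> dvd p"
      using k.add.pow_eq_id[of "\<one>\<^bsub>residue_field R v\<^esub>" p] by (simp add: add_pow_def)
    moreover have "k.add.ord \<one>\<^bsub>residue_field R v\<^esub> \<noteq> 1"
      using k.add.ord_eq_1[of "\<one>\<^bsub>residue_field R v\<^esub>"] by simp
    ultimately have "k.add.ord \<one>\<^bsub>residue_field R v\<^esub> = p"
      using pp by (meson prime_nat_iff)
    moreover have "k.add.ord \<one>\<^bsub>residue_field R v\<^esub> dvd order (add_monoid (residue_field R v))"
      by (rule k.add.ord_dvd_group_order) simp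
    ultimately show ?thesis unfolding q_def by (simp add: order_def)
  qed
  have q1: "q > 1"
  proof -
    have "card {\<zero>\<^bsub>residue_field R v\<^esub>, \<one>\<^bsub>residue_field R v\<^esub>} \<le> q"
      unfolding q_def order_def by (rule card_mono[OF fin]) auto
    then show ?thesis by simp
  qed
  show thesis
  proof (rule that[of "q - 1"])
    show "q - 1 > 0" using q1 by simp
    have "\<not> p dvd q - 1"
    proof
      assume "p dvd q - 1"
      then have "p dvd q - (q - 1)" using \<open>p dvd q\<close> dvd_diff_nat by blast
      then show False using q1 pp by simp
    qed
    then show "coprime p (q - 1)" using pp prime_imp_coprime by blast
    fix x assume x: "x \<in> val_ideal 0" "x \<notin> val_ideal 1"
    interpret m: group "units_of (residue_field R v)" by (rule k.units_group)
    have "residue x \<noteq> residue \<zero>"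
      using residue_eq_iff[OF x(1) fil_zero] x fil_closed by (simp add: a_minus_def)
    then have u: "residue x \<in> Units (residue_field R v)"
      using residue_closed[OF x(1)] by (simp add: residue_simps k.field_Units)
    have "order (units_of (residue_field R v)) = q - 1"
      using fin by (simp add: q_def order_def units_of_carrier k.field_Units)
    then have "residue x [^]\<^bsub>units_of (residue_field R v)\<^esub> (q - 1) = \<one>\<^bsub>residue_field R v\<^esub>"
      using m.pow_order_eq_1[of "residue x"] u by (simp add: units_of_carrier units_of_one)
    then have "residue (x [^] (q - 1)) = residue \<one>"
      using residue_pow[OF x(1)] u by (simp add: k.units_of_pow residue_simps)
    then show "x [^] (q - 1) \<ominus> \<one> \<in> val_ideal 1"
      using residue_eq_iff[of "x [^] (q - 1)" \<one>] fil_one fil_pow[OF x(1)] by simp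
  qed
qed

end

subsection \<open>Hensel's lemma for roots of one-units\<close>

text \<open>Completeness is stated for sequences whose n-th step lies in the n-th ideal, with the
  corresponding rate of convergence. Newton iteration and successive approximation both produce such
  sequences, and in this form completeness passes from \<open>K\<close> to \<open>F\<close>.\<close>

locale complete_valued_field = discretely_valued_field +
  assumes step_complete:
    "\<lbrakk> \<And>n. s n \<in> carrier R; \<And>n. s (Suc n) \<ominus> s n \<in> val_ideal (int n) \<rbrakk>
      \<Longrightarrow> \<exists>l \<in> carrier R. \<forall>n. l \<ominus> s n \<in> val_ideal (int n)"
begin

text \<open>Newton's method for an \<open>n\<close>-th root of \<open>u\<close>, started at one,
  with the derivative frozen at its value \<open>n\<close> there. On one-units the true derivative
  is congruent to \<open>n\<close>, so every step still gains one order of precision.\<close>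

lemma one_unit_root:
  assumes u: "u \<in> carrier R" "u \<ominus> \<one> \<in> val_ideal 1"
    and n: "add_pow R (n :: nat) \<one> \<noteq> \<zero>" "v (add_pow R n \<one>) = 0"
  obtains y where "y \<in> carrier R" "y \<ominus> \<one> \<in> val_ideal 1" "y [^] n = u"
proof -
  define t where "t = inv (add_pow R n \<one>)"
  have nu: "add_pow R n \<one> \<in> carrier R - {\<zero>}" using n by simp
  have t0: "t \<in> val_ideal 0" and tc: "t \<in> carrier R"
    using inv_nonzero[OF nu] val_inv[OF nu] n by (auto simp: t_def mem_val_ideal)
  have tn: "add_pow R n (t \<otimes> x) = x" if "x \<in> carrier R" for x
    using that tc inv_nonzero[OF nu] add_pow_ldistr[of \<one> "t \<otimes> x" n]
    by (simp add: t_def m_assoc[symmetric])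
  define nxt where "nxt y = y \<oplus> t \<otimes> (u \<ominus> y [^] n)" for y
  define s where "s = rec_nat \<one> (\<lambda>_. nxt)"
  have s_simps: "s 0 = \<one>" "\<And>k. s (Suc k) = nxt (s k)" by (auto simp: s_def)
  \<comment> \<open>The order \<open>int k + 1\<close> starts at 1 because the initial value one
    already solves the equation modulo the maximal ideal.\<close>
  have inv: "s k \<in> carrier R \<and> s k \<ominus> \<one> \<in> val_ideal 1 \<and> u \<ominus> s k [^] n \<in> val_ideal (int k + 1)" for k
  proof (induct k)
    case 0
    have "\<one> \<ominus> \<one> \<in> val_ideal 1" using fil_zero by (simp add: a_minus_def r_neg)
    then show ?case using u by (simp add: s_simps)
  next
    case (Suc k)
    define y d where "y = s k" and "d = t \<otimes> (u \<ominus> s k [^] n)"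
    have y: "y \<in> carrier R" "y \<ominus> \<one> \<in> val_ideal 1" using Suc by (auto simp: y_def)
    have d: "d \<in> val_ideal (int k + 1)" unfolding d_def using Suc t0 by (auto intro: fil_mult_eq)
    have dc: "d \<in> carrier R" using d fil_closed by blast
    have sk: "s (Suc k) = y \<oplus> d" by (simp add: s_simps nxt_def y_def d_def)
    have "(y \<oplus> d) [^] n \<ominus> y [^] n \<ominus> add_pow R n d \<in> val_ideal (int k + 1 + 1)"
      using fil_pow_taylor[OF y(2,1) d] by simp
    moreover have "add_pow R n d = u \<ominus> y [^] n" unfolding d_def y_def using tn u Suc by simp
    moreover define Y1 Y2 where "Y1 = (y \<oplus> d) [^] n" and "Y2 = y [^] n"
    have "Y1 \<in> carrier R" "Y2 \<in> carrier R" using y dc by (auto simp: Y1_def Y2_def)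
    then have "u \<ominus> Y1 = \<ominus> (Y1 \<ominus> Y2 \<ominus> (u \<ominus> Y2))" using u(1) by algebra
    ultimately have "u \<ominus> Y1 \<in> val_ideal (int (Suc k) + 1)"
      using fil_a_inv unfolding Y1_def Y2_def by (simp add: algebra_simps)
    moreover have "y \<oplus> d \<ominus> \<one> = (y \<ominus> \<one>) \<oplus> d" using y dc by algebra
    then have "y \<oplus> d \<ominus> \<one> \<in> val_ideal 1" using y(2) fil_weaken[OF d, of 1] fil_add by simp
    ultimately show ?case using sk y dc unfolding Y1_def by simp
  qed
  have step: "s (Suc k) \<ominus> s k \<in> val_ideal (int k)" for k
  proof -
    have "t \<otimes> (u \<ominus> s k [^] n) \<in> val_ideal (int k + 1)" using inv[of k] t0 by (auto intro: fil_mult_eq)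
    then have d: "t \<otimes> (u \<ominus> s k [^] n) \<in> val_ideal (int k)" using fil_weaken by force
    define d where "d = t \<otimes> (u \<ominus> s k [^] n)"
    have "s k \<oplus> d \<ominus> s k = d" using inv[of k] fil_closed[OF d, folded d_def] by algebra
    then show ?thesis using d by (simp add: s_simps nxt_def d_def)
  qed
  obtain l where l: "l \<in> carrier R" "\<And>k. l \<ominus> s k \<in> val_ideal (int k)"
    using step_complete[of s] inv step by blast
  have l1: "l \<ominus> \<one> \<in> val_ideal 1"
    using fil_diff_trans[OF _ _ l(1), of "s 1" 1 \<one>] l(2)[of 1] inv[of 1] by simp
  have l0: "l \<in> val_ideal 0" using fil_of_diff[of l \<one> 0] fil_weaken[OF l1, of 0] fil_one l by simp
  have "u \<ominus> l [^] n \<in> val_ideal (int k)" for k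
  proof -
    have sk: "s k \<in> val_ideal 0"
      using fil_of_diff[of "s k" \<one> 0] fil_weaken[of "s k \<ominus> \<one>" 1 0] inv[of k] fil_one by simp
    have "s k [^] n \<ominus> l [^] n \<in> val_ideal (int k)"
      using fil_pow_cong[OF sk l0] fil_diff_sym[OF l(2)] l inv by simp
    then show ?thesis
      using fil_diff_trans[of u "s k [^] n"] fil_weaken[of "u \<ominus> s k [^] n" "int k + 1" "int k"] inv[of k] u l
      by simp
  qed
  then have "u \<ominus> l [^] n = \<zero>" by (rule val_ideal_nat_separated)
  then have "l [^] n = u" using u l by (metis nat_pow_closed r_right_minus_eq)
  then show thesis using that l l1 by blast
qed

text \<open>The \<open>N\<close>-th power of \<open>x\<close> is a one-unit and so has a one-unit
  \<open>N\<close>-th root \<open>y\<close>. Dividing \<open>x\<close> by \<open>y\<close> leaves a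
  root of unity and does not change the residue.\<close>

lemma teichmueller_lift:
  assumes N: "add_pow R (N :: nat) \<one> \<noteq> \<zero>" "v (add_pow R N \<one>) = 0"
    and x: "x \<in> carrier R" "x [^] N \<ominus> \<one> \<in> val_ideal 1" "N > 0"
  obtains \<tau> where "\<tau> \<in> carrier R" "\<tau> [^] N = \<one>" "\<tau> \<ominus> x \<in> val_ideal 1"
proof -
  obtain y where y: "y \<in> carrier R" "y \<ominus> \<one> \<in> val_ideal 1" "y [^] N = x [^] N"
    using one_unit_root[OF _ x(2) N] x by auto
  have xN: "x [^] N \<noteq> \<zero> \<and> v (x [^] N) = 0" using val_eqI[of "x [^] N" \<one>] x val_one by simp
  then have x0: "x \<in> carrier R - {\<zero>}" using x by (auto simp: nat_pow_zero)
  then have vx: "v x = 0" using val_pow[OF x0, of N] xN x(3) by simp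
  have yz: "y \<in> carrier R - {\<zero>}" and vy: "v y = 0" using val_eqI[of y \<one>] y val_one by auto
  define \<tau> where "\<tau> = x \<otimes> inv y"
  have tc: "\<tau> \<in> carrier R" using x inv_nonzero[OF yz] by (simp add: \<tau>_def)
  have ty: "\<tau> \<otimes> y = x" using x y(1) inv_nonzero[OF yz] by (simp add: \<tau>_def m_assoc)
  have "\<tau> [^] N \<otimes> y [^] N = y [^] N"
    using y(3) nat_pow_distrib[OF tc y(1), of N] ty by simp
  moreover have "y [^] N \<in> carrier R - {\<zero>}" using pow_nonzero[OF yz] .
  ultimately have tN: "\<tau> [^] N = \<one>" using tc y(1)
    by (metis Diff_iff insertI1 l_one m_rcancel nat_pow_closed one_closed)
  have tz: "\<tau> \<in> carrier R - {\<zero>}" using ty x0 tc y by auto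
  then have "v \<tau> = 0" using val_mult[OF tz yz] ty vx vy by simp
  then have t0: "\<tau> \<in> val_ideal 0" using tc by (simp add: mem_val_ideal)
  have "\<tau> \<ominus> x = \<ominus> (\<tau> \<otimes> (y \<ominus> \<one>))" unfolding ty[symmetric] using tc y by algebra
  moreover have "\<tau> \<otimes> (y \<ominus> \<one>) \<in> val_ideal 1" using t0 y by (auto intro: fil_mult_eq)
  ultimately have "\<tau> \<ominus> x \<in> val_ideal 1" using fil_a_inv by simp
  then show thesis using that tc tN by blast
qed

end

sublocale local_field \<subseteq> complete_valued_field
proof unfold_locales
  fix s :: "nat \<Rightarrow> 'a"
  assume s: "\<And>n. s n \<in> carrier R" "\<And>n. s (Suc n) \<ominus> s n \<in> val_ideal (int n)"
  have tel: "s i \<ominus> s j \<in> val_ideal (int j)" if "j \<le> i" for i j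
    using fil_telescope[OF s, of j "i - j"] that by simp
  have "val_Cauchy R v s"
    unfolding val_Cauchy_def
  proof (intro allI exI impI)
    fix n i j assume ij: "nat n \<le> i" "nat n \<le> j"
    have "s i \<ominus> s (nat n) \<in> val_ideal n" "s j \<ominus> s (nat n) \<in> val_ideal n"
      using fil_weaken[OF tel, of "nat n" _ n] ij by simp_all
    then have "s i \<ominus> s j \<in> val_ideal n"
      using fil_diff_trans[OF _ fil_diff_sym, of "s i" "s (nat n)" n "s j"] s by blast
    then show "val_ge R v (s i \<ominus> s j) n" by (simp add: val_ideal_def)
  qed
  then obtain l where l: "l \<in> carrier R" "val_tendsto R v s l" using complete s by blast
  have "l \<ominus> s n \<in> val_ideal (int n)" for n
  proof -
    obtain N where N: "\<forall>i\<ge>N. val_ge R v (s i \<ominus> l) (int n)" using l(2) by (auto simp: val_tendsto_def)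
    define i where "i = max N n"
    have "s i \<ominus> l \<in> val_ideal (int n)" using N s l by (simp add: val_ideal_def i_def)
    then show ?thesis
      using fil_diff_trans[OF fil_diff_sym tel[of n i], of l] s l by (simp add: i_def)
  qed
  then show "\<exists>l\<in>carrier R. \<forall>n. l \<ominus> s n \<in> val_ideal (int n)" using l by blast
qed

section \<open>Unramified extensions\<close>

context unramified_extension
begin

lemma base_in_carrier: "K \<subseteq> carrier F"
  using base_subfield subfieldE(3) by blast

lemma base_subring: "subring K F"
  using base_subfield subfieldE(1) by blast

lemma base_closed:
  "\<zero> \<in> K" "\<one> \<in> K" "\<lbrakk> x \<in> K; y \<in> K \<rbrakk> \<Longrightarrow> x \<oplus> y \<in> K" "\<lbrakk> x \<in> K; y \<in> K \<rbrakk> \<Longrightarrow> x \<otimes> y \<in> K"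
  "x \<in> K \<Longrightarrow> \<ominus> x \<in> K"
  using subringE[OF base_subring] by auto

lemma base_inv: "x \<in> K - {\<zero>} \<Longrightarrow> inv x \<in> K - {\<zero>}"
  using subfield_m_inv[OF base_subfield] by auto

lemma base_minus: "y \<in> K \<Longrightarrow> x \<ominus>\<^bsub>F\<lparr>carrier := K\<rparr>\<^esub> y = x \<ominus> y"
proof -
  assume y: "y \<in> K"
  have "subgroup K (add_monoid F)" using subring.axioms(1)[OF base_subring] .
  from add.m_inv_consistent[OF this y] show ?thesis by (simp add: a_minus_def a_inv_def)
qed

lemma base_val_ideal: "base.val_ideal n = K \<inter> val_ideal n"
proof (rule Set.set_eqI)
  fix x show "x \<in> base.val_ideal n \<longleftrightarrow> x \<in> K \<inter> val_ideal n"
    using unramified[of x] base_in_carrier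
    by (cases "x = \<zero>") (auto simp: base.mem_val_ideal mem_val_ideal)
qed

text \<open>Ramification index one in the form used below: scalars from \<open>K\<close> suffice to
  shift any non-zero element of \<open>F\<close> to valuation zero.\<close>

lemma exists_base_val: obtains c where "c \<in> K - {\<zero>}" "w c = n"
proof -
  have "n \<in> v ` (K - {\<zero>})" using base.val_surj by simp
  then show thesis using that unramified by auto
qed

text \<open>The residues of \<open>us\<close> span the residue field of \<open>F\<close> over that
  of \<open>K\<close>. The congruence form keeps coefficients in the valuation ring of
  \<open>K\<close> at hand, ready to be corrected in the next approximation; independence of
  residues is phrased in the same way.\<close>

definition residually_spanning :: "'a list \<Rightarrow> bool" where
  "residually_spanning us \<longleftrightarrow> set us \<subseteq> val_ideal 0 \<and>
     (\<forall>d \<in> val_ideal 0. \<exists>T. length T = length us \<and> set T \<subseteq> K \<inter> val_ideal 0 \<and>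
        d \<ominus> combine T us \<in> val_ideal 1)"

definition residually_independent :: "'a list \<Rightarrow> bool" where
  "residually_independent us \<longleftrightarrow> set us \<subseteq> val_ideal 0 \<and>
     (\<forall>T. length T = length us \<longrightarrow> set T \<subseteq> K \<inter> val_ideal 0 \<longrightarrow> combine T us \<in> val_ideal 1 \<longrightarrow>
        set T \<subseteq> val_ideal 1)"

text \<open>A non-trivial linear relation, scaled by a coefficient of minimal valuation, survives
  reduction to the residue field.\<close>

lemma residually_independent_imp_independent:
  assumes "residually_independent us"
  shows "independent K us"
proof (rule trivial_combine_imp_independent[OF base_subfield])
  show us: "set us \<subseteq> carrier F"
    using assms fil_carrier by (auto simp: residually_independent_def)
  fix Ks assume Ks: "set Ks \<subseteq> K" "combine Ks us = \<zero>"
  \<comment> \<open>\<open>combine\<close> stops at the end of the shorter list, so the coefficients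
    are first brought to the length of \<open>us\<close>.\<close>
  obtain Ks' where Ks': "set (take (length us) Ks) \<subseteq> set Ks'"
    "set Ks' \<subseteq> set (take (length us) Ks) \<union> {\<zero>}" "length Ks' = length us" "combine Ks' us = \<zero>"
    using combine_normalize[OF subset_trans[OF Ks(1) base_in_carrier] us Ks(2)] by metis
  have K': "set Ks' \<subseteq> K" using Ks'(2) Ks(1) base_closed(1) set_take_subset[of "length us" Ks] by auto
  have "set Ks' \<subseteq> {\<zero>}"
  proof (rule ccontr)
    assume "\<not> set Ks' \<subseteq> {\<zero>}"
    then have ne: "set Ks' - {\<zero>} \<noteq> {}" by blast
    define k where "k = arg_min_on w (set Ks' - {\<zero>})"
    have k: "k \<in> set Ks' - {\<zero>}" "\<And>y. y \<in> set Ks' - {\<zero>} \<Longrightarrow> w k \<le> w y"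
      using arg_min_if_finite(1)[OF _ ne] arg_min_least[OF _ ne] unfolding k_def by auto
    have kK: "k \<in> K - {\<zero>}" and kc: "k \<in> carrier F - {\<zero>}" using k K' base_in_carrier by auto
    define T where "T = map ((\<otimes>) (inv k)) Ks'"
    have "inv k \<otimes> y \<in> K \<inter> val_ideal 0" if "y \<in> set Ks'" for y
    proof (cases "y = \<zero>")
      case True then show ?thesis using inv_nonzero[OF kc] base_closed fil_zero by simp
    next
      case False
      then have y: "y \<in> carrier F - {\<zero>}" "y \<in> K" using that K' base_in_carrier by auto
      then have "w (inv k \<otimes> y) = w y - w k" using val_mult[of "inv k" y] inv_nonzero[OF kc] val_inv[OF kc] by simp
      then show ?thesis using k(2)[of y] that y base_inv[OF kK] base_closed inv_nonzero[OF kc] False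
        by (simp add: mem_val_ideal)
    qed
    then have T: "set T \<subseteq> K \<inter> val_ideal 0" by (auto simp: T_def)
    have "combine T us = inv k \<otimes> combine Ks' us"
      unfolding T_def using combine_r_distr[of Ks' us "inv k"] us K' base_in_carrier inv_nonzero[OF kc] by auto
    then have "combine T us \<in> val_ideal 1" using Ks'(4) inv_nonzero[OF kc] fil_zero by simp
    moreover have "length T = length us" using Ks'(3) by (simp add: T_def)
    ultimately have "set T \<subseteq> val_ideal 1"
      using assms T unfolding residually_independent_def by blast
    moreover have "\<one> \<in> set T" using k(1) inv_nonzero[OF kc] unfolding T_def by force
    ultimately show False using one_notin_val_ideal by blast
  qed
  then show "set (take (length us) Ks) \<subseteq> {\<zero>}" using Ks' by blast
qed

text \<open>Residually independent lists are independent over \<open>K\<close>, so \<open>f\<close>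
  bounds their length and there is a longest one. Adjoining an integral \<open>d\<close> to it
  creates a residual relation in which the coefficient of \<open>d\<close> is a unit; solving for
  \<open>d\<close> gives spanning.\<close>

lemma exists_residually_spanning: "\<exists>us. residually_spanning us"
proof -
  have "residually_independent []" by (simp add: residually_independent_def)
  moreover have "length us \<le> f" if "residually_independent us" for us
    using independent_length_le_dimension[OF base_subfield degree
        residually_independent_imp_independent[OF that]] that fil_carrier
    by (auto simp: residually_independent_def)
  ultimately obtain us where us: "residually_independent us"
    and max: "\<And>us'. residually_independent us' \<Longrightarrow> length us' \<le> length us"
    using ex_has_greatest_nat[of residually_independent "[]" length "Suc f"]
    unfolding less_Suc_eq_le by metis
  have us0: "set us \<subseteq> val_ideal 0" using us by (simp add: residually_independent_def)
  then have usc: "set us \<subseteq> carrier F" using fil_carrier by blast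
  have "residually_spanning us"
    unfolding residually_spanning_def
  proof (intro conjI ballI us0)
    fix d assume d: "d \<in> val_ideal 0"
    have "\<not> residually_independent (d # us)" using max[of "d # us"] by auto
    then obtain T where T: "length T = length (d # us)" "set T \<subseteq> K \<inter> val_ideal 0"
      "combine T (d # us) \<in> val_ideal 1" "\<not> set T \<subseteq> val_ideal 1"
      using d us0 by (auto simp: residually_independent_def)
    then obtain k Ks where kKs: "T = k # Ks" "length Ks = length us" by (cases T) auto
    have k: "k \<in> K" "k \<in> val_ideal 0" "set Ks \<subseteq> K \<inter> val_ideal 0" using T kKs by auto
    have kc: "k \<in> carrier F" "d \<in> carrier F" "set Ks \<subseteq> carrier F" "combine Ks us \<in> carrier F"
      using k d fil_closed base_in_carrier combine_in_carrier[OF _ usc, of Ks] by auto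
    have comb: "k \<otimes> d \<oplus> combine Ks us \<in> val_ideal 1" using T kKs by simp
    \<comment> \<open>Otherwise the \<open>d\<close> term could be dropped from the relation, and
      independence of \<open>us\<close> would put every coefficient into the maximal ideal.\<close>
    have "k \<notin> val_ideal 1"
    proof
      assume k1: "k \<in> val_ideal 1"
      then have kd: "k \<otimes> d \<in> val_ideal 1" using d by (auto intro: fil_mult_eq)
      have "combine Ks us = (k \<otimes> d \<oplus> combine Ks us) \<ominus> k \<otimes> d" using kc by algebra
      then have "combine Ks us \<in> val_ideal 1" using comb kd fil_minus by metis
      then have "set Ks \<subseteq> val_ideal 1" using us k kKs by (auto simp: residually_independent_def)
      then show False using T(4) kKs k1 by auto
    qed
    then have kn: "k \<in> carrier F - {\<zero>}" "w k = 0" "k \<in> K - {\<zero>}" using unit_iff[OF k(2)] kc k by auto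
    define i where "i = \<ominus> (inv k)"
    have i: "i \<in> K" "i \<in> val_ideal 0" "i \<in> carrier F" "i \<otimes> k = \<ominus> \<one>"
    proof -
      show "i \<in> K" unfolding i_def using base_inv[OF kn(3)] base_closed by simp
      have "inv k \<in> val_ideal 0" using inv_nonzero[OF kn(1)] val_inv[OF kn(1)] kn(2) by (simp add: mem_val_ideal)
      then show "i \<in> val_ideal 0" unfolding i_def using fil_a_inv by simp
      then show "i \<in> carrier F" using fil_closed by blast
      show "i \<otimes> k = \<ominus> \<one>" unfolding i_def using inv_nonzero[OF kn(1)] kc by (simp add: l_minus)
    qed
    define T' where "T' = map ((\<otimes>) i) Ks"
    have "combine T' us = i \<otimes> combine Ks us"
      unfolding T'_def using combine_r_distr[OF kc(3) usc i(3)] by simp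
    moreover have "d \<ominus> i \<otimes> combine Ks us = \<ominus> (i \<otimes> (k \<otimes> d \<oplus> combine Ks us))"
    proof -
      define z where "z = combine Ks us"
      have "\<ominus> (i \<otimes> (k \<otimes> d \<oplus> z)) = \<ominus> ((i \<otimes> k) \<otimes> d) \<ominus> i \<otimes> z" using i(3) kc unfolding z_def by algebra
      also have "\<dots> = d \<ominus> i \<otimes> z" unfolding i(4) using kc by (simp add: l_minus)
      finally show ?thesis by (simp add: z_def)
    qed
    moreover have "i \<otimes> (k \<otimes> d \<oplus> combine Ks us) \<in> val_ideal 1" using i comb by (auto intro: fil_mult_eq)
    ultimately have "d \<ominus> combine T' us \<in> val_ideal 1" using fil_a_inv by simp
    moreover have "set T' \<subseteq> K \<inter> val_ideal 0" unfolding T'_def using i k base_closed fil_mult_eq[of _ 0 _ 0 0] by auto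
    ultimately show "\<exists>T. length T = length us \<and> set T \<subseteq> K \<inter> val_ideal 0 \<and> d \<ominus> combine T us \<in> val_ideal 1"
      using kKs by (intro exI[of _ T']) (auto simp: T'_def)
  qed
  then show ?thesis by blast
qed

text \<open>Successive approximation in coordinates. It yields both the completeness of \<open>F\<close> and, for a
  constant sequence, the spanning property.\<close>

lemma coordinate_limit:
  assumes us: "residually_spanning us"
    and s: "\<And>n. s n \<in> carrier F" "\<And>n. s (Suc n) \<ominus> s n \<in> val_ideal (int n)"
  obtains B where "length B = length us" "set B \<subseteq> K \<inter> val_ideal 0"
    "\<And>n. s n \<ominus> s 0 \<ominus> combine B us \<in> val_ideal (int n)"
proof -
  have us0: "set us \<subseteq> val_ideal 0" using us by (simp add: residually_spanning_def)
  then have usc: "set us \<subseteq> carrier F" using fil_carrier by blast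
  have cc: "combine A us \<in> carrier F" if "set A \<subseteq> K \<inter> val_ideal 0" for A
    using that base_in_carrier by (intro combine_in_carrier usc) auto
  \<comment> \<open>Subtracting \<open>s 0\<close> makes the sequence integral, so that the zero
    list is an approximation to order 0 and all coefficients stay in the valuation ring of
    \<open>K\<close>. \<open>Q\<close> will make the coefficient lists converge entry by
    entry.\<close>
  define P where "P n A \<longleftrightarrow> length A = length us \<and> set A \<subseteq> K \<inter> val_ideal 0 \<and>
    s n \<ominus> s 0 \<ominus> combine A us \<in> val_ideal (int n)" for n A
  define Q where "Q n A A' \<longleftrightarrow> list_all2 (\<lambda>a a'. a' \<ominus> a \<in> val_ideal (int n)) A A'" for n :: nat and A A' :: "'a list"
  have "\<exists>A. P 0 A"
  proof -
    have "P 0 (replicate (length us) \<zero>)"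
      unfolding P_def using combine_replicate[OF usc] s(1) fil_zero base_closed
      by (auto simp: a_minus_def r_neg)
    then show ?thesis by blast
  qed
  moreover have "\<exists>A'. P (Suc n) A' \<and> Q n A A'" if A: "P n A" for n A
  proof -
    have A0: "set A \<subseteq> K \<inter> val_ideal 0" "length A = length us" using A by (auto simp: P_def)
    define z where "z = combine A us"
    have zc: "z \<in> carrier F" unfolding z_def using cc A0 by blast
    define r where "r = s (Suc n) \<ominus> s 0 \<ominus> z"
    have "r = (s (Suc n) \<ominus> s n) \<oplus> (s n \<ominus> s 0 \<ominus> z)" unfolding r_def using s(1)[of 0] s(1)[of n] s(1)[of "Suc n"] zc by algebra
    then have r: "r \<in> val_ideal (int n)" using s(2)[of n] A fil_add unfolding P_def z_def by simp
    \<comment> \<open>Scaling by an element of \<open>K\<close> of valuation \<open>n\<close> brings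
      the remainder to order zero, where residual spanning applies; scaling back gains one
      order.\<close>
    obtain c where c: "c \<in> K - {\<zero>}" "w c = int n" by (rule exists_base_val)
    have cn: "c \<in> carrier F - {\<zero>}" using c base_in_carrier by auto
    then have cnc: "c \<in> carrier F" by simp
    have cn': "c \<in> val_ideal (int n)" using c cn by (simp add: mem_val_ideal)
    have "inv c \<in> val_ideal (- int n)" using inv_nonzero[OF cn] val_inv[OF cn] c by (simp add: mem_val_ideal)
    then have "inv c \<otimes> r \<in> val_ideal 0" using r by (auto intro: fil_mult_eq)
    then obtain T where T: "length T = length us" "set T \<subseteq> K \<inter> val_ideal 0"
      "inv c \<otimes> r \<ominus> combine T us \<in> val_ideal 1"
      using us unfolding residually_spanning_def by blast
    define t where "t = combine T us"
    have tc: "t \<in> carrier F" unfolding t_def using cc T by blast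
    define A' where "A' = map2 (\<oplus>) A (map ((\<otimes>) c) T)"
    have cT: "set (map ((\<otimes>) c) T) \<subseteq> K \<inter> val_ideal (int n)"
      using T c cn' base_closed(4) fil_mult_eq[of c "int n" _ 0 "int n"] by auto
    have "set A \<subseteq> carrier F" "set (map ((\<otimes>) c) T) \<subseteq> carrier F"
      using A0(1) cT base_in_carrier by blast+
    then have "combine A' us = z \<oplus> combine (map ((\<otimes>) c) T) us"
      unfolding A'_def z_def
      using combine_add[of A us "map ((\<otimes>) c) T"] A0(2) T(1) usc by simp
    moreover have "combine (map ((\<otimes>) c) T) us = c \<otimes> t"
      unfolding t_def using combine_r_distr[of T us c] usc T(2) base_in_carrier cn by auto
    ultimately have A': "combine A' us = z \<oplus> c \<otimes> t" by simp
    have "s (Suc n) \<ominus> s 0 \<ominus> combine A' us = r \<ominus> c \<otimes> t"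
      unfolding A' r_def using s(1)[of "Suc n"] s(1)[of 0] zc tc cnc by algebra
    also have "\<dots> = c \<otimes> (inv c \<otimes> r \<ominus> t)"
    proof -
      have rc: "r \<in> carrier F" using r fil_closed by blast
      have ic: "inv c \<in> carrier F" using inv_nonzero[OF cn] by simp
      have "c \<otimes> (inv c \<otimes> r \<ominus> t) = (c \<otimes> inv c) \<otimes> r \<ominus> c \<otimes> t"
        using rc tc cnc ic by algebra
      then show ?thesis using inv_nonzero[OF cn] rc by simp
    qed
    finally have "s (Suc n) \<ominus> s 0 \<ominus> combine A' us \<in> val_ideal (int (Suc n))"
      using fil_mult_eq[OF cn' T(3), of "int (Suc n)"] by (simp add: t_def)
    moreover have len: "length A' = length us" using A0 T by (simp add: A'_def)
    moreover have "A' ! i \<in> K \<inter> val_ideal 0 \<and> A' ! i \<ominus> A ! i \<in> val_ideal (int n)" if i: "i < length us" for i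
    proof -
      have ai: "A ! i \<in> K \<inter> val_ideal 0" using A0 i by (metis nth_mem subsetD)
      have ti: "c \<otimes> T ! i \<in> K \<inter> val_ideal (int n)" using cT T(1) i by auto
      have e: "A' ! i = A ! i \<oplus> c \<otimes> T ! i" unfolding A'_def using i A0 T by simp
      define x y where "x = A ! i" and "y = c \<otimes> T ! i"
      have "x \<in> carrier F" "y \<in> carrier F" unfolding x_def y_def using ai ti base_in_carrier by auto
      then have "x \<oplus> y \<ominus> x = y" by algebra
      then show ?thesis using ai ti e base_closed fil_add[OF _ fil_weaken[of _ "int n" 0]] by (simp add: x_def y_def)
    qed
    ultimately have "P (Suc n) A' \<and> Q n A A'"
      unfolding P_def Q_def using A0 by (auto simp: list_all2_conv_all_nth in_set_conv_nth)
    then show ?thesis by blast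
  qed
  ultimately obtain A where A: "\<And>n. P n (A n)" "\<And>n. Q n (A n) (A (Suc n))"
    using dependent_nat_choice[of P Q] by blast
  have An: "length (A n) = length us" "set (A n) \<subseteq> K \<inter> val_ideal 0"
    "s n \<ominus> s 0 \<ominus> combine (A n) us \<in> val_ideal (int n)" for n
    using A(1)[of n] by (auto simp: P_def)
  have Ai: "A n ! i \<in> K \<inter> val_ideal 0" if "i < length us" for n i
    using An(1,2)[of n] that by (metis nth_mem subsetD)
  \<comment> \<open>Each coordinate sequence lies in \<open>K\<close> and converges there by
    completeness of \<open>K\<close>.\<close>
  have "\<exists>l \<in> K. \<forall>n. l \<ominus> A n ! i \<in> val_ideal (int n)" if i: "i < length us" for i
  proof -
    have "\<exists>l\<in>carrier (F\<lparr>carrier := K\<rparr>). \<forall>n. l \<ominus>\<^bsub>F\<lparr>carrier := K\<rparr>\<^esub> A n ! i \<in> base.val_ideal (int n)"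
    proof (rule base.step_complete)
      show "A n ! i \<in> carrier (F\<lparr>carrier := K\<rparr>)" for n using Ai[OF i] by simp
      show "A (Suc n) ! i \<ominus>\<^bsub>F\<lparr>carrier := K\<rparr>\<^esub> A n ! i \<in> base.val_ideal (int n)" for n
        using A(2)[of n] i An(1) Ai[OF i, of n] Ai[OF i, of "Suc n"] base_closed
        by (simp add: Q_def list_all2_conv_all_nth base_minus base_val_ideal) (simp add: a_minus_def)
    qed
    then show ?thesis using Ai[OF i] by (auto simp: base_minus base_val_ideal)
  qed
  then obtain l where l: "\<And>i. i < length us \<Longrightarrow> l i \<in> K \<and> (\<forall>n. l i \<ominus> A n ! i \<in> val_ideal (int n))"
    by metis
  define B where "B = map l [0..<length us]"
  have BA: "list_all2 (\<lambda>a b. a \<ominus> b \<in> val_ideal (int n)) B (A n)" for n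
    using l An(1) by (simp add: B_def list_all2_conv_all_nth)
  have lK: "l i \<in> K \<inter> val_ideal 0" if "i < length us" for i
  proof -
    have "l i \<ominus> A 0 ! i \<in> val_ideal 0" using l[OF that] by (metis of_nat_0)
    then have "l i \<in> val_ideal 0"
      using fil_of_diff[of "l i" "A 0 ! i" 0] l[OF that] Ai[OF that, of 0] base_in_carrier by auto
    then show ?thesis using l[OF that] by simp
  qed
  then have BK: "set B \<subseteq> K \<inter> val_ideal 0" by (auto simp: B_def)
  show thesis
  proof (rule that[OF _ BK])
    show "length B = length us" by (simp add: B_def)
    fix n
    define x y where "x = combine B us" and "y = combine (A n) us"
    have xy: "x \<in> carrier F" "y \<in> carrier F" unfolding x_def y_def using BK An(2) cc by auto
    have "set B \<subseteq> carrier F" "set (A n) \<subseteq> carrier F" using BK An(2) base_in_carrier by blast+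
    then have "x \<ominus> y \<in> val_ideal (int n)"
      unfolding x_def y_def using combine_diff_left[OF BA[of n] _ _ us0] by blast
    moreover have "s n \<ominus> s 0 \<ominus> x = (s n \<ominus> s 0 \<ominus> y) \<ominus> (x \<ominus> y)" using s(1)[of 0] s(1)[of n] xy by algebra
    ultimately show "s n \<ominus> s 0 \<ominus> combine B us \<in> val_ideal (int n)"
      using An(3)[of n] fil_minus unfolding x_def y_def by simp
  qed
qed

end

text \<open>The limit is \<open>s 0\<close> plus the combination formed with the limits of the
  coordinates. From here on Hensel's lemma is available in \<open>F\<close>.\<close>

sublocale unramified_extension \<subseteq> complete_valued_field F w
proof unfold_locales
  fix s :: "nat \<Rightarrow> 'a"
  assume s: "\<And>n. s n \<in> carrier F" "\<And>n. s (Suc n) \<ominus> s n \<in> val_ideal (int n)"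
  obtain us where us: "residually_spanning us" using exists_residually_spanning by blast
  obtain B where B: "set B \<subseteq> K \<inter> val_ideal 0" "\<And>n. s n \<ominus> s 0 \<ominus> combine B us \<in> val_ideal (int n)"
    by (rule coordinate_limit[OF us s], rule that)
  define z where "z = combine B us"
  have zc: "z \<in> carrier F"
    unfolding z_def
  proof (rule combine_in_carrier)
    show "set B \<subseteq> carrier F" using B(1) base_in_carrier by blast
    show "set us \<subseteq> carrier F" using us fil_carrier unfolding residually_spanning_def by blast
  qed
  have "s 0 \<oplus> z \<ominus> s n \<in> val_ideal (int n)" for n
  proof -
    have "s 0 \<oplus> z \<ominus> s n = \<ominus> (s n \<ominus> s 0 \<ominus> z)" using s(1)[of 0] s(1)[of n] zc by algebra
    then show ?thesis using B(2)[of n] fil_a_inv by (simp add: z_def)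
  qed
  then show "\<exists>l\<in>carrier F. \<forall>n. l \<ominus> s n \<in> val_ideal (int n)"
    using s(1) zc by (intro bexI[of _ "s 0 \<oplus> z"]) auto
qed

context unramified_extension
begin

text \<open>The point is the bound on the coefficients: they are as small as the element itself.
  Once \<open>us\<close> consists of roots of unity and zeros, this bound is what makes
  automorphisms over \<open>K\<close> respect the valuation.\<close>

lemma residually_spanning_spans:
  assumes us: "residually_spanning us" and x: "x \<in> val_ideal n"
  obtains B where "set B \<subseteq> K \<inter> val_ideal n" "x = combine B us"
proof -
  have usc: "set us \<subseteq> carrier F" using us fil_carrier by (auto simp: residually_spanning_def)
  obtain c where c: "c \<in> K - {\<zero>}" "w c = n" by (rule exists_base_val)
  have cn: "c \<in> carrier F - {\<zero>}" using c base_in_carrier by auto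
  have cn': "c \<in> val_ideal n" using c cn by (simp add: mem_val_ideal)
  have "inv c \<in> val_ideal (- n)" using inv_nonzero[OF cn] val_inv[OF cn] c by (simp add: mem_val_ideal)
  then have y: "inv c \<otimes> x \<in> val_ideal 0" using x by (auto intro: fil_mult_eq)
  define y where "y = inv c \<otimes> x"
  have yc: "y \<in> carrier F" unfolding y_def using y fil_closed by blast
  \<comment> \<open>The jump from zero to \<open>y\<close> is placed at index 0, where a step need
    only be integral; afterwards the sequence is constant.\<close>
  define s where "s n = (case n of 0 \<Rightarrow> \<zero> | Suc _ \<Rightarrow> y)" for n :: nat
  have s: "s n \<in> carrier F" "s (Suc n) \<ominus> s n \<in> val_ideal (int n)" for n
    using y yc fil_zero by (auto simp: s_def a_minus_def r_neg y_def split: nat.split)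
  obtain B where B: "set B \<subseteq> K \<inter> val_ideal 0" "\<And>n. s n \<ominus> s 0 \<ominus> combine B us \<in> val_ideal (int n)"
    by (rule coordinate_limit[OF us s], rule that)
  have Bc: "set B \<subseteq> carrier F" using B(1) base_in_carrier by blast
  then have bc: "combine B us \<in> carrier F" using usc by simp
  \<comment> \<open>The approximation is read off at \<open>Suc n\<close>, since the sequence takes
    the value \<open>y\<close> only from index 1 on.\<close>
  have "y \<ominus> combine B us \<in> val_ideal (int n)" for n
    using B(2)[of "Suc n"] fil_weaken[of _ "int (Suc n)" "int n"] yc by (simp add: s_def a_minus_def)
  then have "y \<ominus> combine B us = \<zero>" by (rule val_ideal_nat_separated)
  then have "y = combine B us" using yc bc by (simp add: r_right_minus_eq)
  then have "x = c \<otimes> combine B us"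
    using inv_nonzero[OF cn] cn fil_closed[OF x] unfolding y_def by (metis DiffD1 l_one m_assoc)
  then have "x = combine (map ((\<otimes>) c) B) us" using combine_r_distr[OF Bc usc, of c] cn by simp
  moreover have "set (map ((\<otimes>) c) B) \<subseteq> K \<inter> val_ideal n"
    using B c cn' base_closed(4) fil_mult_eq[of c n _ 0 n] by auto
  ultimately show thesis using that by blast
qed

end

lemma (in ring_hom_ring) combine_hom_image:
  assumes "set Ks \<subseteq> carrier R" "set us \<subseteq> carrier R"
  shows "h (R.combine Ks us) = S.combine (map h Ks) (map h us)"
  using assms by (induct Ks us rule: R.combine.induct) auto

context unramified_extension
begin

section \<open>Residue field of \<open>F\<close>, roots of unity, and Galois invariance of the
  valuation\<close>

lemma residue_char_lift:
  assumes "residue_char (F \<lparr> carrier := K \<rparr>) v p"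
  shows "residue_char F w p"
proof -
  have "add_pow (F \<lparr> carrier := K \<rparr>) p \<one> = add_pow F p \<one>"
    by (simp add: add_pow_def nat_pow_def)
  then show ?thesis
    using assms base.residue_char_iff[of p] by (simp add: residue_char_iff base_val_ideal)
qed

text \<open>Modulo the maximal ideal a coefficient matters only through its residue, and
  \<open>K\<close> has finitely many of these. So the finitely many coefficient lists with entries
  among the representatives \<open>S\<close> reach every residue class.\<close>

lemma finite_residue_field_lift: "finite (carrier (residue_field F w))"
proof -
  obtain us where us: "residually_spanning us" using exists_residually_spanning by blast
  have us0: "set us \<subseteq> val_ideal 0" using us by (simp add: residually_spanning_def)
  then have usc: "set us \<subseteq> carrier F" using fil_carrier by blast
  obtain S where S: "S \<subseteq> base.val_ideal 0" "finite S"
    "base.residue ` base.val_ideal 0 = base.residue ` S"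
    using finite_subset_image[OF base.finite_residue_field, of base.residue "base.val_ideal 0"]
    by (auto simp: base.carrier_residue_field)
  have rep: "\<exists>r \<in> S. k \<ominus> r \<in> val_ideal 1" if k: "k \<in> K \<inter> val_ideal 0" for k
  proof -
    have "base.residue k \<in> base.residue ` S" using S(3) k base_val_ideal by blast
    then obtain r where r: "r \<in> S" "base.residue k = base.residue r" by blast
    moreover have "r \<in> base.val_ideal 0" using r S(1) by blast
    ultimately have "r \<in> S" "k \<ominus>\<^bsub>F\<lparr>carrier := K\<rparr>\<^esub> r \<in> base.val_ideal 1" "r \<in> K"
      using base.residue_eq_iff[of k r] S(1) k base_val_ideal by auto
    then show ?thesis by (auto simp: base_val_ideal base_minus)
  qed
  have "carrier (residue_field F w) \<subseteq>
      (\<lambda>A. residue (combine A us)) ` {A. set A \<subseteq> S \<and> length A = length us}"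
  proof
    fix c assume "c \<in> carrier (residue_field F w)"
    then obtain d where d: "d \<in> val_ideal 0" "c = residue d" using carrier_residue_field by auto
    obtain T where T: "length T = length us" "set T \<subseteq> K \<inter> val_ideal 0" "d \<ominus> combine T us \<in> val_ideal 1"
      using us d unfolding residually_spanning_def by blast
    have "\<forall>k \<in> set T. \<exists>r. r \<in> S \<and> k \<ominus> r \<in> val_ideal 1" using rep T(2) by blast
    then obtain g where g: "\<And>k. k \<in> set T \<Longrightarrow> g k \<in> S \<and> k \<ominus> g k \<in> val_ideal 1" by metis
    define A where "A = map g T"
    have A: "set A \<subseteq> S" "length A = length us" using g T(1) by (auto simp: A_def)
    have S0: "S \<subseteq> val_ideal 0" using S(1) base_val_ideal by auto
    have AT: "set A \<subseteq> val_ideal 0" "set T \<subseteq> val_ideal 0" "set A \<subseteq> carrier F" "set T \<subseteq> carrier F"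
      using A S0 T(2) fil_carrier by blast+
    have "list_all2 (\<lambda>a b. a \<ominus> b \<in> val_ideal 1) T A" using g by (simp add: A_def list_all2_conv_all_nth)
    then have "combine T us \<ominus> combine A us \<in> val_ideal 1" using combine_diff_left AT us0 by blast
    then have "d \<ominus> combine A us \<in> val_ideal 1"
      using fil_diff_trans[OF T(3)] fil_closed[OF d(1)] AT usc by simp
    then have "c = residue (combine A us)"
      using residue_eq_iff[OF d(1) combine_val_ideal[OF AT(1) us0]] d(2) by simp
    then show "c \<in> (\<lambda>A. residue (combine A us)) ` {A. set A \<subseteq> S \<and> length A = length us}"
      using A by blast
  qed
  then show ?thesis using finite_lists_length_eq[OF S(2), of "length us"] finite_subset by blast
qed

text \<open>Residual spanning depends on residues only, so each spanning element may be exchanged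
  for a root of unity with the same residue, or for zero if its residue vanishes. The lifting
  property is exported as well, for recognising roots of unity of the radical extension as elements
  of \<open>F\<close>.\<close>

lemma exists_teichmueller_span:
  assumes p: "residue_char (F \<lparr> carrier := K \<rparr>) v p"
  obtains N us where "N > 0" "add_pow F (N :: nat) \<one> \<noteq> \<zero>" "w (add_pow F N \<one>) = 0"
    "\<And>x. \<lbrakk> x \<in> val_ideal 0; x \<notin> val_ideal 1 \<rbrakk> \<Longrightarrow>
      \<exists>\<tau> \<in> carrier F. \<tau> [^] N = \<one> \<and> \<tau> \<ominus> x \<in> val_ideal 1"
    "residually_spanning us" "\<And>u. u \<in> set us \<Longrightarrow> u = \<zero> \<or> u [^] N = \<one>"
proof -
  have pF: "residue_char F w p" by (rule residue_char_lift[OF p])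
  obtain N :: nat where N: "N > 0" "coprime p N"
    "\<And>x. \<lbrakk> x \<in> val_ideal 0; x \<notin> val_ideal 1 \<rbrakk> \<Longrightarrow> x [^] N \<ominus> \<one> \<in> val_ideal 1"
    using residue_exponent[OF finite_residue_field_lift pF] by metis
  have Nu: "add_pow F N \<one> \<noteq> \<zero>" "w (add_pow F N \<one>) = 0" using coprime_unit[OF pF N(2)] by auto
  have lift: "\<exists>\<tau> \<in> carrier F. \<tau> [^] N = \<one> \<and> \<tau> \<ominus> x \<in> val_ideal 1"
    if "x \<in> val_ideal 0" "x \<notin> val_ideal 1" for x
    using teichmueller_lift[OF Nu fil_closed[OF that(1)] N(3)[OF that] N(1)] by metis
  have root0: "u \<in> val_ideal 0" if "u \<in> carrier F" "u [^] N = \<one>" for u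
  proof -
    have u: "u \<in> carrier F - {\<zero>}" using that N(1) by (auto simp: nat_pow_zero)
    then have "int N * w u = 0" using val_pow[OF u, of N] that val_one by simp
    then show ?thesis using N(1) that by (simp add: mem_val_ideal)
  qed
  obtain us where us: "residually_spanning us" using exists_residually_spanning by blast
  have us0: "set us \<subseteq> val_ideal 0" using us by (simp add: residually_spanning_def)
  have "\<exists>u'. u' \<in> val_ideal 0 \<and> (u' = \<zero> \<or> u' [^] N = \<one>) \<and> u \<ominus> u' \<in> val_ideal 1" if u: "u \<in> set us" for u
  proof (cases "u \<in> val_ideal 1")
    case True then show ?thesis using fil_zero fil_closed[OF True] by (intro exI[of _ \<zero>]) (simp add: a_minus_def)
  next
    case False
    have u0: "u \<in> val_ideal 0" using us0 u by blast
    obtain \<tau> where "\<tau> \<in> carrier F" "\<tau> [^] N = \<one>" "\<tau> \<ominus> u \<in> val_ideal 1" using lift[OF u0 False] by blast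
    then show ?thesis using root0 fil_diff_sym[of \<tau> u] fil_closed[OF u0] by blast
  qed
  then obtain g where g: "\<And>u. u \<in> set us \<Longrightarrow>
      g u \<in> val_ideal 0 \<and> (g u = \<zero> \<or> g u [^] N = \<one>) \<and> u \<ominus> g u \<in> val_ideal 1" by metis
  define us' where "us' = map g us"
  have us'0: "set us' \<subseteq> val_ideal 0" using g by (auto simp: us'_def)
  have c: "set us \<subseteq> carrier F" "set us' \<subseteq> carrier F" using us0 us'0 fil_carrier by blast+
  have la: "list_all2 (\<lambda>u u'. u \<ominus> u' \<in> val_ideal 1) us us'" using g by (simp add: us'_def list_all2_conv_all_nth)
  have "residually_spanning us'"
    unfolding residually_spanning_def
  proof (intro conjI us'0 ballI)
    fix d assume d: "d \<in> val_ideal 0"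
    obtain T where T: "length T = length us" "set T \<subseteq> K \<inter> val_ideal 0" "d \<ominus> combine T us \<in> val_ideal 1"
      using us d unfolding residually_spanning_def by blast
    have T0: "set T \<subseteq> val_ideal 0" "set T \<subseteq> carrier F" using T(2) fil_carrier by blast+
    have "combine T us \<ominus> combine T us' \<in> val_ideal 1" by (rule combine_diff_right[OF la c T0(1)])
    then have "d \<ominus> combine T us' \<in> val_ideal 1"
      using fil_diff_trans[OF T(3)] fil_closed[OF d(1)] c T0 by simp
    then show "\<exists>T. length T = length us' \<and> set T \<subseteq> K \<inter> val_ideal 0 \<and> d \<ominus> combine T us' \<in> val_ideal 1"
      using T by (intro exI[of _ T]) (auto simp: us'_def)
  qed
  moreover have "u = \<zero> \<or> u [^] N = \<one>" if "u \<in> set us'" for u using that g by (auto simp: us'_def)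
  ultimately show thesis using that[OF N(1) Nu lift, of us'] by blast
qed

text \<open>An automorphism over \<open>K\<close> fixes the coefficients and sends roots of unity to
  roots of unity, which have valuation zero. By the coefficient bound of the spanning lemma
  valuations cannot drop, and the same for \<open>inv x\<close> gives equality.\<close>

lemma Gal_val:
  assumes p: "residue_char (F \<lparr> carrier := K \<rparr>) v p"
    and g: "g \<in> Gal F K" and x: "x \<in> carrier F - {\<zero>}"
  shows "g x \<in> carrier F - {\<zero>} \<and> w (g x) = w x"
proof -
  have iso: "g \<in> ring_iso F F" and fixK: "\<And>k. k \<in> K \<Longrightarrow> g k = k" using g by (auto simp: Gal_def)
  have hom: "g \<in> ring_hom F F" using iso by (simp add: ring_iso_def)
  interpret g: ring_hom_ring F F g by (rule ring_hom_ringI2[OF ring_axioms ring_axioms hom])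
  have inj: "inj_on g (carrier F)" using iso by (auto simp: ring_iso_def bij_betw_def)
  have nz: "g y \<in> carrier F - {\<zero>}" if "y \<in> carrier F - {\<zero>}" for y
    using that inj_onD[OF inj, of y \<zero>] g.hom_zero by auto
  obtain N us where N: "(N :: nat) > 0" "residually_spanning us" "\<And>u. u \<in> set us \<Longrightarrow> u = \<zero> \<or> u [^] N = \<one>"
    by (rule exists_teichmueller_span[OF p], rule that)
  have usc: "set us \<subseteq> carrier F" using N(2) fil_carrier by (auto simp: residually_spanning_def)
  have "g u \<in> val_ideal 0" if u: "u \<in> set us" for u
  proof (cases "u = \<zero>")
    case True then show ?thesis using g.hom_zero fil_zero by simp
  next
    case False
    then have uc: "u \<in> carrier F" "u [^] N = \<one>" using N(3) u usc by auto
    have "g u [^] N = \<one>" using g.hom_nat_pow[OF uc(1), of N] uc(2) by simp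
    then have "int N * w (g u) = 0" using val_pow[OF nz, of u N] uc False val_one by simp
    then show ?thesis using N(1) uc by (simp add: mem_val_ideal)
  qed
  then have sus: "set (map g us) \<subseteq> val_ideal 0" by auto
  have ge: "w y \<le> w (g y)" if y: "y \<in> carrier F - {\<zero>}" for y
  proof -
    have "y \<in> val_ideal (w y)" using y by (simp add: mem_val_ideal)
    then obtain B where B: "set B \<subseteq> K \<inter> val_ideal (w y)" "y = combine B us"
      using residually_spanning_spans[OF N(2)] by metis
    have "map g B = B" using B(1) fixK by (intro map_idI) auto
    moreover have "set B \<subseteq> carrier F" using B(1) base_in_carrier by blast
    ultimately have "g y = combine B (map g us)" using g.combine_hom_image[OF _ usc] B(2) by simp
    then have "g y \<in> val_ideal (w y)" using combine_val_ideal[OF _ sus] B(1) by simp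
    then show ?thesis using nz[OF y] by (simp add: mem_val_ideal)
  qed
  have ix: "inv x \<in> carrier F - {\<zero>}" "x \<otimes> inv x = \<one>" using inv_nonzero[OF x] by auto
  have "g x \<otimes> g (inv x) = \<one>" using g.hom_mult[of x "inv x"] x ix g.hom_one by simp
  then have "w (g x) + w (g (inv x)) = 0" using val_mult[OF nz[OF x] nz[OF ix(1)]] val_one by simp
  then have "w (g x) \<le> w x" using ge[OF ix(1)] val_inv[OF x] by simp
  then show ?thesis using ge[OF x] nz[OF x] by simp
qed

end

section \<open>Radical extensions\<close>

text \<open>With \<open>w \<pi> = 1\<close> the radical polynomial is Eisenstein. This is exploited
  as follows: giving \<open>Y\<close> order 1 and multiplying valuations on \<open>F\<close> by
  \<open>e\<close>, the replacement of the \<open>e\<close>-th power of \<open>Y\<close> by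
  \<open>\<pi>\<close> preserves orders.\<close>

locale radical_extension = discretely_valued_field F w
  for F :: "('a, 'b) ring_scheme" (structure) and w +
  fixes e :: nat and \<pi> :: 'a
  assumes exponent_pos: "e > 0"
    and uniformiser: "\<pi> \<in> carrier F - {\<zero>}" "w \<pi> = 1"
begin

abbreviation L :: "'a list set ring" where "L \<equiv> radical_ext F e \<pi>"
abbreviation emb :: "'a \<Rightarrow> 'a list set" (\<open>\<iota>\<close>) where "\<iota> \<equiv> radical_emb F e \<pi>"

definition proj :: "'a list \<Rightarrow> 'a list set" where
  "proj = rupture_surj (carrier F) (radical_poly F e \<pi>)"

definition Y :: "'a list set" where "Y = proj X"

lemma poly_domain: "domain (poly_ring F)"
  using univ_poly_is_domain[OF carrier_is_subring] .

lemma const_closed: "a \<in> carrier F \<Longrightarrow> poly_of_const a \<in> carrier (poly_ring F)"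
  using ring_hom_closed[OF canonical_embedding_is_hom[OF carrier_is_subring]] by simp

lemma radical_poly_closed: "radical_poly F e \<pi> \<in> carrier (poly_ring F)"
proof -
  interpret UP: domain "poly_ring F" by (rule poly_domain)
  show ?thesis
    unfolding radical_poly_def using var_pow_closed[OF carrier_is_subring] const_closed uniformiser
    by (intro UP.minus_closed) auto
qed

lemma length_radical_poly: "length (radical_poly F e \<pi>) = Suc e"
proof -
  interpret UP: domain "poly_ring F" by (rule poly_domain)
  have "\<ominus>\<^bsub>poly_ring F\<^esub> poly_of_const \<pi> = [\<ominus> \<pi>]"
    using univ_poly_a_inv_def'[OF carrier_is_subring const_closed, of \<pi>] uniformiser
    by (simp add: poly_of_const_def)
  then have eq: "radical_poly F e \<pi> = poly_add (monom \<one> e) [\<ominus> \<pi>]"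
    unfolding radical_poly_def a_minus_def unitary_monom_eq_var_pow[OF carrier_is_subring, symmetric]
    by (simp add: univ_poly_add)
  have "\<ominus> \<pi> \<noteq> \<zero>" using uniformiser by (metis DiffD1 DiffD2 add.inv_eq_1_iff insertI1)
  then have "polynomial (carrier F) (monom \<one> e)" "polynomial (carrier F) [\<ominus> \<pi>]"
    using monom_is_polynomial[OF carrier_is_subring, of \<one>] uniformiser by (auto simp: polynomial_def)
  moreover have "length (monom \<one> e) = Suc e" by (simp add: monom_def)
  ultimately show ?thesis
    unfolding eq using poly_add_length_eq[OF carrier_is_subring] exponent_pos
    by (simp del: poly_add.simps)
qed

lemma cring_L: "cring L"
proof -
  interpret UP: domain "poly_ring F" by (rule poly_domain)
  show ?thesis
    unfolding radical_ext_def rupture_def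
    using ideal.quotient_is_cring[OF UP.cgenideal_ideal[OF radical_poly_closed] UP.is_cring] .
qed

sublocale L: cring L
  by (rule cring_L)

lemma proj_hom: "proj \<in> ring_hom (poly_ring F) L"
  using rupture_surj_hom(1)[OF carrier_is_subring radical_poly_closed]
  by (simp add: proj_def radical_ext_def)

lemma emb_eq: "\<iota> a = proj (poly_of_const a)"
  by (simp add: radical_emb_def proj_def)

lemma emb_hom: "\<iota> \<in> ring_hom F L"
proof -
  have "\<iota> = proj \<circ> poly_of_const" by (auto simp: emb_eq)
  then show ?thesis
    using ring_hom_trans[OF canonical_embedding_is_hom[OF carrier_is_subring] proj_hom] by simp
qed

sublocale emb: ring_hom_ring F L \<iota>
  by (rule ring_hom_ringI2[OF ring_axioms L.ring_axioms emb_hom])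

lemma Y_closed: "Y \<in> carrier L"
  unfolding Y_def using ring_hom_closed[OF proj_hom] var_closed(1)[OF carrier_is_subring] by blast

text \<open>Length at most \<open>e\<close> means degree below \<open>e\<close>: such polynomials
  are the remainders modulo the radical polynomial, hence unique representatives. Every statement
  below about coefficients of elements of \<open>L\<close> rests on this.\<close>

lemma proj_inj:
  assumes "p \<in> carrier (poly_ring F)" "length p \<le> e" "q \<in> carrier (poly_ring F)" "length q \<le> e"
    and "proj p = proj q"
  shows "p = q"
proof -
  have "radical_poly F e \<pi> \<noteq> []" using length_radical_poly by auto
  then show "p = q"
    using rupture_surj_inj_on[OF carrier_is_subfield radical_poly_closed] assms
    unfolding pmod_image_characterization[OF carrier_is_subfield radical_poly_closed \<open>_ \<noteq> []\<close>]
    by (auto simp: inj_on_def proj_def length_radical_poly)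
qed

lemma Y_pow: "Y [^]\<^bsub>L\<^esub> e = \<iota> \<pi>"
proof -
  interpret UP: domain "poly_ring F" by (rule poly_domain)
  interpret p: ring_hom_ring "poly_ring F" L proj
    by (rule ring_hom_ringI2[OF UP.ring_axioms L.ring_axioms proj_hom])
  have X: "X \<in> carrier (poly_ring F)" by (rule var_closed(1)[OF carrier_is_subring])
  have c: "poly_of_const \<pi> \<in> carrier (poly_ring F)" using const_closed uniformiser by simp
  have "proj (radical_poly F e \<pi>) = \<zero>\<^bsub>L\<^esub>"
    using UP.a_rcos_zero[OF UP.cgenideal_ideal[OF radical_poly_closed] UP.cgenideal_self[OF radical_poly_closed]]
    by (simp add: proj_def radical_ext_def rupture_def FactRing_def)
  then have "proj (X [^]\<^bsub>poly_ring F\<^esub> e) \<ominus>\<^bsub>L\<^esub> proj (poly_of_const \<pi>) = \<zero>\<^bsub>L\<^esub>"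
    using X c unfolding radical_poly_def a_minus_def by simp
  then have "proj (X [^]\<^bsub>poly_ring F\<^esub> e) = \<iota> \<pi>" using X c by (simp add: emb_eq)
  then show ?thesis using p.hom_nat_pow[OF X, of e] by (simp add: Y_def)
qed

lemma Y_pow_mult: "Y [^]\<^bsub>L\<^esub> (e * k) = \<iota> (\<pi> [^] k)"
  using L.nat_pow_pow[OF Y_closed, of e k] emb.hom_nat_pow[of \<pi> k] uniformiser by (simp add: Y_pow)

lemma proj_monom:
  assumes "a \<in> carrier F - {\<zero>}"
  shows "proj (monom a k) = \<iota> a \<otimes>\<^bsub>L\<^esub> Y [^]\<^bsub>L\<^esub> k"
proof -
  interpret UP: domain "poly_ring F" by (rule poly_domain)
  interpret p: ring_hom_ring "poly_ring F" L proj
    by (rule ring_hom_ringI2[OF UP.ring_axioms L.ring_axioms proj_hom])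
  have X: "X \<in> carrier (poly_ring F)" by (rule var_closed(1)[OF carrier_is_subring])
  have "monom a k = poly_of_const a \<otimes>\<^bsub>poly_ring F\<^esub> X [^]\<^bsub>poly_ring F\<^esub> k"
    using monom_eq_var_pow[OF carrier_is_subring assms] assms by (simp add: poly_of_const_def)
  then show ?thesis using X const_closed[of a] assms p.hom_nat_pow[OF X, of k]
    by (simp add: emb_eq Y_def)
qed

lemma proj_eval:
  assumes "p \<in> carrier (poly_ring F)"
  shows "proj p = L.eval (map \<iota> p) Y"
proof -
  interpret UP: domain "poly_ring F" by (rule poly_domain)
  interpret p: ring_hom_ring "poly_ring F" L proj
    by (rule ring_hom_ringI2[OF UP.ring_axioms L.ring_axioms proj_hom])
  have X: "X \<in> carrier (poly_ring F)" by (rule var_closed(1)[OF carrier_is_subring])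
  have sp: "set p \<subseteq> carrier F" using assms polynomial_incl univ_poly_carrier by blast
  have "proj p = proj (UP.eval (map poly_of_const p) X)"
    using eval_rewrite[OF carrier_is_subring assms] by simp
  also have "\<dots> = L.eval (map proj (map poly_of_const p)) (proj X)"
    by (rule p.eval_hom'[OF X]) (use sp const_closed in auto)
  also have "map proj (map poly_of_const p) = map \<iota> p" by (simp add: emb_eq)
  finally show ?thesis by (simp add: Y_def)
qed

lemma L_cases:
  assumes "x \<in> carrier L"
  obtains p where "p \<in> carrier (poly_ring F)" "x = proj p"
  using assms that unfolding radical_ext_def rupture_def FactRing_def A_RCOSETS_def' proj_def by auto

lemma L_induct [consumes 1, case_names add monom]:
  assumes "x \<in> carrier L"
    and add: "\<And>x y. \<lbrakk> x \<in> carrier L; y \<in> carrier L; P x; P y \<rbrakk> \<Longrightarrow> P (x \<oplus>\<^bsub>L\<^esub> y)"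
    and monom: "\<And>a k. a \<in> carrier F \<Longrightarrow> P (\<iota> a \<otimes>\<^bsub>L\<^esub> Y [^]\<^bsub>L\<^esub> (k :: nat))"
  shows "P x"
proof -
  obtain p where p: "p \<in> carrier (poly_ring F)" "x = proj p" by (rule L_cases[OF assms(1)])
  have "P (L.eval (map \<iota> p) Y) \<and> L.eval (map \<iota> p) Y \<in> carrier L" if "set p \<subseteq> carrier F" for p
    using that
  proof (induct p)
    case Nil
    have "\<iota> \<zero> \<otimes>\<^bsub>L\<^esub> Y [^]\<^bsub>L\<^esub> (0 :: nat) = \<zero>\<^bsub>L\<^esub>" by simp
    then show ?case using monom[of \<zero> 0] by simp
  next
    case (Cons a p)
    then show ?case using add monom[of a "length p"] Y_closed by simp
  qed
  moreover have "set p \<subseteq> carrier F" using p polynomial_incl univ_poly_carrier by blast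
  ultimately show ?thesis using p proj_eval by simp
qed

text \<open>The extension of \<open>w\<close> to \<open>L\<close> gives \<open>\<iota> a Y\<^sup>k\<close> the value \<open>e w a + k\<close>. Only its filtration by
  fractional ideals is used.\<close>

inductive_set fil :: "int \<Rightarrow> 'a list set set" for n :: int where
  fil_monom: "\<lbrakk> a \<in> val_ideal m; n \<le> int e * m + int k \<rbrakk> \<Longrightarrow> \<iota> a \<otimes>\<^bsub>L\<^esub> Y [^]\<^bsub>L\<^esub> (k :: nat) \<in> fil n"
| fil_sum: "\<lbrakk> x \<in> fil n; y \<in> fil n \<rbrakk> \<Longrightarrow> x \<oplus>\<^bsub>L\<^esub> y \<in> fil n"

lemma fil_in_carrier: "x \<in> fil n \<Longrightarrow> x \<in> carrier L"
  by (induct rule: fil.induct) (auto simp: Y_closed fil_closed)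

sublocale L: filtered_cring L fil
proof unfold_locales
  show "fil n \<subseteq> carrier L" for n using fil_in_carrier by blast
  show "\<zero>\<^bsub>L\<^esub> \<in> fil n" for n
  proof -
    \<comment> \<open>The absolute value is a bound that serves for either sign of \<open>n\<close>,
      because \<open>e\<close> is at least 1.\<close>
    have "n \<le> \<bar>n\<bar>" by simp
    also have "\<bar>n\<bar> \<le> int e * \<bar>n\<bar>" using exponent_pos by (simp add: mult_le_cancel_right1)
    finally have "\<iota> \<zero> \<otimes>\<^bsub>L\<^esub> Y [^]\<^bsub>L\<^esub> (0 :: nat) \<in> fil n"
      by (intro fil_monom[of \<zero> "\<bar>n\<bar>"]) (auto simp: fil_zero)
    then show ?thesis by simp
  qed
  show "x \<oplus>\<^bsub>L\<^esub> y \<in> fil n" if "x \<in> fil n" "y \<in> fil n" for x y n using that fil_sum by blast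
  show "\<ominus>\<^bsub>L\<^esub> x \<in> fil n" if "x \<in> fil n" for x n
    using that
  proof (induct rule: fil.induct)
    case (fil_monom a m k)
    have a: "a \<in> carrier F" using fil_monom fil_closed by blast
    have "\<ominus>\<^bsub>L\<^esub> (\<iota> a \<otimes>\<^bsub>L\<^esub> Y [^]\<^bsub>L\<^esub> k) = \<iota> (\<ominus> a) \<otimes>\<^bsub>L\<^esub> Y [^]\<^bsub>L\<^esub> k"
      using a Y_closed by (simp add: L.l_minus)
    then show ?case using fil.fil_monom[of "\<ominus> a" m n k] fil_monom fil_a_inv by simp
  next
    case (fil_sum x y)
    have "\<ominus>\<^bsub>L\<^esub> (x \<oplus>\<^bsub>L\<^esub> y) = \<ominus>\<^bsub>L\<^esub> x \<oplus>\<^bsub>L\<^esub> \<ominus>\<^bsub>L\<^esub> y"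
      using fil_sum fil_in_carrier by (simp add: L.minus_add)
    then show ?case using fil_sum fil.fil_sum by simp
  qed
  show anti: "fil n \<subseteq> fil m" if "m \<le> n" for m n
  proof
    fix x assume "x \<in> fil n" then show "x \<in> fil m"
      by (induct rule: fil.induct) (use that in \<open>auto intro: fil.intros\<close>)
  qed
  show "x \<otimes>\<^bsub>L\<^esub> y \<in> fil (m + n)" if "x \<in> fil m" "y \<in> fil n" for x y m n
    using that(1)
  proof (induct rule: fil.induct)
    case (fil_monom a r k)
    show ?case using that(2)
    proof (induct rule: fil.induct)
      case (fil_monom b s l)
      have c: "a \<in> carrier F" "b \<in> carrier F" using fil_monom \<open>a \<in> val_ideal r\<close> fil_closed by auto
      have "(\<iota> a \<otimes>\<^bsub>L\<^esub> Y [^]\<^bsub>L\<^esub> k) \<otimes>\<^bsub>L\<^esub> (\<iota> b \<otimes>\<^bsub>L\<^esub> Y [^]\<^bsub>L\<^esub> l) =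
          (\<iota> a \<otimes>\<^bsub>L\<^esub> \<iota> b) \<otimes>\<^bsub>L\<^esub> (Y [^]\<^bsub>L\<^esub> k \<otimes>\<^bsub>L\<^esub> Y [^]\<^bsub>L\<^esub> l)"
        using emb.hom_closed[OF c(1)] emb.hom_closed[OF c(2)] L.nat_pow_closed[OF Y_closed]
        by (simp add: L.m_assoc L.m_lcomm)
      also have "\<dots> = \<iota> (a \<otimes> b) \<otimes>\<^bsub>L\<^esub> Y [^]\<^bsub>L\<^esub> (k + l)"
        using c Y_closed by (simp add: L.nat_pow_mult)
      also have "\<dots> \<in> fil (m + n)"
      proof (rule fil.fil_monom)
        show "a \<otimes> b \<in> val_ideal (r + s)" using fil_monom \<open>a \<in> val_ideal r\<close> fil_mult by blast
        show "m + n \<le> int e * (r + s) + int (k + l)"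
          using fil_monom \<open>m \<le> int e * r + int k\<close> by (simp add: algebra_simps)
      qed
      finally show ?case .
    next
      case (fil_sum y z)
      have "\<iota> a \<otimes>\<^bsub>L\<^esub> Y [^]\<^bsub>L\<^esub> k \<in> carrier L" using \<open>a \<in> val_ideal r\<close> fil_closed Y_closed by simp
      then show ?case using fil_sum fil_in_carrier by (simp add: L.r_distr fil.fil_sum)
    qed
  next
    case (fil_sum x z)
    then show ?case using fil_in_carrier that(2) by (simp add: L.l_distr fil.fil_sum)
  qed
  have "\<iota> \<one> \<otimes>\<^bsub>L\<^esub> Y [^]\<^bsub>L\<^esub> (0 :: nat) \<in> fil 0"
    by (rule fil_monom[of \<one> 0]) (auto simp: fil_one)
  then show "\<one>\<^bsub>L\<^esub> \<in> fil 0" by simp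
qed

lemma emb_fil: "a \<in> val_ideal m \<Longrightarrow> n \<le> int e * m \<Longrightarrow> \<iota> a \<in> fil n"
  using fil_monom[of a m n 0] fil_closed by simp

text \<open>Each block of \<open>e\<close> factors \<open>Y\<close> is traded for one factor
  \<open>\<pi>\<close>. The valuation of the coefficient rises by one for each block, so the order
  of the monomial is unchanged.\<close>

lemma monom_reduce:
  assumes "a \<in> val_ideal m"
  shows "a \<otimes> \<pi> [^] (k div e) \<in> val_ideal (m + int (k div e))"
    and "\<iota> a \<otimes>\<^bsub>L\<^esub> Y [^]\<^bsub>L\<^esub> k = \<iota> (a \<otimes> \<pi> [^] (k div e)) \<otimes>\<^bsub>L\<^esub> Y [^]\<^bsub>L\<^esub> (k mod e)"
proof -
  have "\<pi> \<in> val_ideal 1" using uniformiser by (simp add: mem_val_ideal)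
  from fil_pow[OF this, of "k div e"] show "a \<otimes> \<pi> [^] (k div e) \<in> val_ideal (m + int (k div e))"
    using assms fil_mult by simp
  have a: "a \<in> carrier F" using assms fil_closed by blast
  have "Y [^]\<^bsub>L\<^esub> k = Y [^]\<^bsub>L\<^esub> (e * (k div e)) \<otimes>\<^bsub>L\<^esub> Y [^]\<^bsub>L\<^esub> (k mod e)"
    using L.nat_pow_mult[OF Y_closed] by simp
  also have "\<dots> = \<iota> (\<pi> [^] (k div e)) \<otimes>\<^bsub>L\<^esub> Y [^]\<^bsub>L\<^esub> (k mod e)" by (simp add: Y_pow_mult)
  finally show "\<iota> a \<otimes>\<^bsub>L\<^esub> Y [^]\<^bsub>L\<^esub> k = \<iota> (a \<otimes> \<pi> [^] (k div e)) \<otimes>\<^bsub>L\<^esub> Y [^]\<^bsub>L\<^esub> (k mod e)"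
    using a uniformiser Y_closed by (simp add: L.m_assoc)
qed

text \<open>The generators of \<open>fil\<close> present an element in many ways. Reducing exponents
  below \<open>e\<close> makes the coefficients unique, so that membership becomes a bound on each
  of them. The bound is phrased through some \<open>m\<close> because a zero coefficient has no
  valuation.\<close>

lemma fil_normal_form:
  assumes "x \<in> fil n"
  shows "\<exists>p \<in> carrier (poly_ring F). length p \<le> e \<and> x = proj p \<and>
    (\<forall>j. \<exists>m. n \<le> int e * m + int j \<and> coeff p j \<in> val_ideal m)"
  using assms
proof (induct rule: fil.induct)
  case (fil_monom a m k)
  define c where "c = a \<otimes> \<pi> [^] (k div e)"
  have c: "c \<in> val_ideal (m + int (k div e))" "\<iota> a \<otimes>\<^bsub>L\<^esub> Y [^]\<^bsub>L\<^esub> k = \<iota> c \<otimes>\<^bsub>L\<^esub> Y [^]\<^bsub>L\<^esub> (k mod e)"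
    using monom_reduce[OF fil_monom(1)] by (auto simp: c_def)
  have z: "\<exists>m. n \<le> int e * m + int j \<and> \<zero> \<in> val_ideal m" for j
  proof -
    have "n \<le> \<bar>n\<bar>" by simp
    also have "\<bar>n\<bar> \<le> int e * \<bar>n\<bar>" using exponent_pos by (simp add: mult_le_cancel_right1)
    finally show ?thesis by (intro exI[of _ "\<bar>n\<bar>"]) (auto simp: fil_zero)
  qed
  show ?case
  proof (cases "c = \<zero>")
    case True
    have "proj [] = \<zero>\<^bsub>L\<^esub>"
      using ring_hom_zero[OF proj_hom] poly_domain L.ring_axioms
      by (simp add: domain_def cring_def univ_poly_zero)
    then show ?thesis using c True z Y_closed by (intro bexI[of _ "[]"]) auto
  next
    case False
    then have cn: "c \<in> carrier F - {\<zero>}" using c fil_closed by auto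
    have "n \<le> int e * (m + int (k div e)) + int (k mod e)"
    proof -
      have "int k = int e * int (k div e) + int (k mod e)"
        by (metis mult_div_mod_eq of_nat_add of_nat_mult)
      then show ?thesis using fil_monom(2) by (simp add: algebra_simps)
    qed
    then have "\<forall>j. \<exists>m. n \<le> int e * m + int j \<and> coeff (monom c (k mod e)) j \<in> val_ideal m"
      using c(1) z by (auto simp: monom_coeff)
    moreover have "monom c (k mod e) \<in> carrier (poly_ring F)"
      using monom_is_polynomial[OF carrier_is_subring cn] univ_poly_carrier by blast
    moreover have "length (monom c (k mod e)) \<le> e" using exponent_pos by (simp add: monom_def Suc_leI)
    ultimately show ?thesis using c(2) proj_monom[OF cn] by (intro bexI[of _ "monom c (k mod e)"]) auto
  qed
next
  case (fil_sum x y)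
  then obtain p q where p: "p \<in> carrier (poly_ring F)" "length p \<le> e" "x = proj p"
    "\<And>j. \<exists>m. n \<le> int e * m + int j \<and> coeff p j \<in> val_ideal m"
    and q: "q \<in> carrier (poly_ring F)" "length q \<le> e" "y = proj q"
    "\<And>j. \<exists>m. n \<le> int e * m + int j \<and> coeff q j \<in> val_ideal m" by metis
  interpret UP: domain "poly_ring F" by (rule poly_domain)
  have s: "set p \<subseteq> carrier F" "set q \<subseteq> carrier F" using p q polynomial_incl univ_poly_carrier by blast+
  have eq: "p \<oplus>\<^bsub>poly_ring F\<^esub> q = poly_add p q" by (simp add: univ_poly_add)
  have "proj (poly_add p q) = x \<oplus>\<^bsub>L\<^esub> y" using ring_hom_add[OF proj_hom p(1) q(1)] p q eq by simp
  moreover have "poly_add p q \<in> carrier (poly_ring F)" using UP.a_closed[OF p(1) q(1)] eq by simp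
  moreover have "length (poly_add p q) \<le> e" using poly_add_length_le[of p q] p q by simp
  moreover have "\<exists>m. n \<le> int e * m + int j \<and> coeff (poly_add p q) j \<in> val_ideal m" for j
  proof -
    obtain m m' where m: "n \<le> int e * m + int j" "coeff p j \<in> val_ideal m"
      "n \<le> int e * m' + int j" "coeff q j \<in> val_ideal m'" using p(4)[of j] q(4)[of j] by blast
    have "coeff (poly_add p q) j \<in> val_ideal (min m m')"
      using poly_add_coeff[OF s] fil_weaken[OF m(2), of "min m m'"] fil_weaken[OF m(4), of "min m m'"]
        fil_add by simp
    moreover have "n \<le> int e * min m m' + int j" using m by (simp add: min_def)
    ultimately show ?thesis by blast
  qed
  ultimately show ?case by (intro bexI[of _ "poly_add p q"]) auto
qed

text \<open>The normal form of \<open>\<iota> a\<close> is the constant polynomial. Together with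
  \<open>emb_fil\<close> this shows that \<open>fil\<close> induces on \<open>F\<close> the
  filtration of \<open>w\<close>, scaled by \<open>e\<close>.\<close>

lemma emb_mem_fil:
  assumes "\<iota> a \<in> fil n" "a \<in> carrier F"
  shows "\<exists>m. n \<le> int e * m \<and> a \<in> val_ideal m"
proof -
  obtain p where p: "p \<in> carrier (poly_ring F)" "length p \<le> e" "\<iota> a = proj p"
    "\<And>j. \<exists>m. n \<le> int e * m + int j \<and> coeff p j \<in> val_ideal m"
    using fil_normal_form[OF assms(1)] by blast
  have "length (poly_of_const a) \<le> e" using exponent_pos by (simp add: poly_of_const_def)
  then have "p = poly_of_const a"
    using proj_inj[OF p(1,2) const_closed[OF assms(2)]] p(3) emb_eq by simp
  moreover have "coeff (poly_of_const a) 0 = a" by (simp add: poly_of_const_def)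
  ultimately show ?thesis using p(4)[of 0] by auto
qed

text \<open>The normal forms obtained for all \<open>n\<close> coincide by uniqueness, so each
  coefficient satisfies every bound and vanishes.\<close>

lemma fil_separated:
  assumes "\<And>n. x \<in> fil n"
  shows "x = \<zero>\<^bsub>L\<^esub>"
proof -
  obtain p where p: "p \<in> carrier (poly_ring F)" "length p \<le> e" "x = proj p"
    using fil_normal_form[OF assms, of 0] by blast
  have "coeff p j = \<zero>" for j
  proof (rule val_ideal_separated)
    fix k
    \<comment> \<open>The order is chosen so that the bound for the coefficient of degree
      \<open>j\<close> becomes \<open>k\<close>.\<close>
    obtain q where q: "q \<in> carrier (poly_ring F)" "length q \<le> e" "x = proj q"
      "\<And>j'. \<exists>m. int e * k + int j \<le> int e * m + int j' \<and> coeff q j' \<in> val_ideal m"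
      using fil_normal_form[OF assms, of "int e * k + int j"] by blast
    have "q = p" using proj_inj p q by metis
    then obtain m where "int e * k \<le> int e * m" "coeff p j \<in> val_ideal m" using q(4)[of j] by auto
    then show "coeff p j \<in> val_ideal k" using exponent_pos fil_weaken by auto
  qed
  then have "coeff p = coeff []" by auto
  then have "p = []"
    using coeff_iff_polynomial_cond[of "carrier F" p "[]"] p(1) univ_poly_carrier zero_is_polynomial by blast
  then show ?thesis
    using p(3) ring_hom_zero[OF proj_hom] poly_domain L.ring_axioms
    by (simp add: domain_def cring_def univ_poly_zero)
qed

section \<open>Leading terms and exact orders\<close>

lemma fil_exhausts:
  assumes "x \<in> carrier L"
  shows "\<exists>n. x \<in> fil n"
  using assms
proof (induct rule: L_induct)
  case (add x y)
  then obtain m n where "x \<in> fil m" "y \<in> fil n" by blast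
  then have "x \<in> fil (min m n)" "y \<in> fil (min m n)"
    using L.fil_weaken[of x m "min m n"] L.fil_weaken[of y n "min m n"] by auto
  then show ?case using fil_sum by blast
next
  case (monom a k)
  have "a \<in> val_ideal (w a)" using monom by (simp add: mem_val_ideal)
  then show ?case using fil_monom[of a "w a" "int e * w a + int k" k] by blast
qed

text \<open>The order of a monomial with exponent below \<open>e\<close> is congruent to that
  exponent modulo \<open>e\<close>. Hence all terms of order exactly \<open>n\<close> carry the same
  power of \<open>Y\<close>, and their coefficients add up to a single \<open>c\<close>.\<close>

lemma leading_term:
  assumes "z \<in> fil n"
  shows "\<exists>c \<in> val_ideal (n div int e). z \<ominus>\<^bsub>L\<^esub> \<iota> c \<otimes>\<^bsub>L\<^esub> Y [^]\<^bsub>L\<^esub> nat (n mod int e) \<in> fil (n + 1)"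
  using assms
proof (induct rule: fil.induct)
  case (fil_monom a m k)
  show ?case
  proof (cases "n + 1 \<le> int e * m + int k")
    \<comment> \<open>A generator of order above \<open>n\<close> contributes the leading
      coefficient zero.\<close>
    case True
    then have "\<iota> a \<otimes>\<^bsub>L\<^esub> Y [^]\<^bsub>L\<^esub> k \<in> fil (n + 1)" using fil_monom(1) fil.fil_monom by blast
    then show ?thesis using fil_zero Y_closed fil_closed[OF fil_monom(1)]
      by (intro bexI[of _ \<zero>]) (auto simp: a_minus_def)
  next
    case False
    then have n: "n = int e * m + int k" using fil_monom(2) by simp
    then have "n div int e = m + int (k div e)" "nat (n mod int e) = k mod e"
      using exponent_pos by (auto simp: zdiv_int nat_mod_as_int)
    then show ?thesis
      using monom_reduce[OF fil_monom(1), of k] L.fil_zero fil_closed[OF fil_monom(1)] Y_closed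
        fil_closed[OF monom_reduce(1)[OF fil_monom(1)], of k]
      by (intro bexI[of _ "a \<otimes> \<pi> [^] (k div e)"]) (auto simp: a_minus_def L.r_neg)
  qed
next
  case (fil_sum x y)
  define j where "j = nat (n mod int e)"
  obtain c d where c: "c \<in> val_ideal (n div int e)" "x \<ominus>\<^bsub>L\<^esub> \<iota> c \<otimes>\<^bsub>L\<^esub> Y [^]\<^bsub>L\<^esub> j \<in> fil (n + 1)"
    and d: "d \<in> val_ideal (n div int e)" "y \<ominus>\<^bsub>L\<^esub> \<iota> d \<otimes>\<^bsub>L\<^esub> Y [^]\<^bsub>L\<^esub> j \<in> fil (n + 1)"
    using fil_sum unfolding j_def by blast
  define C D B where "C = \<iota> c" "D = \<iota> d" "B = Y [^]\<^bsub>L\<^esub> j"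
  have CD: "C \<in> carrier L" "D \<in> carrier L" "B \<in> carrier L" "x \<in> carrier L" "y \<in> carrier L"
    unfolding C_D_B_def using c d fil_closed Y_closed fil_sum fil_in_carrier by auto
  have "\<iota> (c \<oplus> d) = C \<oplus>\<^bsub>L\<^esub> D" using c d fil_closed by (simp add: C_D_B_def)
  moreover have "(x \<oplus>\<^bsub>L\<^esub> y) \<ominus>\<^bsub>L\<^esub> (C \<oplus>\<^bsub>L\<^esub> D) \<otimes>\<^bsub>L\<^esub> B = (x \<ominus>\<^bsub>L\<^esub> C \<otimes>\<^bsub>L\<^esub> B) \<oplus>\<^bsub>L\<^esub> (y \<ominus>\<^bsub>L\<^esub> D \<otimes>\<^bsub>L\<^esub> B)"
    using CD by algebra
  ultimately show ?case using c d fil_add[OF c(1) d(1)] L.fil_add[OF c(2) d(2)]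
    by (intro bexI[of _ "c \<oplus> d"]) (auto simp: C_D_B_def j_def)
qed

text \<open>Multiplying by a further power of \<open>Y\<close> raises the exponent from
  \<open>k\<close> to the multiple \<open>e * k\<close> of \<open>e\<close> and turns the monomial
  into an element of \<open>F\<close>, whose order is known.\<close>

lemma monom_mem_fil:
  assumes "c \<in> carrier F - {\<zero>}" "\<iota> c \<otimes>\<^bsub>L\<^esub> Y [^]\<^bsub>L\<^esub> (k :: nat) \<in> fil n"
  shows "n \<le> int e * w c + int k"
proof -
  define r where "r = (e - 1) * k"
  have kr: "k + r = e * k" unfolding r_def using exponent_pos by (cases e) auto
  have "\<iota> \<one> \<otimes>\<^bsub>L\<^esub> Y [^]\<^bsub>L\<^esub> r \<in> fil (int r)" by (rule fil_monom[of \<one> 0]) (auto simp: fil_one)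
  then have "Y [^]\<^bsub>L\<^esub> r \<in> fil (int r)" using Y_closed by simp
  then have "\<iota> c \<otimes>\<^bsub>L\<^esub> Y [^]\<^bsub>L\<^esub> k \<otimes>\<^bsub>L\<^esub> Y [^]\<^bsub>L\<^esub> r \<in> fil (n + int r)" using assms(2) L.fil_mult by blast
  moreover have "\<iota> c \<otimes>\<^bsub>L\<^esub> Y [^]\<^bsub>L\<^esub> k \<otimes>\<^bsub>L\<^esub> Y [^]\<^bsub>L\<^esub> r = \<iota> (c \<otimes> \<pi> [^] k)"
  proof -
    have "\<iota> c \<otimes>\<^bsub>L\<^esub> Y [^]\<^bsub>L\<^esub> k \<otimes>\<^bsub>L\<^esub> Y [^]\<^bsub>L\<^esub> r = \<iota> c \<otimes>\<^bsub>L\<^esub> Y [^]\<^bsub>L\<^esub> (k + r)"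
      using assms(1) Y_closed by (simp add: L.m_assoc L.nat_pow_mult)
    then show ?thesis using assms(1) uniformiser by (simp add: kr Y_pow_mult)
  qed
  ultimately have "\<iota> (c \<otimes> \<pi> [^] k) \<in> fil (n + int r)" by simp
  moreover have p: "\<pi> [^] k \<in> carrier F - {\<zero>}" by (rule pow_nonzero[OF uniformiser(1)])
  ultimately obtain m where m: "n + int r \<le> int e * m" "c \<otimes> \<pi> [^] k \<in> val_ideal m"
    using emb_mem_fil assms(1) by blast
  have "m \<le> w c + int k"
    using val_idealD[OF m(2)] mult_nonzero[OF assms(1) p] val_mult[OF assms(1) p]
      val_pow[OF uniformiser(1), of k] uniformiser(2) by simp
  then have "int e * m \<le> int e * (w c + int k)" by (simp add: mult_left_mono)
  moreover have "int e * int k = int k + int r" using kr by (metis of_nat_add of_nat_mult)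
  ultimately show ?thesis using m(1) by (simp add: algebra_simps)
qed

text \<open>Since the filtration is exhaustive and separated, there is a last step \<open>m\<close>
  that contains \<open>z\<close>. The leading coefficient there has valuation exactly
  \<open>m div int e\<close>, as otherwise its monomial would be absorbed by the error.\<close>

lemma exists_leading_term:
  assumes "z \<in> carrier L" "z \<noteq> \<zero>\<^bsub>L\<^esub>"
  obtains m c j where "z \<in> fil m" "c \<in> carrier F - {\<zero>}" "m = int e * w c + int j" "j < e"
    "z \<ominus>\<^bsub>L\<^esub> \<iota> c \<otimes>\<^bsub>L\<^esub> Y [^]\<^bsub>L\<^esub> j \<in> fil (m + 1)"
proof -
  obtain n0 where n0: "z \<in> fil n0" using fil_exhausts[OF assms(1)] by blast
  obtain n1 where n1: "z \<notin> fil n1" using fil_separated assms(2) by blast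
  have "z \<notin> fil (n0 + int (nat (n1 - n0)))" using n1 L.fil_weaken[of z _ n1] by force
  \<comment> \<open>The least distance at which \<open>z\<close> has left the filtration; at
    \<open>d - 1\<close> it is still inside.\<close>
  define d where "d = (LEAST d. z \<notin> fil (n0 + int d))"
  have d: "z \<notin> fil (n0 + int d)" unfolding d_def by (rule LeastI) fact
  then have "d \<noteq> 0" using n0 by (metis add.right_neutral of_nat_0)
  then have "z \<in> fil (n0 + int (d - 1))" using not_less_Least[of "d - 1" "\<lambda>d. z \<notin> fil (n0 + int d)"]
    unfolding d_def[symmetric] by simp
  define m where "m = n0 + int (d - 1)"
  have m: "z \<in> fil m" "z \<notin> fil (m + 1)"
    using \<open>z \<in> fil (n0 + int (d - 1))\<close> d \<open>d \<noteq> 0\<close> by (auto simp: m_def of_nat_diff)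
  define j where "j = nat (m mod int e)"
  have j: "int j = m mod int e" "j < e" using exponent_pos by (auto simp: j_def nat_less_iff)
  obtain c where c: "c \<in> val_ideal (m div int e)" "z \<ominus>\<^bsub>L\<^esub> \<iota> c \<otimes>\<^bsub>L\<^esub> Y [^]\<^bsub>L\<^esub> j \<in> fil (m + 1)"
    using leading_term[OF m(1)] unfolding j_def by blast
  have mdm: "m = int e * (m div int e) + int j" by (simp add: j)
  have cc: "c \<in> carrier F" using c(1) fil_closed by blast
  have "c \<notin> val_ideal (m div int e + 1)"
  proof
    assume "c \<in> val_ideal (m div int e + 1)"
    moreover have "m + 1 \<le> int e * (m div int e + 1) + int j"
      using mdm exponent_pos by (simp add: algebra_simps)
    ultimately have "\<iota> c \<otimes>\<^bsub>L\<^esub> Y [^]\<^bsub>L\<^esub> j \<in> fil (m + 1)" using fil_monom by blast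
    then show False using L.fil_of_diff[OF c(2)] assms(1) m(2) by blast
  qed
  then have "c \<noteq> \<zero>" "w c = m div int e" using c(1) cc by (auto simp: mem_val_ideal)
  then show thesis using that[OF m(1), of c j] c(2) mdm j(2) cc by simp
qed

end

section \<open>Roots of unity and radicands in the radical extension\<close>

context radical_extension
begin

lemma monom_pow:
  assumes "c \<in> carrier F"
  shows "(\<iota> c \<otimes>\<^bsub>L\<^esub> Y [^]\<^bsub>L\<^esub> j) [^]\<^bsub>L\<^esub> (n :: nat) = \<iota> (c [^] n) \<otimes>\<^bsub>L\<^esub> Y [^]\<^bsub>L\<^esub> (j * n)"
  using assms Y_closed L.nat_pow_distrib[of "\<iota> c" "Y [^]\<^bsub>L\<^esub> j" n] L.nat_pow_pow[OF Y_closed, of j n]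
    emb.hom_nat_pow[OF assms, of n] by simp

text \<open>A root of unity has order zero, so its leading term is a unit \<open>c\<close> of
  \<open>F\<close>: this reflects that there is no residue extension. The root of unity
  \<open>\<tau>\<close> of \<open>F\<close> with the residue of \<open>c\<close> then differs from
  \<open>z\<close> by a one-unit factor, which is again a root of unity and hence one.\<close>

lemma root_of_unity_in_base:
  assumes N: "(N :: nat) > 0" "add_pow F N \<one> \<noteq> \<zero>" "w (add_pow F N \<one>) = 0"
    and lift: "\<And>x. \<lbrakk> x \<in> val_ideal 0; x \<notin> val_ideal 1 \<rbrakk> \<Longrightarrow>
      \<exists>\<tau> \<in> carrier F. \<tau> [^] N = \<one> \<and> \<tau> \<ominus> x \<in> val_ideal 1"
    and z: "z \<in> carrier L" "z [^]\<^bsub>L\<^esub> N = \<one>\<^bsub>L\<^esub>"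
  shows "\<exists>\<tau> \<in> carrier F. z = \<iota> \<tau>"
proof -
  have one1: "\<one>\<^bsub>L\<^esub> \<notin> fil 1"
  proof
    assume "\<one>\<^bsub>L\<^esub> \<in> fil 1"
    then have "\<iota> \<one> \<otimes>\<^bsub>L\<^esub> Y [^]\<^bsub>L\<^esub> (0 :: nat) \<in> fil 1" by simp
    then show False using monom_mem_fil[of \<one> 0 1] val_one by simp
  qed
  have "z \<noteq> \<zero>\<^bsub>L\<^esub>"
  proof
    assume "z = \<zero>\<^bsub>L\<^esub>"
    then have "\<one>\<^bsub>L\<^esub> = \<zero>\<^bsub>L\<^esub>" using z(2) N(1) by (simp add: L.nat_pow_zero)
    then show False using one1 L.fil_zero by simp
  qed
  then obtain m c j where m: "z \<in> fil m" "c \<in> carrier F - {\<zero>}" "m = int e * w c + int j" "j < e"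
    "z \<ominus>\<^bsub>L\<^esub> \<iota> c \<otimes>\<^bsub>L\<^esub> Y [^]\<^bsub>L\<^esub> j \<in> fil (m + 1)"
    using exists_leading_term[OF z(1)] by metis
  define b where "b = \<iota> c \<otimes>\<^bsub>L\<^esub> Y [^]\<^bsub>L\<^esub> j"
  have cv: "c \<in> val_ideal (w c)" using m(2) by (simp add: mem_val_ideal)
  have b: "b \<in> fil m" unfolding b_def using fil_monom[OF cv, of m j] m(3) by simp
  have bc: "b \<in> carrier L" using b fil_in_carrier by blast
  have "z [^]\<^bsub>L\<^esub> N \<ominus>\<^bsub>L\<^esub> b [^]\<^bsub>L\<^esub> N \<in> fil (int N * m + 1)"
    by (rule L.fil_pow_diff[OF m(1) b m(5)[folded b_def]])
  then have d: "b [^]\<^bsub>L\<^esub> N \<ominus>\<^bsub>L\<^esub> \<one>\<^bsub>L\<^esub> \<in> fil (int N * m + 1)"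
    using L.fil_diff_sym z bc by simp
  have bN: "b [^]\<^bsub>L\<^esub> N \<notin> fil (int N * m + 1)"
  proof
    assume "b [^]\<^bsub>L\<^esub> N \<in> fil (int N * m + 1)"
    then have "int N * m + 1 \<le> int e * w (c [^] N) + int (j * N)"
      using monom_mem_fil[OF pow_nonzero[OF m(2), of N], of "j * N" "int N * m + 1"] m(2) unfolding b_def by (simp add: monom_pow)
    then show False using m(3) val_pow[OF m(2), of N] by (simp add: algebra_simps)
  qed
  \<comment> \<open>A positive order would put one into \<open>fil 1\<close>. For a negative order,
    one would disappear in the error term, and the \<open>N\<close>-th power of the leading monomial
    would have too large an order.\<close>
  have m0: "m = 0"
  proof (rule ccontr)
    assume "m \<noteq> 0"
    then consider "m > 0" | "m < 0" by linarith
    then show False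
    proof cases
      case 1
      then have "int N * m \<ge> 1" using N(1) by (metis int_one_le_iff_zero_less mult_pos_pos of_nat_0_less_iff)
      then show False using L.fil_weaken[OF L.fil_pow[OF m(1), of N]] z(2) one1 by simp
    next
      case 2
      then have "int N * m < 0" using N(1) by (simp add: mult_pos_neg)
      then have "\<one>\<^bsub>L\<^esub> \<in> fil (int N * m + 1)" using L.fil_weaken[OF L.fil_one] by simp
      then show False using L.fil_of_diff[OF d] bc bN by simp
    qed
  qed
  have wc: "w c = 0"
  proof -
    have "int e * w c + int j = 0" using m(3) m0 by simp
    then have "w c = - (int j) div int e" using exponent_pos
      by (metis add.commute add_eq_0_iff nonzero_mult_div_cancel_left of_nat_0_eq_iff neq0_conv)
    moreover have "int e dvd int j" using \<open>int e * w c + int j = 0\<close>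
      by (metis add.commute add_eq_0_iff dvd_minus_iff dvd_triv_left)
    then have "j = 0" using m(4) by (auto dest: dvd_imp_le)
    ultimately show ?thesis by simp
  qed
  have j0: "j = 0" using m(3) m0 wc by simp
  have zc: "z \<ominus>\<^bsub>L\<^esub> \<iota> c \<in> fil 1" using m(5) m(2) unfolding j0 m0 by simp
  have "c \<in> val_ideal 0" "c \<notin> val_ideal 1" using m(2) wc by (auto simp: mem_val_ideal)
  then obtain \<tau> where \<tau>: "\<tau> \<in> carrier F" "\<tau> [^] N = \<one>" "\<tau> \<ominus> c \<in> val_ideal 1" using lift by blast
  have "\<iota> (\<tau> \<ominus> c) \<in> fil 1" using emb_fil[OF \<tau>(3), of 1] exponent_pos by simp
  then have tc: "\<iota> \<tau> \<ominus>\<^bsub>L\<^esub> \<iota> c \<in> fil 1" using \<tau>(1) m(2) by (simp add: a_minus_def)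
  have zt: "z \<ominus>\<^bsub>L\<^esub> \<iota> \<tau> \<in> fil 1"
    by (rule L.fil_diff_trans[OF zc L.fil_diff_sym[OF tc]]) (use \<tau>(1) m(2) z(1) in auto)
  have tn: "\<tau> \<in> carrier F - {\<zero>}" using \<tau> N(1) by (auto simp: nat_pow_zero)
  have it: "inv \<tau> \<in> carrier F" "inv \<tau> \<otimes> \<tau> = \<one>" "\<tau> \<otimes> inv \<tau> = \<one>" using inv_nonzero[OF tn] by auto
  have "int N * w \<tau> = 0" using val_pow[OF tn, of N] \<tau>(2) val_one by simp
  then have wt: "w (inv \<tau>) = 0" using N(1) val_inv[OF tn] by simp
  have itN: "inv \<tau> [^] N = \<one>"
    using nat_pow_distrib[OF it(1) \<tau>(1), of N] it \<tau>(2) by simp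
  define y where "y = z \<otimes>\<^bsub>L\<^esub> \<iota> (inv \<tau>)"
  have ic: "\<iota> (inv \<tau>) \<in> carrier L" "\<iota> \<tau> \<in> carrier L" using it \<tau> by auto
  have itt: "\<iota> \<tau> \<otimes>\<^bsub>L\<^esub> \<iota> (inv \<tau>) = \<one>\<^bsub>L\<^esub>"
    using emb.hom_mult[OF \<tau>(1) it(1)] it(3) by simp
  have "y = \<one>\<^bsub>L\<^esub>"
  proof (rule L.one_unit_root_of_unity[OF fil_separated])
    have "y \<ominus>\<^bsub>L\<^esub> \<iota> \<tau> \<otimes>\<^bsub>L\<^esub> \<iota> (inv \<tau>) = (z \<ominus>\<^bsub>L\<^esub> \<iota> \<tau>) \<otimes>\<^bsub>L\<^esub> \<iota> (inv \<tau>)"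
      unfolding y_def using ic z(1) by algebra
    moreover have "\<iota> (inv \<tau>) \<in> fil 0" using emb_fil[of "inv \<tau>" 0 0] it(1) wt by (simp add: mem_val_ideal)
    ultimately show "y \<ominus>\<^bsub>L\<^esub> \<one>\<^bsub>L\<^esub> \<in> fil 1"
      using L.fil_mult[OF zt, of "\<iota> (inv \<tau>)" 0] itt by simp
    show "y \<in> carrier L" using ic z(1) by (simp add: y_def)
    have "\<iota> (inv \<tau>) [^]\<^bsub>L\<^esub> N = \<one>\<^bsub>L\<^esub>"
      unfolding emb.hom_nat_pow[OF it(1), of N, symmetric] itN by simp
    then show "y [^]\<^bsub>L\<^esub> N = \<one>\<^bsub>L\<^esub>"
      unfolding y_def L.nat_pow_distrib[OF z(1) ic(1), of N] z(2) by simp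
    define n where "n = add_pow F N \<one>"
    have n: "n \<in> carrier F - {\<zero>}" "w n = 0" using N by (auto simp: n_def)
    have "inv n \<in> val_ideal 0" using inv_nonzero[OF n(1)] val_inv[OF n(1)] n(2) by (simp add: mem_val_ideal)
    then show "\<iota> (inv n) \<in> fil 0" using emb_fil[of "inv n" 0 0] by simp
    have "\<iota> (add_pow F k \<one>) = add_pow L k \<one>\<^bsub>L\<^esub>" for k :: nat by (induct k) auto
    then have "add_pow L N \<one>\<^bsub>L\<^esub> = \<iota> n" by (simp add: n_def)
    then show "\<iota> (inv n) \<otimes>\<^bsub>L\<^esub> add_pow L N \<one>\<^bsub>L\<^esub> = \<one>\<^bsub>L\<^esub>"
      using emb.hom_mult[of "inv n" n] inv_nonzero[OF n(1)] n(1) by simp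
  qed
  then have "z \<otimes>\<^bsub>L\<^esub> (\<iota> \<tau> \<otimes>\<^bsub>L\<^esub> \<iota> (inv \<tau>)) = \<iota> \<tau>"
    unfolding y_def using ic z(1) by (metis L.l_one L.m_assoc L.m_comm)
  then show ?thesis using itt z(1) \<tau>(1) by auto
qed

text \<open>The \<open>e\<close>-th power of the leading monomial of \<open>z\<close> lies in
  \<open>F\<close> again, with valuation equal to the order \<open>m\<close> of \<open>z\<close>. It
  must match \<open>a\<close>, so \<open>m\<close> is 1, and for \<open>e > 1\<close> division with
  remainder gives \<open>w c = 0\<close> and \<open>j = 1\<close>. For \<open>e = 1\<close> the
  exponent \<open>j\<close> could only be 0.\<close>

lemma radicand_congruence:
  assumes e: "e > 1" and z: "z \<in> carrier L" "z [^]\<^bsub>L\<^esub> e = \<iota> a"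
    and a: "a \<in> carrier F - {\<zero>}" "w a = 1"
  obtains c where "c \<in> carrier F - {\<zero>}" "w c = 0" "a \<ominus> c [^] e \<otimes> \<pi> \<in> val_ideal 2"
proof -
  have "z \<noteq> \<zero>\<^bsub>L\<^esub>"
  proof
    assume "z = \<zero>\<^bsub>L\<^esub>"
    then have "\<iota> a \<otimes>\<^bsub>L\<^esub> Y [^]\<^bsub>L\<^esub> (0 :: nat) \<in> fil (int e + 1)"
      using z e a L.fil_zero by (simp add: L.nat_pow_zero flip: z(2))
    then show False using monom_mem_fil[OF a(1), of 0] a(2) by fastforce
  qed
  then obtain m c j where m: "z \<in> fil m" "c \<in> carrier F - {\<zero>}" "m = int e * w c + int j" "j < e"
    "z \<ominus>\<^bsub>L\<^esub> \<iota> c \<otimes>\<^bsub>L\<^esub> Y [^]\<^bsub>L\<^esub> j \<in> fil (m + 1)"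
    using exists_leading_term[OF z(1)] by metis
  define b where "b = c [^] e \<otimes> \<pi> [^] j"
  have bn: "b \<in> carrier F - {\<zero>}"
    unfolding b_def by (rule mult_nonzero[OF pow_nonzero[OF m(2)] pow_nonzero[OF uniformiser(1)]])
  have wb: "w b = m"
    unfolding b_def using val_mult[OF pow_nonzero[OF m(2)] pow_nonzero[OF uniformiser(1)]]
      val_pow[OF m(2)] val_pow[OF uniformiser(1)] uniformiser(2) m(3) by simp
  have "c \<in> val_ideal (w c)" using m(2) by (simp add: mem_val_ideal)
  then have "\<iota> c \<otimes>\<^bsub>L\<^esub> Y [^]\<^bsub>L\<^esub> j \<in> fil m" using fil_monom[of c "w c" m j] m(3) by simp
  from L.fil_pow_diff[OF m(1) this m(5), of e]
  have "\<iota> a \<ominus>\<^bsub>L\<^esub> \<iota> (c [^] e) \<otimes>\<^bsub>L\<^esub> Y [^]\<^bsub>L\<^esub> (e * j) \<in> fil (int e * m + 1)"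
    using m(2) z(2) monom_pow[of c j e] by (simp add: mult.commute)
  then have "\<iota> (a \<ominus> b) \<in> fil (int e * m + 1)"
    using m(2) a uniformiser(1) by (simp add: Y_pow_mult b_def a_minus_def)
  then obtain m' where m': "int e * m + 1 \<le> int e * m'" "a \<ominus> b \<in> val_ideal m'"
    using emb_mem_fil a(1) bn by blast
  \<comment> \<open>Elements of \<open>F\<close> have orders divisible by \<open>e\<close>, so
    exceeding \<open>int e * m\<close> at all means gaining a full unit of valuation.\<close>
  have "m < m'"
  proof (rule ccontr)
    assume "\<not> m < m'"
    then have "int e * m' \<le> int e * m" by (simp add: mult_left_mono)
    then show False using m'(1) by linarith
  qed
  then have ab: "a \<ominus> b \<in> val_ideal (w b + 1)" using fil_weaken[OF m'(2)] wb by simp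
  then have "m = 1" using val_eqI[OF ab] a bn wb by simp
  then have eq: "1 = int e * w c + int j" using m(3) by simp
  have "1 div int e = w c"
    by (rule int_div_pos_eq[OF eq]) (use m(4) in auto)
  then have wc: "w c = 0" using e by simp
  then have "j = 1" using eq by simp
  then show thesis using that[OF m(2) wc] ab wb \<open>m = 1\<close> uniformiser(1) by (simp add: b_def)
qed

end

section \<open>Universal property of the radical extension\<close>

lemma quotient_ring_universal:
  assumes I: "ideal I R" and S: "ring S" and h: "h \<in> ring_hom R S" and ker: "\<And>x. x \<in> I \<Longrightarrow> h x = \<zero>\<^bsub>S\<^esub>"
  obtains H where "H \<in> ring_hom (R Quot I) S" "\<And>x. x \<in> carrier R \<Longrightarrow> H (I +>\<^bsub>R\<^esub> x) = h x"
proof -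
  interpret I: ideal I R by (rule I)
  interpret h: ring_hom_ring R S h by (rule ring_hom_ringI2[OF I.ring_axioms S h])
  interpret Q: ring "R Quot I" by (rule I.quotient_is_ring)
  \<comment> \<open>\<open>r\<close> picks a representative of a coset; the resulting value is
    independent of the choice because \<open>h\<close> vanishes on \<open>I\<close>.\<close>
  define r where "r c = (SOME x. x \<in> carrier R \<and> c = I +>\<^bsub>R\<^esub> x)" for c
  define H where "H c = h (r c)" for c
  have H: "H (I +>\<^bsub>R\<^esub> x) = h x" if x: "x \<in> carrier R" for x
  proof -
    have "\<exists>y. y \<in> carrier R \<and> I +>\<^bsub>R\<^esub> x = I +>\<^bsub>R\<^esub> y" using x by blast
    from someI_ex[OF this] have y: "r (I +>\<^bsub>R\<^esub> x) \<in> carrier R" "I +>\<^bsub>R\<^esub> x = I +>\<^bsub>R\<^esub> r (I +>\<^bsub>R\<^esub> x)"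
      by (auto simp: r_def)
    then have "x \<ominus>\<^bsub>R\<^esub> r (I +>\<^bsub>R\<^esub> x) \<in> I" using I.quotient_eq_iff_same_a_r_cos[OF I x y(1)] by simp
    from ker[OF this] show ?thesis using x y(1) unfolding H_def a_minus_def
      by simp (metis h.S.minus_equality h.S.minus_minus h.S.add.inv_closed h.hom_closed)
  qed
  have cs: "\<exists>x \<in> carrier R. c = I +>\<^bsub>R\<^esub> x" if "c \<in> carrier (R Quot I)" for c
    using that by (auto simp: FactRing_def A_RCOSETS_def')
  note q = I.rcos_ring_hom
  have "H \<in> ring_hom (R Quot I) S"
  proof (rule ring_hom_memI)
    fix c assume "c \<in> carrier (R Quot I)"
    then show "H c \<in> carrier S" using cs H by fastforce
  next
    fix c d assume "c \<in> carrier (R Quot I)" "d \<in> carrier (R Quot I)"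
    then obtain x y where "x \<in> carrier R" "c = I +>\<^bsub>R\<^esub> x" "y \<in> carrier R" "d = I +>\<^bsub>R\<^esub> y" using cs by meson
    then show "H (c \<otimes>\<^bsub>R Quot I\<^esub> d) = H c \<otimes>\<^bsub>S\<^esub> H d" "H (c \<oplus>\<^bsub>R Quot I\<^esub> d) = H c \<oplus>\<^bsub>S\<^esub> H d"
      using ring_hom_mult[OF q, of x y] ring_hom_add[OF q, of x y] H by (simp_all flip: ring_hom_mult[OF q] ring_hom_add[OF q])
  next
    show "H \<one>\<^bsub>R Quot I\<^esub> = \<one>\<^bsub>S\<^esub>" using ring_hom_one[OF q] H[OF I.one_closed] by simp
  qed
  then show thesis using that H by blast
qed

context radical_extension
begin

lemma radical_ext_universal:
  assumes S: "cring S" and g: "g \<in> ring_hom F S" and z: "z \<in> carrier S" "z [^]\<^bsub>S\<^esub> e = g \<pi>"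
  obtains H where "H \<in> ring_hom L S" "\<And>a. a \<in> carrier F \<Longrightarrow> H (\<iota> a) = g a" "H Y = z"
proof -
  interpret S: cring S by (rule S)
  interpret g: ring_hom_ring F S g by (rule ring_hom_ringI2[OF ring_axioms S.ring_axioms g])
  interpret UP: domain "poly_ring F" by (rule poly_domain)
  define \<phi> where "\<phi> p = S.eval (map g p) z" for p
  have sp: "set p \<subseteq> carrier F" if "p \<in> carrier (poly_ring F)" for p
    using that polynomial_incl univ_poly_carrier by blast
  have sm: "set (map g p) \<subseteq> carrier S" if "set p \<subseteq> carrier F" for p using that by auto
  have hom: "\<phi> \<in> ring_hom (poly_ring F) S"
  proof (rule ring_hom_memI)
    fix p assume "p \<in> carrier (poly_ring F)"
    then show "\<phi> p \<in> carrier S" unfolding \<phi>_def using S.eval_in_carrier[OF sm[OF sp] z(1)] by blast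
  next
    fix p q assume pq: "p \<in> carrier (poly_ring F)" "q \<in> carrier (poly_ring F)"
    \<comment> \<open>Applying \<open>g\<close> to the coefficients may create leading zeros, so the
      list is normalised before products are compared; evaluation does not notice this. Sums are
      treated alike.\<close>
    have "\<phi> (poly_mult p q) = S.eval (S.normalize (map g (poly_mult p q))) z"
      unfolding \<phi>_def using S.eval_normalize[OF sm[OF poly_mult_in_carrier[OF sp sp]] z(1)] pq by simp
    also have "\<dots> = \<phi> p \<otimes>\<^bsub>S\<^esub> \<phi> q"
      unfolding g.poly_mult_hom'[OF sp[OF pq(1)] sp[OF pq(2)]] \<phi>_def
      by (rule S.eval_poly_mult[OF sm[OF sp[OF pq(1)]] sm[OF sp[OF pq(2)]] z(1)])
    finally show "\<phi> (p \<otimes>\<^bsub>poly_ring F\<^esub> q) = \<phi> p \<otimes>\<^bsub>S\<^esub> \<phi> q" by (simp add: univ_poly_mult)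
    have "\<phi> (poly_add p q) = S.eval (S.normalize (map g (poly_add p q))) z"
      unfolding \<phi>_def using S.eval_normalize[OF sm[OF poly_add_in_carrier[OF sp sp]] z(1)] pq by simp
    also have "\<dots> = \<phi> p \<oplus>\<^bsub>S\<^esub> \<phi> q"
      unfolding g.poly_add_hom'[OF sp[OF pq(1)] sp[OF pq(2)]] \<phi>_def
      by (rule S.eval_poly_add[OF sm[OF sp[OF pq(1)]] sm[OF sp[OF pq(2)]] z(1)])
    finally show "\<phi> (p \<oplus>\<^bsub>poly_ring F\<^esub> q) = \<phi> p \<oplus>\<^bsub>S\<^esub> \<phi> q" by (simp add: univ_poly_add del: poly_add.simps)
  next
    show "\<phi> \<one>\<^bsub>poly_ring F\<^esub> = \<one>\<^bsub>S\<^esub>" by (simp add: \<phi>_def univ_poly_one)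
  qed
  interpret p: ring_hom_ring "poly_ring F" S \<phi>
    by (rule ring_hom_ringI2[OF UP.ring_axioms S.ring_axioms hom])
  have X: "X \<in> carrier (poly_ring F)" by (rule var_closed(1)[OF carrier_is_subring])
  have pX: "\<phi> X = z" using z by (simp add: \<phi>_def var_def)
  have pc: "\<phi> (poly_of_const a) = g a" if "a \<in> carrier F" for a
    using that by (auto simp: \<phi>_def poly_of_const_def)
  have "\<phi> (radical_poly F e \<pi>) = \<phi> X [^]\<^bsub>S\<^esub> e \<ominus>\<^bsub>S\<^esub> \<phi> (poly_of_const \<pi>)"
    unfolding radical_poly_def a_minus_def
    using X const_closed uniformiser p.hom_nat_pow[OF X, of e] by simp
  then have pr: "\<phi> (radical_poly F e \<pi>) = \<zero>\<^bsub>S\<^esub>"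
    using pX pc uniformiser z by (simp add: a_minus_def S.r_neg)
  have "\<phi> q = \<zero>\<^bsub>S\<^esub>" if "q \<in> PIdl\<^bsub>poly_ring F\<^esub> radical_poly F e \<pi>" for q
    using that pr radical_poly_closed by (auto simp: cgenideal_def)
  then obtain H where H: "H \<in> ring_hom L S" "\<And>q. q \<in> carrier (poly_ring F) \<Longrightarrow> H (proj q) = \<phi> q"
    using quotient_ring_universal[OF UP.cgenideal_ideal[OF radical_poly_closed] S.ring_axioms hom]
    unfolding radical_ext_def rupture_def proj_def by metis
  show thesis
  proof (rule that[OF H(1)])
    show "H (\<iota> a) = g a" if "a \<in> carrier F" for a using H(2)[OF const_closed[OF that]] pc[OF that] by (simp add: emb_eq)
    show "H Y = z" using H(2)[OF X] pX by (simp add: Y_def)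
  qed
qed

lemma L_endo_id:
  assumes H: "H \<in> ring_hom L L" "\<And>a. a \<in> carrier F \<Longrightarrow> H (\<iota> a) = \<iota> a" "H Y = Y"
    and x: "x \<in> carrier L"
  shows "H x = x"
proof -
  interpret H: ring_hom_ring L L H by (rule ring_hom_ringI2[OF L.ring_axioms L.ring_axioms H(1)])
  show ?thesis
    using x
  proof (induct rule: L_induct)
    case (add x y) then show ?case by simp
  next
    case (monom a k) then show ?case using H Y_closed H.hom_nat_pow[OF Y_closed, of k] by simp
  qed
qed

end

text \<open>\<open>A.Y\<close> is sent to \<open>u\<close> times \<open>B.Y\<close>, where
  \<open>u\<close> is the inverse of \<open>x\<close>: the \<open>e\<close>-th power of this element
  is the image of \<open>g \<pi>\<close>. The inverse map arises in the same way from the inverse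
  \<open>g'\<close> of \<open>g\<close>, with \<open>g' x\<close> in place of
  \<open>u\<close>.\<close>

lemma radical_ext_iso:
  assumes r: "radical_extension F w e \<pi>" and r': "radical_extension F w e \<pi>'"
    and g: "g \<in> ring_iso F F" and x: "x \<in> carrier F - {\<zero>\<^bsub>F\<^esub>}"
    and eq: "\<pi>' = x [^]\<^bsub>F\<^esub> e \<otimes>\<^bsub>F\<^esub> g \<pi>"
  obtains h where "h \<in> ring_iso (radical_ext F e \<pi>) (radical_ext F e \<pi>')"
    "\<And>a. a \<in> carrier F \<Longrightarrow> h (radical_emb F e \<pi> a) = radical_emb F e \<pi>' (g a)"
proof -
  interpret A: radical_extension F w e \<pi> by (rule r)
  interpret B: radical_extension F w e \<pi>' by (rule r')
  have gh: "g \<in> ring_hom F F" and gb: "bij_betw g (carrier F) (carrier F)" using g by (auto simp: ring_iso_def)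
  define g' where "g' = inv_into (carrier F) g"
  have g': "g' \<in> ring_iso F F" unfolding g'_def by (rule ring_iso_set_sym[OF A.ring_axioms g])
  then have gh': "g' \<in> ring_hom F F" by (simp add: ring_iso_def)
  interpret g: ring_hom_ring F F g by (rule ring_hom_ringI2[OF A.ring_axioms A.ring_axioms gh])
  interpret g': ring_hom_ring F F g' by (rule ring_hom_ringI2[OF A.ring_axioms A.ring_axioms gh'])
  have gg': "g (g' a) = a" "g' (g a) = a" if "a \<in> carrier F" for a
    using gb that unfolding g'_def by (auto simp: bij_betw_def f_inv_into_f)
  define u where "u = inv\<^bsub>F\<^esub> x"
  have xc: "x \<in> carrier F" and u: "u \<in> carrier F" "u \<otimes>\<^bsub>F\<^esub> x = \<one>\<^bsub>F\<^esub>" "x \<otimes>\<^bsub>F\<^esub> u = \<one>\<^bsub>F\<^esub>"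
    using x A.inv_nonzero[OF x] by (auto simp: u_def)
  have pc: "\<pi> \<in> carrier F" "\<pi>' \<in> carrier F" using A.uniformiser B.uniformiser by auto
  have "u [^]\<^bsub>F\<^esub> e \<otimes>\<^bsub>F\<^esub> x [^]\<^bsub>F\<^esub> e = \<one>\<^bsub>F\<^esub>"
    using A.nat_pow_distrib[OF u(1) xc, of e] u(2) by simp
  then have e1: "u [^]\<^bsub>F\<^esub> e \<otimes>\<^bsub>F\<^esub> \<pi>' = g \<pi>"
    unfolding eq using u(1) xc pc by (simp flip: A.m_assoc)
  have e2: "g' x [^]\<^bsub>F\<^esub> e \<otimes>\<^bsub>F\<^esub> \<pi> = g' \<pi>'"
    unfolding eq using xc pc gg' g'.hom_nat_pow[OF xc, of e] by simp
  have z1: "B.emb u \<otimes>\<^bsub>B.L\<^esub> B.Y \<in> carrier B.L" "(B.emb u \<otimes>\<^bsub>B.L\<^esub> B.Y) [^]\<^bsub>B.L\<^esub> e = (B.emb \<circ> g) \<pi>"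
    using u B.Y_closed B.monom_pow[OF u(1), of 1 e] pc by (simp_all add: B.Y_pow flip: e1)
  have z2: "A.emb (g' x) \<otimes>\<^bsub>A.L\<^esub> A.Y \<in> carrier A.L"
    "(A.emb (g' x) \<otimes>\<^bsub>A.L\<^esub> A.Y) [^]\<^bsub>A.L\<^esub> e = (A.emb \<circ> g') \<pi>'"
    using xc A.Y_closed A.monom_pow[of "g' x" 1 e] pc by (simp_all add: A.Y_pow flip: e2)
  obtain H where H: "H \<in> ring_hom A.L B.L" "\<And>a. a \<in> carrier F \<Longrightarrow> H (A.emb a) = B.emb (g a)"
    "H A.Y = B.emb u \<otimes>\<^bsub>B.L\<^esub> B.Y"
    using A.radical_ext_universal[OF B.cring_L ring_hom_trans[OF gh B.emb_hom] z1] by auto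
  obtain H' where H': "H' \<in> ring_hom B.L A.L" "\<And>a. a \<in> carrier F \<Longrightarrow> H' (B.emb a) = A.emb (g' a)"
    "H' B.Y = A.emb (g' x) \<otimes>\<^bsub>A.L\<^esub> A.Y"
    using B.radical_ext_universal[OF A.cring_L ring_hom_trans[OF gh' A.emb_hom] z2] by auto
  interpret H: ring_hom_ring A.L B.L H by (rule ring_hom_ringI2[OF A.L.ring_axioms B.L.ring_axioms H(1)])
  interpret H': ring_hom_ring B.L A.L H' by (rule ring_hom_ringI2[OF B.L.ring_axioms A.L.ring_axioms H'(1)])
  have "H' (H A.Y) = (A.emb (g' u) \<otimes>\<^bsub>A.L\<^esub> A.emb (g' x)) \<otimes>\<^bsub>A.L\<^esub> A.Y"
    using H(3) H' u xc A.Y_closed B.Y_closed by (simp add: A.L.m_assoc)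
  also have "A.emb (g' u) \<otimes>\<^bsub>A.L\<^esub> A.emb (g' x) = \<one>\<^bsub>A.L\<^esub>"
    using u xc by (simp flip: A.emb.hom_mult g'.hom_mult)
  finally have Y1: "(H' \<circ> H) A.Y = A.Y" using A.Y_closed by simp
  have "H (H' B.Y) = (B.emb x \<otimes>\<^bsub>B.L\<^esub> B.emb u) \<otimes>\<^bsub>B.L\<^esub> B.Y"
    using H H'(3) u xc gg' A.Y_closed B.Y_closed by (simp add: B.L.m_assoc)
  also have "B.emb x \<otimes>\<^bsub>B.L\<^esub> B.emb u = \<one>\<^bsub>B.L\<^esub>"
    using u xc by (simp flip: B.emb.hom_mult)
  finally have Y2: "(H \<circ> H') B.Y = B.Y" using B.Y_closed by simp
  have id1: "H' (H y) = y" if "y \<in> carrier A.L" for y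
    using A.L_endo_id[OF ring_hom_trans[OF H(1) H'(1)] _ Y1 that] H H' gg' by simp
  have id2: "H (H' y) = y" if "y \<in> carrier B.L" for y
    using B.L_endo_id[OF ring_hom_trans[OF H'(1) H(1)] _ Y2 that] H H' gg' by simp
  have "bij_betw H (carrier A.L) (carrier B.L)"
    by (rule bij_betwI[of H _ _ H']) (use id1 id2 in auto)
  then have "H \<in> ring_iso A.L B.L" using H(1) by (simp add: ring_iso_def)
  then show thesis using that H(2) by blast
qed

section \<open>Classes modulo powers and ramified lines\<close>

context discretely_valued_field
begin

text \<open>The class of \<open>a\<close> in the unit group modulo \<open>e\<close>-th powers,
  unfolded to elements of \<open>R\<close>; \<open>rcoset_powers\<close> identifies it with the
  coset.\<close>

definition power_class :: "nat \<Rightarrow> 'a \<Rightarrow> 'a set" where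
  "power_class e a = {x [^] e \<otimes> a | x. x \<in> carrier R - {\<zero>}}"

lemma power_classE:
  assumes "b \<in> power_class e a"
  obtains x where "x \<in> carrier R - {\<zero>}" "b = x [^] e \<otimes> a"
  using assms by (auto simp: power_class_def)

lemma power_class_eqI:
  assumes a: "a \<in> carrier R - {\<zero>}" and b: "b \<in> power_class e a"
  shows "power_class e b = power_class e a"
proof -
  obtain x where x: "x \<in> carrier R - {\<zero>}" "b = x [^] e \<otimes> a" by (rule power_classE[OF b])
  have xc: "x \<in> carrier R" "a \<in> carrier R" using x a by auto
  have ix: "inv x \<in> carrier R - {\<zero>}" "x \<otimes> inv x = \<one>" "inv x \<otimes> x = \<one>" using inv_nonzero[OF x(1)] by auto
  have ixe: "inv x [^] e \<otimes> x [^] e = \<one>" using nat_pow_distrib[of "inv x" x e] ix xc by simp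
  show ?thesis
  proof (intro Set.set_eqI iffI)
    fix c assume "c \<in> power_class e b"
    then obtain y where y: "y \<in> carrier R - {\<zero>}" "c = y [^] e \<otimes> b" by (rule power_classE)
    then have "c = (y \<otimes> x) [^] e \<otimes> a" using xc x(2) by (simp add: nat_pow_distrib m_assoc)
    then show "c \<in> power_class e a" using mult_nonzero[OF y(1) x(1)] by (auto simp: power_class_def)
  next
    fix c assume "c \<in> power_class e a"
    then obtain y where y: "y \<in> carrier R - {\<zero>}" "c = y [^] e \<otimes> a" by (rule power_classE)
    have "(y \<otimes> inv x) [^] e \<otimes> b = y [^] e \<otimes> (inv x [^] e \<otimes> x [^] e) \<otimes> a"
      using y x(2) xc ix by (simp add: nat_pow_distrib m_assoc)
    then have "c = (y \<otimes> inv x) [^] e \<otimes> b" using y xc ixe by simp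
    then show "c \<in> power_class e b" using mult_nonzero[OF y(1) ix(1)] by (auto simp: power_class_def)
  qed
qed

lemma power_class_self: "a \<in> carrier R - {\<zero>} \<Longrightarrow> a \<in> power_class e a"
proof -
  assume a: "a \<in> carrier R - {\<zero>}"
  then have "a = \<one> [^] e \<otimes> a" by simp
  then show ?thesis unfolding power_class_def using one_not_zero by blast
qed

lemma power_class_pow:
  assumes "a \<in> carrier R - {\<zero>}" "b \<in> power_class e a"
  shows "b [^] (k :: nat) \<in> power_class e (a [^] k)"
proof -
  obtain x where x: "x \<in> carrier R - {\<zero>}" "b = x [^] e \<otimes> a" by (rule power_classE[OF assms(2)])
  have "b [^] k = (x [^] k) [^] e \<otimes> a [^] k"
    using x assms(1) by (simp add: nat_pow_distrib nat_pow_pow mult.commute)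
  then show ?thesis using pow_nonzero[OF x(1), of k] unfolding power_class_def by blast
qed

lemma units_carrier: "carrier (units_of R) = carrier R - {\<zero>}"
  by (simp add: units_of_carrier field_Units)

lemma units_pow: "x \<in> carrier R - {\<zero>} \<Longrightarrow> x [^]\<^bsub>units_of R\<^esub> (n :: nat) = x [^] n"
  by (rule units_of_pow) (simp add: field_Units)

lemma rcoset_powers:
  "((\<lambda>x. x [^]\<^bsub>units_of R\<^esub> e) ` carrier (units_of R)) #>\<^bsub>units_of R\<^esub> a = power_class e a"
  by (auto simp: r_coset_def power_class_def units_carrier units_pow units_of_mult)

lemma powers_normal: "(\<lambda>x. x [^]\<^bsub>units_of R\<^esub> (e :: nat)) ` carrier (units_of R) \<lhd> units_of R"
proof -
  interpret U: comm_group "units_of R" by (rule units_comm_group)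
  have "group_hom (units_of R) (units_of R) (\<lambda>x. x [^]\<^bsub>units_of R\<^esub> e)"
    by (intro group_hom.intro group_hom_axioms.intro U.is_group homI)
      (auto simp: U.nat_pow_distrib)
  then have "subgroup ((\<lambda>x. x [^]\<^bsub>units_of R\<^esub> e) ` carrier (units_of R)) (units_of R)"
    by (rule group_hom.img_is_subgroup)
  then show ?thesis by (rule U.subgroup_imp_normal)
qed

lemma carrier_mod_powers: "carrier (mod_powers R e) = power_class e ` (carrier R - {\<zero>})"
proof -
  have "carrier (mod_powers R e) = power_class e ` carrier (units_of R)"
    unfolding mod_powers_def carrier_FactGroup rcoset_powers ..
  then show ?thesis by (simp only: units_carrier)
qed

lemma mult_mod_powers:
  assumes "a \<in> carrier R - {\<zero>}" "b \<in> carrier R - {\<zero>}"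
  shows "power_class e a \<otimes>\<^bsub>mod_powers R e\<^esub> power_class e b = power_class e (a \<otimes> b)"
proof -
  have "a \<in> carrier (units_of R)" "b \<in> carrier (units_of R)" using assms by (simp_all add: units_carrier)
  from normal.rcos_sum[OF powers_normal this, of e] show ?thesis
    by (simp add: rcoset_powers mod_powers_def units_of_mult)
qed

lemma one_mod_powers: "\<one>\<^bsub>mod_powers R e\<^esub> = power_class e \<one>"
proof -
  interpret U: comm_group "units_of R" by (rule units_comm_group)
  have "(\<lambda>x. x [^]\<^bsub>units_of R\<^esub> e) ` carrier (units_of R) \<subseteq> carrier (units_of R)" by auto
  from U.coset_mult_one[OF this] show ?thesis
    by (simp add: rcoset_powers units_of_one mod_powers_def)
qed

lemma induced_val_power_class:
  assumes a: "a \<in> carrier R - {\<zero>}"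
  shows "induced_val v e (power_class e a) = v a mod int e"
proof -
  have "v b mod int e = v a mod int e" if b: "b \<in> power_class e a" for b
  proof -
    obtain x where x: "x \<in> carrier R - {\<zero>}" "b = x [^] e \<otimes> a" by (rule power_classE[OF b])
    then show ?thesis using val_mult[OF pow_nonzero[OF x(1)] a] val_pow[OF x(1)] by simp
  qed
  then have "(\<lambda>x. v x mod int e) ` power_class e a = (\<lambda>_. v a mod int e) ` power_class e a"
    by (rule image_cong[OF refl])
  also have "\<dots> = {v a mod int e}" by (rule image_constant[OF power_class_self[OF a]])
  finally show ?thesis by (simp add: induced_val_def)
qed

lemma ramified_line_inj:
  assumes "ramified_line R v e D" "power_class e a \<in> D" "power_class e b \<in> D"
    and "a \<in> carrier R - {\<zero>}" "b \<in> carrier R - {\<zero>}" "v a = v b"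
  shows "power_class e a = power_class e b"
proof -
  have "inj_on (induced_val v e) D"
    using assms(1) by (simp add: ramified_line_def iso_def bij_betw_def)
  then show ?thesis
    by (rule inj_onD[OF _ _ assms(2,3)])
      (simp only: induced_val_power_class[OF assms(4)] induced_val_power_class[OF assms(5)] assms(6))
qed

lemma line_uniformiser_class:
  assumes "ramified_line R v e D" "line_uniformiser R v D \<pi>"
  shows "power_class e \<pi> \<in> D"
proof -
  obtain c where c: "c \<in> D" "\<pi> \<in> c" using assms(2) by (auto simp: line_uniformiser_def)
  then have "c \<in> carrier (mod_powers R e)"
    using assms(1) subgroup.subset by (fastforce simp: ramified_line_def)
  then obtain a where "a \<in> carrier R - {\<zero>}" "c = power_class e a" by (auto simp: carrier_mod_powers)
  then show ?thesis using power_class_eqI c by simp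
qed

text \<open>The powers of a uniformiser with exponent below \<open>e\<close> already realise every
  value modulo \<open>e\<close>, and within a ramified line the value determines the class.\<close>

lemma ramified_line_eq:
  assumes D: "ramified_line R v e D" "line_uniformiser R v D \<pi>" and e: "e > 0"
  shows "D = (\<lambda>k :: nat. power_class e (\<pi> [^] k)) ` UNIV"
proof (intro equalityI subsetI)
  have sg: "subgroup D (mod_powers R e)" using D(1) by (simp add: ramified_line_def)
  have p: "\<pi> \<in> carrier R - {\<zero>}" "v \<pi> = 1" using D(2) by (auto simp: line_uniformiser_def)
  have mem: "power_class e (\<pi> [^] k) \<in> D" for k :: nat
  proof (induct k)
    case 0 then show ?case using subgroup.one_closed[OF sg] by (simp add: one_mod_powers)
  next
    case (Suc k)
    then show ?case
      using subgroup.m_closed[OF sg Suc line_uniformiser_class[OF D]]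
        mult_mod_powers[OF pow_nonzero[OF p(1)] p(1), of e k] by simp
  qed
  then show "c \<in> D" if "c \<in> (\<lambda>k :: nat. power_class e (\<pi> [^] k)) ` UNIV" for c using that by blast
  fix c assume c: "c \<in> D"
  have bij: "bij_betw (induced_val v e) D (carrier (integer_mod_group e))"
    using D(1) by (simp add: ramified_line_def iso_def)
  then have "induced_val v e c \<in> {0..<int e}"
    using c e by (auto simp: bij_betw_def carrier_integer_mod_group)
  then obtain n where n: "induced_val v e c = int n" "n < e" by (metis atLeastLessThan_iff nat_less_iff nat_0_le)
  have "induced_val v e (power_class e (\<pi> [^] n)) = int n"
    using induced_val_power_class[OF pow_nonzero[OF p(1)], of e n] val_pow[OF p(1), of n] p(2) n(2) by simp
  then have "c = power_class e (\<pi> [^] n)"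
    using bij c mem[of n] n(1) by (metis bij_betw_def inj_onD)
  then show "c \<in> (\<lambda>k :: nat. power_class e (\<pi> [^] k)) ` UNIV" by blast
qed

lemma image_power_class:
  assumes g: "g \<in> ring_iso R R" and a: "a \<in> carrier R"
  shows "g ` power_class e a = power_class e (g a)"
proof -
  have gh: "g \<in> ring_hom R R" and gb: "bij_betw g (carrier R) (carrier R)" using g by (auto simp: ring_iso_def)
  interpret g: ring_hom_ring R R g by (rule ring_hom_ringI2[OF ring_axioms ring_axioms gh])
  have inj: "g x \<noteq> \<zero>" if "x \<in> carrier R - {\<zero>}" for x
    using that gb g.hom_zero by (metis DiffD1 DiffD2 bij_betw_def inj_onD insertI1 zero_closed)
  have surj: "\<exists>y \<in> carrier R - {\<zero>}. x = g y" if "x \<in> carrier R - {\<zero>}" for x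
    using that gb g.hom_zero by (metis DiffD1 DiffD2 DiffI bij_betw_imp_surj_on imageE singleton_iff)
  show ?thesis
  proof (intro equalityI subsetI)
    fix c assume "c \<in> g ` power_class e a"
    then obtain x where x: "x \<in> carrier R - {\<zero>}" "c = g (x [^] e \<otimes> a)" by (auto simp: power_class_def)
    then have "c = g x [^] e \<otimes> g a" using a g.hom_nat_pow[of x e] by simp
    then show "c \<in> power_class e (g a)" using x(1) inj[OF x(1)] by (auto simp: power_class_def)
  next
    fix c assume "c \<in> power_class e (g a)"
    then obtain x where x: "x \<in> carrier R - {\<zero>}" "c = x [^] e \<otimes> g a" by (rule power_classE)
    obtain y where y: "y \<in> carrier R - {\<zero>}" "x = g y" using surj[OF x(1)] by blast
    then have "c = g (y [^] e \<otimes> a)" using x a g.hom_nat_pow[of y e] by simp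
    then show "c \<in> g ` power_class e a" using y by (auto simp: power_class_def)
  qed
qed

end

text \<open>The quotient of \<open>a\<close> by \<open>b\<close> is a one-unit, and one-units are
  \<open>e\<close>-th powers because \<open>e\<close> is a unit of the valuation ring.\<close>

lemma (in complete_valued_field) power_class_of_congruence:
  assumes e: "add_pow R (e :: nat) \<one> \<noteq> \<zero>" "v (add_pow R e \<one>) = 0"
    and a: "a \<in> carrier R" and b: "b \<in> carrier R - {\<zero>}" and ab: "a \<ominus> b \<in> val_ideal (v b + 1)"
    and e_pos: "e > 0"
  shows "a \<in> power_class e b"
proof -
  have ib: "inv b \<in> carrier R" "b \<otimes> inv b = \<one>" "inv b \<otimes> b = \<one>" and bc: "b \<in> carrier R"
    using inv_nonzero[OF b] b by auto
  define u where "u = a \<otimes> inv b"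
  have uc: "u \<in> carrier R" using a ib by (simp add: u_def)
  have "a \<otimes> inv b \<ominus> b \<otimes> inv b = (a \<ominus> b) \<otimes> inv b" using a bc ib(1) by algebra
  then have "u \<ominus> \<one> = (a \<ominus> b) \<otimes> inv b" by (simp add: u_def ib)
  moreover have "inv b \<in> val_ideal (- v b)" using ib val_inv[OF b] by (simp add: mem_val_ideal)
  ultimately have "u \<ominus> \<one> \<in> val_ideal 1" using fil_mult[OF ab, of "inv b" "- v b"] by simp
  then obtain y where y: "y \<in> carrier R" "y \<ominus> \<one> \<in> val_ideal 1" "y [^] e = u"
    using one_unit_root[OF uc _ e] by metis
  have "y \<noteq> \<zero>" using val_eqI[of y \<one>] y val_one by simp
  moreover have "a = y [^] e \<otimes> b" using y(3) a ib bc by (simp add: u_def m_assoc)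
  ultimately show ?thesis using y(1) by (auto simp: power_class_def)
qed

context radical_extension
begin

text \<open>Zero lies in every step of the filtration, whereas a non-zero \<open>a\<close> has an
  image of order exactly \<open>int e * w a\<close>.\<close>

lemma emb_inj: "inj_on \<iota> (carrier F)"
proof (rule emb.trivial_ker_imp_inj)
  have ker: "a = \<zero>" if "a \<in> carrier F" "\<iota> a = \<zero>\<^bsub>L\<^esub>" for a
  proof (rule ccontr)
    assume "a \<noteq> \<zero>"
    moreover have "\<iota> a \<otimes>\<^bsub>L\<^esub> Y [^]\<^bsub>L\<^esub> (0 :: nat) \<in> fil (int e * w a + 1)" using that L.fil_zero by simp
    ultimately show False using monom_mem_fil[of a 0] that(1) by fastforce
  qed
  show "a_kernel F L \<iota> = {\<zero>}" unfolding a_kernel_def' using emb.hom_zero zero_closed ker by blast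
qed

end

text \<open>Over \<open>K\<close>, the field \<open>F\<close> is spanned by roots of unity of order prime to the residue
  characteristic, and a totally ramified extension contains no further ones.\<close>

lemma (in unramified_extension) hom_preserves_base:
  assumes p: "residue_char (F \<lparr> carrier := K \<rparr>) v p"
    and r: "radical_extension F w e \<pi>" and r': "radical_extension F w e \<pi>'"
    and h: "h \<in> ring_hom (radical_ext F e \<pi>) (radical_ext F e \<pi>')"
    and hK: "\<And>a. a \<in> K \<Longrightarrow> h (radical_emb F e \<pi> a) = radical_emb F e \<pi>' a"
    and x: "x \<in> carrier F"
  shows "h (radical_emb F e \<pi> x) \<in> radical_emb F e \<pi>' ` carrier F"
proof -
  interpret A: radical_extension F w e \<pi> by (rule r)
  interpret B: radical_extension F w e \<pi>' by (rule r')
  interpret h: ring_hom_ring A.L B.L h by (rule ring_hom_ringI2[OF A.L.ring_axioms B.L.ring_axioms h])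
  obtain N us where N: "N > 0" "add_pow F (N :: nat) \<one> \<noteq> \<zero>" "w (add_pow F N \<one>) = 0"
    "\<And>x. \<lbrakk> x \<in> val_ideal 0; x \<notin> val_ideal 1 \<rbrakk> \<Longrightarrow>
      \<exists>\<tau> \<in> carrier F. \<tau> [^] N = \<one> \<and> \<tau> \<ominus> x \<in> val_ideal 1"
    and us: "residually_spanning us" "\<And>u. u \<in> set us \<Longrightarrow> u = \<zero> \<or> u [^] N = \<one>"
    by (rule exists_teichmueller_span[OF p], rule that)
  have usc: "set us \<subseteq> carrier F" using us(1) fil_carrier by (auto simp: residually_spanning_def)
  have hu: "h (A.emb u) \<in> B.emb ` carrier F" if u: "u \<in> set us" for u
  proof (cases "u = \<zero>")
    case True
    then have "h (A.emb u) = B.emb \<zero>" by simp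
    then show ?thesis by blast
  next
    case False
    then have uN: "u \<in> carrier F" "u [^] N = \<one>" using us(2) u usc by auto
    have "h (A.emb u) [^]\<^bsub>B.L\<^esub> N = h (A.emb (u [^] N))"
      using uN(1) h.hom_nat_pow[of "A.emb u" N] A.emb.hom_nat_pow[OF uN(1), of N] by simp
    then have "h (A.emb u) [^]\<^bsub>B.L\<^esub> N = \<one>\<^bsub>B.L\<^esub>" using uN(2) by simp
    then show ?thesis using B.root_of_unity_in_base[OF N, of "h (A.emb u)"] uN(1) by auto
  qed
  have add: "s \<oplus>\<^bsub>B.L\<^esub> t \<in> B.emb ` carrier F" "s \<otimes>\<^bsub>B.L\<^esub> t \<in> B.emb ` carrier F"
    if st: "s \<in> B.emb ` carrier F" "t \<in> B.emb ` carrier F" for s t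
  proof -
    obtain a b where ab: "a \<in> carrier F" "s = B.emb a" "b \<in> carrier F" "t = B.emb b" using st by blast
    then have eq: "s \<oplus>\<^bsub>B.L\<^esub> t = B.emb (a \<oplus> b)" "s \<otimes>\<^bsub>B.L\<^esub> t = B.emb (a \<otimes> b)" by simp_all
    show "s \<oplus>\<^bsub>B.L\<^esub> t \<in> B.emb ` carrier F" "s \<otimes>\<^bsub>B.L\<^esub> t \<in> B.emb ` carrier F"
      unfolding eq using ab by (auto simp del: B.emb.hom_add B.emb.hom_mult)
  qed
  have zero: "\<zero>\<^bsub>B.L\<^esub> \<in> B.emb ` carrier F" using B.emb.hom_zero zero_closed by (metis imageI)
  have comb: "h (A.emb (combine Ks vs)) \<in> B.emb ` carrier F"
    if "set Ks \<subseteq> K" "set vs \<subseteq> set us" for Ks vs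
    using that
  proof (induct Ks vs rule: combine.induct)
    case (1 k Ks u vs)
    have c: "k \<in> carrier F" "u \<in> carrier F" "combine Ks vs \<in> carrier F"
      using 1(2,3) usc base_in_carrier by (auto intro!: combine_in_carrier)
    have "h (A.emb k) \<in> B.emb ` carrier F" using hK[of k] 1(2) c by auto
    then show ?case using 1 c add hu[of u] by simp
  next
    case ("2_1" us)
    show ?case using zero by simp
  next
    case ("2_2" Ks)
    show ?case using zero by simp
  qed
  have "x \<in> val_ideal (w x)" using x by (simp add: mem_val_ideal)
  then obtain B' where "set B' \<subseteq> K \<inter> val_ideal (w x)" "x = combine B' us"
    using residually_spanning_spans[OF us(1)] by metis
  then show ?thesis using comb[of B' us] by simp
qed

section \<open>The isomorphism criterion\<close>

lemma (in unramified_extension) isomorphism_imp_Gal: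
  assumes p: "residue_char (F \<lparr> carrier := K \<rparr>) v p"
    and r: "radical_extension F w e \<pi>" and r': "radical_extension F w e \<pi>'"
    and h: "h \<in> ring_iso (radical_ext F e \<pi>) (radical_ext F e \<pi>')"
    and hK: "\<And>a. a \<in> K \<Longrightarrow> h (radical_emb F e \<pi> a) = radical_emb F e \<pi>' a"
  obtains g where "g \<in> Gal F K"
    "\<And>x. x \<in> carrier F \<Longrightarrow> h (radical_emb F e \<pi> x) = radical_emb F e \<pi>' (g x)"
proof -
  interpret A: radical_extension F w e \<pi> by (rule r)
  interpret B: radical_extension F w e \<pi>' by (rule r')
  have hh: "h \<in> ring_hom A.L B.L" and hb: "bij_betw h (carrier A.L) (carrier B.L)" using h by (auto simp: ring_iso_def)
  interpret h: ring_hom_ring A.L B.L h by (rule ring_hom_ringI2[OF A.L.ring_axioms B.L.ring_axioms hh])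
  define k where "k = inv_into (carrier A.L) h"
  have k: "k \<in> ring_iso B.L A.L" unfolding k_def by (rule ring_iso_set_sym[OF A.L.ring_axioms h])
  have kh: "k (h y) = y" if "y \<in> carrier A.L" for y
    using hb that by (simp add: k_def bij_betw_def)
  have hk: "h (k y) = y" if "y \<in> carrier B.L" for y
    using hb that by (simp add: k_def bij_betw_def f_inv_into_f)
  have kK: "k (B.emb a) = A.emb a" if "a \<in> K" for a
    using kh[of "A.emb a"] hK[OF that] that base_in_carrier by auto
  have img: "\<exists>y \<in> carrier F. h (A.emb x) = B.emb y" if "x \<in> carrier F" for x
    using hom_preserves_base[OF p r r' hh hK that] by blast
  \<comment> \<open>The inverse isomorphism maps \<open>F\<close> into \<open>F\<close> as well;
    this will give surjectivity of \<open>g\<close>.\<close>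
  have img': "\<exists>y \<in> carrier F. k (B.emb x) = A.emb y" if x: "x \<in> carrier F" for x
  proof -
    have "k \<in> ring_hom B.L A.L" using k by (simp add: ring_iso_def)
    from hom_preserves_base[OF p r' r this kK x] show ?thesis by blast
  qed
  obtain g0 where g0: "\<And>x. x \<in> carrier F \<Longrightarrow> g0 x \<in> carrier F \<and> h (A.emb x) = B.emb (g0 x)"
    using img by metis
  \<comment> \<open>\<open>Gal\<close> consists of functions extensional on
    \<open>carrier F\<close>, hence the restriction.\<close>
  define g where "g = restrict g0 (carrier F)"
  have g: "g x \<in> carrier F" "h (A.emb x) = B.emb (g x)" if "x \<in> carrier F" for x
    using g0[OF that] that by (auto simp: g_def)
  have eqI: "x = y" if "x \<in> carrier F" "y \<in> carrier F" "B.emb x = B.emb y" for x y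
    using B.emb_inj that by (auto dest: inj_onD)
  have "g \<in> ring_hom F F"
  proof (rule ring_hom_memI)
    fix x y assume xy: "x \<in> carrier F" "y \<in> carrier F"
    have "B.emb (g (x \<otimes> y)) = h (A.emb (x \<otimes> y))"
      by (rule g(2)[symmetric]) (use xy in simp)
    also have "\<dots> = h (A.emb x) \<otimes>\<^bsub>B.L\<^esub> h (A.emb y)" using xy by simp
    also have "\<dots> = B.emb (g x \<otimes> g y)" using g xy by simp
    finally show "g (x \<otimes> y) = g x \<otimes> g y" using eqI g xy by simp
    have "B.emb (g (x \<oplus> y)) = h (A.emb (x \<oplus> y))"
      by (rule g(2)[symmetric]) (use xy in simp)
    also have "\<dots> = h (A.emb x) \<oplus>\<^bsub>B.L\<^esub> h (A.emb y)" using xy by simp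
    also have "\<dots> = B.emb (g x \<oplus> g y)" using g xy by simp
    finally show "g (x \<oplus> y) = g x \<oplus> g y" using eqI g xy by simp
  next
    have "B.emb (g \<one>) = h (A.emb \<one>)" by (rule g(2)[symmetric]) simp
    also have "\<dots> = B.emb \<one>" by simp
    finally show "g \<one> = \<one>" using eqI g by simp
  qed (use g in auto)
  moreover have "bij_betw g (carrier F) (carrier F)"
    unfolding bij_betw_def
  proof (intro conjI inj_onI equalityI subsetI)
    fix x y assume xy: "x \<in> carrier F" "y \<in> carrier F" "g x = g y"
    then have "h (A.emb x) = h (A.emb y)" using g by simp
    then have "A.emb x = A.emb y" using kh xy by (metis A.emb.hom_closed)
    then show "x = y" using A.emb_inj xy by (auto dest: inj_onD)
  next
    fix y assume y: "y \<in> carrier F"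
    then obtain x where x: "x \<in> carrier F" "k (B.emb y) = A.emb x" using img' by blast
    then have "B.emb (g x) = B.emb y" using g(2)[OF x(1)] hk[of "B.emb y"] y by simp
    then have "g x = y" using eqI g x(1) y by blast
    then show "y \<in> g ` carrier F" using x(1) by blast
  qed (use g in auto)
  moreover have "g a = a" if a: "a \<in> K" for a
    using eqI[of "g a" a] g[of a] hK[OF a] a base_in_carrier by auto
  ultimately have "g \<in> Gal F K" by (simp add: Gal_def ring_iso_def g_def)
  then show thesis using that g(2) by blast
qed

theorem (in unramified_extension) isomorphic_iff_Galois_conjugate:
  assumes p: "residue_char (F \<lparr> carrier := K \<rparr>) v p" and e: "e > 0" "\<not> p dvd e"
    and D: "ramified_line F w e D" "line_uniformiser F w D \<pi>"
    and D': "ramified_line F w e D'" "line_uniformiser F w D' \<pi>'"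
  shows "isomorphic_over K (radical_ext F e \<pi>) (radical_emb F e \<pi>)
                           (radical_ext F e \<pi>') (radical_emb F e \<pi>')
         \<longleftrightarrow> (\<exists>g \<in> Gal F K. D' = act_on_line g D)"
proof -
  have \<pi>: "\<pi> \<in> carrier F - {\<zero>}" "w \<pi> = 1" and \<pi>': "\<pi>' \<in> carrier F - {\<zero>}" "w \<pi>' = 1"
    using D(2) D'(2) by (auto simp: line_uniformiser_def)
  have r: "radical_extension F w e \<pi>" and r': "radical_extension F w e \<pi>'"
    using e(1) \<pi> \<pi>' by (auto intro!: radical_extension.intro radical_extension_axioms.intro discretely_valued_field_axioms)
  interpret A: radical_extension F w e \<pi> by (rule r)
  interpret B: radical_extension F w e \<pi>' by (rule r')
  have "Factorial_Ring.prime p" using p by (simp add: residue_char_def)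
  then have "coprime p e" using e(2) prime_imp_coprime by blast
  then have eu: "add_pow F e \<one> \<noteq> \<zero>" "w (add_pow F e \<one>) = 0"
    using coprime_unit[OF residue_char_lift[OF p]] by auto
  show ?thesis
  proof
    assume "isomorphic_over K A.L A.emb B.L B.emb"
    then obtain h where h: "h \<in> ring_iso A.L B.L" "\<And>a. a \<in> K \<Longrightarrow> h (A.emb a) = B.emb a"
      by (auto simp: isomorphic_over_def)
    obtain g where g: "g \<in> Gal F K" "\<And>x. x \<in> carrier F \<Longrightarrow> h (A.emb x) = B.emb (g x)"
      using isomorphism_imp_Gal[OF p r r' h] by metis
    have gi: "g \<in> ring_iso F F" using g(1) by (simp add: Gal_def)
    interpret g: ring_hom_ring F F g
      using gi by (intro ring_hom_ringI2[OF ring_axioms ring_axioms]) (simp add: ring_iso_def)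
    interpret h: ring_hom_ring A.L B.L h
      using h(1) by (intro ring_hom_ringI2[OF A.L.ring_axioms B.L.ring_axioms]) (simp add: ring_iso_def)
    have g\<pi>: "g \<pi> \<in> carrier F - {\<zero>}" "w (g \<pi>) = 1" using Gal_val[OF p g(1) \<pi>(1)] \<pi>(2) by auto
    have "g \<pi> \<in> power_class e \<pi>'"
    \<comment> \<open>For \<open>e = 1\<close> all non-zero elements form one class, while the
      comparison of leading terms requires \<open>e > 1\<close>.\<close>
    proof (cases "e = 1")
      case True
      have "g \<pi> = (g \<pi> \<otimes> inv \<pi>') [^] e \<otimes> \<pi>'"
        using True g\<pi>(1) \<pi>'(1) inv_nonzero[OF \<pi>'(1)] by (simp add: m_assoc)
      moreover have "g \<pi> \<otimes> inv \<pi>' \<in> carrier F - {\<zero>}"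
        using mult_nonzero[OF g\<pi>(1)] inv_nonzero[OF \<pi>'(1)] by blast
      ultimately show ?thesis unfolding power_class_def by blast
    next
      case False
      then have "e > 1" using e(1) by simp
      moreover have "h A.Y [^]\<^bsub>B.L\<^esub> e = B.emb (g \<pi>)"
        using h.hom_nat_pow[OF A.Y_closed, of e] g(2)[of \<pi>] \<pi>(1) by (simp add: A.Y_pow)
      moreover have "h A.Y \<in> carrier B.L" using A.Y_closed by simp
      ultimately obtain c where c: "c \<in> carrier F - {\<zero>}" "w c = 0" "g \<pi> \<ominus> c [^] e \<otimes> \<pi>' \<in> val_ideal 2"
        using B.radicand_congruence[OF _ _ _ g\<pi>] by metis
      \<comment> \<open>\<open>b\<close> lies in the class of \<open>\<pi>'\<close> and has
        valuation 1, so a congruence modulo \<open>val_ideal 2\<close> makes \<open>g \<pi>\<close>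
        equal to \<open>b\<close> up to a one-unit.\<close>
      define b where "b = c [^] e \<otimes> \<pi>'"
      have b: "b \<in> carrier F - {\<zero>}" unfolding b_def by (rule mult_nonzero[OF pow_nonzero[OF c(1)] \<pi>'(1)])
      have "w b = 1" unfolding b_def using val_mult[OF pow_nonzero[OF c(1)] \<pi>'(1)] val_pow[OF c(1)] c(2) \<pi>'(2) by simp
      then have "g \<pi> \<in> power_class e b"
        using power_class_of_congruence[OF eu _ b _ e(1)] g\<pi>(1) c(3) by (simp add: b_def)
      moreover have "b \<in> power_class e \<pi>'" unfolding b_def power_class_def using c(1) by blast
      ultimately show ?thesis using power_class_eqI[OF \<pi>'(1)] by blast
    qed
    \<comment> \<open>Equality of the classes of the uniformisers passes to all powers, and these
      make up the two lines.\<close>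
    then have "power_class e (g \<pi> [^] k) = power_class e (\<pi>' [^] k)" for k :: nat
      using power_class_eqI[OF pow_nonzero[OF \<pi>'(1)] power_class_pow[OF \<pi>'(1)]] by blast
    moreover have "g ` power_class e (\<pi> [^] k) = power_class e (g \<pi> [^] k)" for k :: nat
      using image_power_class[OF gi, of "\<pi> [^] k" e] g.hom_nat_pow[of \<pi> k] \<pi>(1) by simp
    ultimately have "act_on_line g D = D'"
      unfolding act_on_line_def ramified_line_eq[OF D e(1)] ramified_line_eq[OF D' e(1)]
      by (simp add: image_image)
    then show "\<exists>g \<in> Gal F K. D' = act_on_line g D" using g(1) by blast
  next
    assume "\<exists>g \<in> Gal F K. D' = act_on_line g D"
    then obtain g where g: "g \<in> Gal F K" "D' = act_on_line g D" by blast
    have gi: "g \<in> ring_iso F F" using g(1) by (simp add: Gal_def)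
    have g\<pi>: "g \<pi> \<in> carrier F - {\<zero>}" "w (g \<pi>) = 1" using Gal_val[OF p g(1) \<pi>(1)] \<pi>(2) by auto
    have "g ` power_class e \<pi> \<in> D'"
      using line_uniformiser_class[OF D] g(2) by (auto simp: act_on_line_def)
    then have "power_class e (g \<pi>) \<in> D'" using image_power_class[OF gi] \<pi>(1) by simp
    \<comment> \<open>Both classes lie in \<open>D'\<close> and have value 1, and the value is
      injective on a ramified line.\<close>
    then have "power_class e \<pi>' = power_class e (g \<pi>)"
      using ramified_line_inj[OF D'(1) line_uniformiser_class[OF D']] \<pi>' g\<pi> by simp
    then have "\<pi>' \<in> power_class e (g \<pi>)" using power_class_self[OF \<pi>'(1), of e] by simp
    then obtain x where x: "x \<in> carrier F - {\<zero>}" "\<pi>' = x [^] e \<otimes> g \<pi>" by (rule power_classE)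
    obtain h where h: "h \<in> ring_iso A.L B.L" "\<And>a. a \<in> carrier F \<Longrightarrow> h (A.emb a) = B.emb (g a)"
      using radical_ext_iso[OF r r' gi x] by metis
    have "h (A.emb a) = B.emb a" if "a \<in> K" for a
      using h(2)[of a] that g(1) base_in_carrier by (auto simp: Gal_def)
    then show "isomorphic_over K A.L A.emb B.L B.emb" using h(1) by (auto simp: isomorphic_over_def)
  qed
qed

theorem mainTheorem1:
  fixes Kf :: "('a, 'b) ring_scheme" and w :: "'a \<Rightarrow> int"
    and K :: "'a set" and v :: "'a \<Rightarrow> int"
    and p e f :: nat and D D' :: "'a set set" and \<pi> \<pi>' :: 'a
  assumes "local_field (Kf \<lparr> carrier := K \<rparr>) v"
    and "residue_char (Kf \<lparr> carrier := K \<rparr>) v p"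
    and "e > 0" and "\<not> p dvd e" and "f > 0"
    and "unramified_extension Kf w K v f"
    and "ramified_line Kf w e D" and "ramified_line Kf w e D'"
    and "line_uniformiser Kf w D \<pi>" and "line_uniformiser Kf w D' \<pi>'"
  shows "isomorphic_over K (radical_ext Kf e \<pi>) (radical_emb Kf e \<pi>)
                           (radical_ext Kf e \<pi>') (radical_emb Kf e \<pi>')
         \<longleftrightarrow> (\<exists>\<sigma> \<in> Gal Kf K. D' = act_on_line \<sigma> D)"
  by (rule unramified_extension.isomorphic_iff_Galois_conjugate[OF assms(6,2,3,4,7,9,8,10)])

end
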